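(* Let $\Bbbk$ be a unital commutative ring. The twisted composite product $\mathrm{Lie}^{\diamond}_3\circ_{\tilde\kappa}\mathrm{Lie}$ satisfies $$H_r\big((\mathrm{Lie}^{\diamond}_3\circ_{\tilde\kappa}\mathrm{Lie})(n)\big)=0$$ for all $r\le 3$ in all arities $n$.
   Context: Conventions. Chain complexes are $\mathbb{Z}$-graded complexes of $\Bbbk$-modules with differential of degree $-1$; the Koszul sign rule is used. A dg $\mathbb{S}$-module $M$ is a family of dg right $\Bbbk[\mathbb{S}_n]$-modules $M(n)$, $n\ge 0$. Permutations are in cycle notation ($(123)$ means $1\mapsto2\mapsto3\mapsto1$) and composed as functions; $x^\sigma$ is the right action, normalized so that for multilinear operations $\mu^\sigma(v_1,\dots,v_n)=\pm\mu(v_{\sigma^{-1}(1)},\dots,v_{\sigma^{-1}(n)})$ ($\pm$ the Koszul sign). The composite product is $(M\circ N)(n)=\bigoplus_m\bigoplus_{n=n_1+\dots+n_m}M(m)\otimes_{\mathbb{S}_m}\mathrm{Ind}_{\mathbb{S}_{n_1}\times\dots\times\mathbb{S}_{n_m}}^{\mathbb{S}_n}(N(n_1)\otimes\dots\otimes N(n_m))$ with differential $d^{M\circ N}=d^M\circ 1+1\circ' d^N$ (apply $d^M$ to the $M$-factor, resp. $d^N$ to each $N$-factor in turn, with Koszul signs). $\mu\circ(\nu_1,\dots,\nu_m)$ is an elementary element, $\mu\circ(\nu_1,\dots,\nu_m)^\sigma$ its image under $\sigma$. $\mathrm{I}=(0,\Bbbk,0,\dots)$. $M\circ_{(1)}N\subset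 M\circ(\mathrm{I}\oplus N)$ is the part linear in $N$. For a cooperad $\mathcal{C}$ the partial decomposition $\Delta_{(1)}\colon\mathcal{C}\to\mathcal{C}\circ_{(1)}\mathcal{C}$ is obtained from $\Delta$ by corestriction. For a dg cooperad $\mathcal{C}$ and operad $\mathcal{P}$ with composition $\gamma$, and a degree $-1$ twisting morphism $\alpha\colon\mathcal{C}\to\mathcal{P}$, the twisted composite product $\mathcal{C}\circ_\alpha\mathcal{P}$ is $\mathcal{C}\circ\mathcal{P}$ with differential $d^{\mathcal{C}\circ\mathcal{P}}+d_\alpha$, where $d_\alpha$ is the composite $$\mathcal{C}\circ\mathcal{P}\xrightarrow{\Delta_{(1)}\circ1}(\mathcal{C}\circ_{(1)}\mathcal{C})\circ\mathcal{P}\xrightarrow{(1\circ_{(1)}\alpha)\circ1}(\mathcal{C}\circ_{(1)}\mathcal{P})\circ\mathcal{P}\cong\mathcal{C}\circ(\mathcal{P};\mathcal{P}\circ\mathcal{P})\xrightarrow{1\circ(1;\gamma)}\mathcal{C}\circ(\mathcal{P};\mathcal{P})\to\mathcal{C}\circ\mathcal{P},$$ with $M\circ(N_1;N_2)\subset M\circ(N_1\oplus N_2)$ the part linear in $N_2$. $\mathrm{Lie}$ is the operad of Lie algebras over $\Bbbk$ (concentrated in degree 0), generated by a bracket $b\in\mathrm{Lie}(2)$ with $b^{(12)}=-b$ subject to the Jacobi identity. $\tilde\kappa\colon\mathrm{Lie}^{\diamond}_3\to\mathrm{Lie}$ is the equivariant degree $-1$ map with $\tilde\kappa(l_2)=b$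 and vanishing on all other generators below. (It equals $\kappa\circ\psi$, where $\psi\colon\mathrm{Lie}^\diamond_3\to\mathrm{Lie}^{¡}$ is the morphism to the Koszul dual cooperad of $\mathrm{Lie}$ given by $\psi(l_n^\sigma)=(-1)^{|\sigma|}\bar l_n$ and zero on the remaining generators, and $\kappa\colon\mathrm{Lie}^{¡}\to\mathrm{Lie}$ is the canonical twisting morphism.) The dg cooperad $\mathrm{Lie}^{\diamond}_3$. $\mathrm{Lie}^{\diamond}_3(0)=0$, $\mathrm{Lie}^{\diamond}_3(1)=\Bbbk$ in degree $0$ spanned by $1=:l_1$, $\mathrm{Lie}^{\diamond}_3(n)=0$ for $n\ge6$. In arities $2\le n\le5$ it is the free graded $\Bbbk[\mathbb{S}_n]$-module on: arity 2: $l_2$ (degree 1), $l_{2;1}$ (degree 2), $l_{2;1,1}$ (degree 3), $l_{2;1,1,1}$ (degree 4); arity 3: $l_3$ (degree 2), $l_{3;1},l_{3;2}$ (degree 3), $l_{3;1,1},l_{3;1,2},l_{3;2,2}$ (degree 4); arity 4: $l_4$ (degree 3), $l_{4;1},l_{4;2},l_{4;3}$ (degree 4); arity 5: $l_5$ (degree 4). The equivariant differential is: $d l_n=0$; $d l_{2;1}=-l_2-l_2^{(12)}$; $d l_{2;1,1}=-l_{2;1}+l_{2;1}^{(12)}$; $d l_{2;1,1,1}=-l_{2;1,1}-l_{2;1,1}^{(12)}$; $d l_{3;1}=-l_3-l_3^{(12)}$; $d l_{3;2}=-l_3-l_3^{(23)}$; $d l_{3;1,1}=-l_{3;1}+l_{3;1}^{(12)}$;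 $d l_{3;1,2}=l_{3;1}+l_{3;1}^{(23)}+l_{3;1}^{(132)}-l_{3;2}-l_{3;2}^{(12)}-l_{3;2}^{(123)}$; $d l_{3;2,2}=-l_{3;2}+l_{3;2}^{(23)}$; $d l_{4;1}=-l_4-l_4^{(12)}$; $d l_{4;2}=-l_4-l_4^{(23)}$; $d l_{4;3}=-l_4-l_4^{(34)}$. The decomposition map $\Delta$ is $\mathbb{S}$-equivariant, $\Delta(1)=1\circ(1)$, and $\Delta(\mu)=1\circ(\mu)+\bar\Delta(\mu)+\mu\circ(1,\dots,1)$ for $\mu$ of arity $\ge2$. For $2\le n\le 5$: $$\Delta(l_n)=\sum_{1\le j\le n,\ i_1+\dots+i_j=n,\ i_p\ge1}(-1)^{(j-1)(n-j)}(-1)^{\sum_{p=1}^{j}(p-1)(i_p-1)}\sum_{\sigma\in\overline{\mathrm{Sh}}^{-1}(i_1,\dots,i_j)}(-1)^{|\sigma|}\,l_j\circ(l_{i_1},\dots,l_{i_j})^\sigma,$$ where $\overline{\mathrm{Sh}}^{-1}(i_1,\dots,i_j)$ is the set of inverses of reduced shuffles; a shuffle $\tau\in\mathbb{S}_n$ is increasing on each of the consecutive blocks of sizes $i_1,\dots,i_j$, and it is reduced if $\tau(i_1)<\tau(i_1+i_2)<\dots<\tau(i_1+\dots+i_j)$. On the other generators: $\bar\Delta(l_{2;1})=\bar\Delta(l_{2;1,1})=\bar\Delta(l_{2;1,1,1})=0$; $\bar\Delta(l_{3;1})=l_2\circ(l_{2;1},1)$; $\bar\Delta(l_{3;2})=-l_{2;1}\circ(l_2,1)-l_2\circ(1,l_{2;1})-l_{2;1}\circ(1,l_2)^{(12)}$;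 $\bar\Delta(l_{3;1,1})=-l_2\circ(l_{2;1,1},1)$; $\bar\Delta(l_{3;1,2})=-l_{2;1}\circ(l_{2;1},1)-l_{2;1}\circ(1,l_{2;1})-l_{2;1}\circ(1,l_{2;1})^{(12)}+l_{2;1,1}\circ(1,l_2)^{(132)}$; $\bar\Delta(l_{3;2,2})=-l_{2;1,1}\circ(l_2,1)+l_2\circ(1,l_{2;1,1})-l_{2;1,1}\circ(1,l_2)^{(12)}$; $\bar\Delta(l_{4;1})=-l_2\circ(l_{3;1},1)-l_2\circ(1,l_{3;1})^{(123)}+l_2\circ(l_{2;1},l_2)+l_3\circ(l_{2;1},1,1)+l_{3;1}\circ(1,1,l_2)$; $\bar\Delta(l_{4;2})=-l_2\circ(l_{3;2},1)-l_2\circ(1,l_{3;1})+l_2\circ(l_{2;1},l_2)^{(132)}+l_{3;1}\circ(l_2,1,1)+l_{3;1}\circ(1,l_2,1)^{(12)}-l_3\circ(1,l_{2;1},1)+l_{3;1}\circ(1,1,l_2)^{(132)}$; $\bar\Delta(l_{4;3})=l_{2;1}\circ(1,l_3)^{(123)}-l_2\circ(1,l_{3;2})+l_2\circ(1,l_{3;2})^{(12)}+l_{2;1}\circ(l_3,1)-l_2\circ(l_2,l_{2;1})-l_{2;1}\circ(l_2,l_2)^{(132)}+l_{2;1}\circ(l_2,l_2)^{(23)}+l_{3;2}\circ(l_2,1,1)-l_{3;2}\circ(1,1,l_2)^{(23)}+l_{3;2}\circ(1,1,l_2)^{(132)}+l_3\circ(1,1,l_{2;1})-l_{3;2}\circ(1,l_2,1)+l_{3;2}\circ(1,l_2,1)^{(12)}$.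 With these data $\mathrm{Lie}^\diamond_3$ is a dg cooperad.
   Formalization: The single case of arity n = 1 and degree r = 0 is excluded, because there the complex is the ground ring in degree 0 with zero differential, so H_0 is the ring itself and not 0; the ground ring is assumed to be nonzero. *)

theory Defs
  imports Complex_Main "HOL-Library.Poly_Mapping" "HOL-Combinatorics.Permutations" "HOL-Combinatorics.Cycles"
begin

section \<open>Free modules\<close>

definition pscale :: "'k::comm_ring_1 \<Rightarrow> ('g \<Rightarrow>\<^sub>0 'k) \<Rightarrow> ('g \<Rightarrow>\<^sub>0 'k)" where
  "pscale c x = Poly_Mapping.map (\<lambda>a. c * a) x"

lemma lookup_pscale: "Poly_Mapping.lookup (pscale c x) g = c * Poly_Mapping.lookup x g"
  by (simp add: pscale_def Poly_Mapping.map.rep_eq when_def)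

global_interpretation free_mod: module "pscale :: 'k::comm_ring_1 \<Rightarrow> ('g \<Rightarrow>\<^sub>0 'k) \<Rightarrow> ('g \<Rightarrow>\<^sub>0 'k)"
  by unfold_locales
    (auto intro!: poly_mapping_eqI simp: lookup_pscale lookup_add algebra_simps)

text \<open>Linear extension from the basis.\<close>

definition lin :: "('g \<Rightarrow> ('h \<Rightarrow>\<^sub>0 'k)) \<Rightarrow> ('g \<Rightarrow>\<^sub>0 'k) \<Rightarrow> ('h \<Rightarrow>\<^sub>0 'k::comm_ring_1)" where
  "lin f x = (\<Sum>g\<in>Poly_Mapping.keys x. pscale (Poly_Mapping.lookup x g) (f g))"

definition ksign :: "int \<Rightarrow> 'k::comm_ring_1" where
  "ksign e = (if even e then 1 else - 1)"

section \<open>Presented dg S-modules\<close>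

text \<open>
  A dg S-module is given by a presentation: a set \<open>gens\<close> of generators, each with an arity and a
  degree and permuted by the right action of the symmetric groups, and a set \<open>rels\<close> of relators.
  The module it denotes is the free module on \<open>gens\<close> modulo the span of \<open>rels\<close>. All keys of a
  relator lie in \<open>gens\<close> and have the same arity and degree, and the span of \<open>rels\<close> is stable under
  the action and the differential. A permutation of \<open>{1..n}\<close> is a function
  \<open>\<sigma> :: nat \<Rightarrow> nat\<close> with \<open>\<sigma> permutes {1..n}\<close>.
\<close>

record (overloaded) ('g, 'k::zero) dg_smod =
  gens :: "'g set"
  ar :: "'g \<Rightarrow> nat"
  dgr :: "'g \<Rightarrow> int"
  act :: "'g \<Rightarrow> (nat \<Rightarrow> nat) \<Rightarrow> 'g"
  rels :: "('g \<Rightarrow>\<^sub>0 'k) set"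
  diff :: "'g \<Rightarrow> ('g \<Rightarrow>\<^sub>0 'k)"

definition dg_chains :: "('g, 'k::comm_ring_1, 'z) dg_smod_scheme \<Rightarrow> nat \<Rightarrow> int \<Rightarrow> ('g \<Rightarrow>\<^sub>0 'k) set" where
  "dg_chains X n r = {x. Poly_Mapping.keys x \<subseteq> {g \<in> gens X. ar X g = n \<and> dgr X g = r}}"

definition dg_cycles :: "('g, 'k::comm_ring_1, 'z) dg_smod_scheme \<Rightarrow> nat \<Rightarrow> int \<Rightarrow> ('g \<Rightarrow>\<^sub>0 'k) set" where
  "dg_cycles X n r = {x \<in> dg_chains X n r. lin (diff X) x \<in> free_mod.span (rels X)}"

definition dg_boundaries :: "('g, 'k::comm_ring_1, 'z) dg_smod_scheme \<Rightarrow> nat \<Rightarrow> int \<Rightarrow> ('g \<Rightarrow>\<^sub>0 'k) set" where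
  "dg_boundaries X n r = {x \<in> dg_chains X n r.
     \<exists>y \<in> dg_chains X n (r + 1). x - lin (diff X) y \<in> free_mod.span (rels X)}"

text \<open>
  Cycles and boundaries are taken in the free module, as the preimages of those of the presented
  complex, so that their quotient is the homology of the latter. Its zero element is the coset
  \<open>dg_boundaries X n r\<close>.
\<close>

definition homology :: "('g, 'k::comm_ring_1, 'z) dg_smod_scheme \<Rightarrow> nat \<Rightarrow> int \<Rightarrow> ('g \<Rightarrow>\<^sub>0 'k) set set" where
  "homology X n r = dg_cycles X n r // {(x, y). x - y \<in> dg_boundaries X n r}"

definition homology_vanishes :: "('g, 'k::comm_ring_1, 'z) dg_smod_scheme \<Rightarrow> nat \<Rightarrow> int \<Rightarrow> bool" where
  "homology_vanishes X n r \<longleftrightarrow> homology X n r = {dg_boundaries X n r}"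

section \<open>Block permutations\<close>

text \<open>
  \<open>{1..n}\<close> is cut into consecutive blocks of sizes \<open>ns\<close>. \<open>blk ns k\<close> is the number (from 1) of the
  block containing \<open>k\<close>, and \<open>off ns j\<close> is the total size of the blocks before the \<open>j\<close>-th one.
\<close>

primrec blk :: "nat list \<Rightarrow> nat \<Rightarrow> nat" where
  "blk [] k = 1"
| "blk (n # ns) k = (if k \<le> n then 1 else Suc (blk ns (k - n)))"

definition off :: "nat list \<Rightarrow> nat \<Rightarrow> nat" where
  "off ns j = sum_list (take (j - 1) ns)"

text \<open>The image of \<open>(\<tau>\<^sub>1, \<dots>, \<tau>\<^sub>m)\<close> under the inclusion of the Young subgroup.\<close>

definition block_sum :: "nat list \<Rightarrow> (nat \<Rightarrow> nat) list \<Rightarrow> nat \<Rightarrow> nat" where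
  "block_sum ns \<tau>s k =
     (if k \<in> {1..sum_list ns} then let j = blk ns k in off ns j + (\<tau>s ! (j - 1)) (k - off ns j) else k)"

text \<open>\<open>perm_list \<sigma> [x\<^sub>1, \<dots>, x\<^sub>m]\<close> has \<open>x\<^sub>j\<close> with \<open>\<sigma> j = i\<close> in position \<open>i\<close>.\<close>

definition perm_list :: "(nat \<Rightarrow> nat) \<Rightarrow> 'a list \<Rightarrow> 'a list" where
  "perm_list \<sigma> xs = map (\<lambda>i. xs ! (inv \<sigma> i - 1)) [1..<Suc (length xs)]"

text \<open>
  The permutation that moves the \<open>j\<close>-th block, as a whole, to the \<open>\<sigma> j\<close>-th place; afterwards the
  block sizes are \<open>perm_list \<sigma> ns\<close>.
\<close>

definition block_perm :: "(nat \<Rightarrow> nat) \<Rightarrow> nat list \<Rightarrow> nat \<Rightarrow> nat" where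
  "block_perm \<sigma> ns k =
     (if k \<in> {1..sum_list ns}
      then let j = blk ns k
           in (\<Sum>i \<in> {i \<in> {1..length ns}. \<sigma> i < \<sigma> j}. ns ! (i - 1)) + (k - off ns j)
      else k)"

text \<open>The Koszul sign of permuting elements of degrees \<open>ds\<close> by \<open>perm_list \<sigma>\<close>.\<close>

definition koszul :: "(nat \<Rightarrow> nat) \<Rightarrow> int list \<Rightarrow> 'k::comm_ring_1" where
  "koszul \<sigma> ds = ksign (\<Sum>(i, j) \<in> {(i, j). 1 \<le> i \<and> i < j \<and> j \<le> length ds \<and> \<sigma> j < \<sigma> i}.
     ds ! (i - 1) * ds ! (j - 1))"

section \<open>The composite product\<close>

text \<open>The triple \<open>(\<mu>, [\<nu>\<^sub>1, \<dots>, \<nu>\<^sub>m], \<sigma>)\<close> stands for the elementary element \<open>\<mu> \<circ> (\<nu>\<^sub>1, \<dots>, \<nu>\<^sub>m)\<^sup>\<sigma>\<close>.\<close>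

type_synonym ('a, 'b) elem = "'a \<times> 'b list \<times> (nat \<Rightarrow> nat)"

definition composite_gens ::
    "('a, 'k::zero, 'y) dg_smod_scheme \<Rightarrow> ('b, 'k, 'z) dg_smod_scheme \<Rightarrow> ('a, 'b) elem set" where
  "composite_gens M N = {(\<mu>, \<nu>s, \<sigma>). \<mu> \<in> gens M \<and> set \<nu>s \<subseteq> gens N \<and> length \<nu>s = ar M \<mu> \<and>
     \<sigma> permutes {1..sum_list (map (ar N) \<nu>s)}}"

text \<open>
  The relators express, in this order: the relations of \<open>M\<close>; the relations of \<open>N\<close> in each slot;
  the identification of \<open>(\<nu>\<^sub>1\<^bsup>\<tau>\<^sub>1\<^esup>, \<dots>, \<nu>\<^sub>m\<^bsup>\<tau>\<^sub>m\<^esup>)\<close> made by the induction from the Young subgroup; and the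
  tensor product over \<open>S\<^sub>m\<close>, where \<open>\<mu>\<^sup>\<tau> \<circ> (\<nu>\<^sub>1, \<dots>, \<nu>\<^sub>m)\<close> is, up to the Koszul sign, \<open>\<mu>\<close> composed
  with the permuted \<open>\<nu>\<close>s, followed by the block permutation of the inputs.
\<close>

definition composite_rels ::
    "('a, 'k::comm_ring_1, 'y) dg_smod_scheme \<Rightarrow> ('b, 'k, 'z) dg_smod_scheme \<Rightarrow> (('a, 'b) elem \<Rightarrow>\<^sub>0 'k) set" where
  "composite_rels M N =
     {lin (\<lambda>\<mu>. Poly_Mapping.single (\<mu>, \<nu>s, \<sigma>) 1) x | x \<nu>s \<sigma>.
        x \<in> rels M \<and> (\<forall>\<mu> \<in> Poly_Mapping.keys x. (\<mu>, \<nu>s, \<sigma>) \<in> composite_gens M N)}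
   \<union> {lin (\<lambda>\<nu>. Poly_Mapping.single (\<mu>, \<nu>s[i := \<nu>], \<sigma>) 1) x | x \<mu> \<nu>s i \<sigma>.
        x \<in> rels N \<and> i < length \<nu>s \<and> (\<forall>\<nu> \<in> Poly_Mapping.keys x. (\<mu>, \<nu>s[i := \<nu>], \<sigma>) \<in> composite_gens M N)}
   \<union> {Poly_Mapping.single (\<mu>, map2 (act N) \<nu>s \<tau>s, \<sigma>) 1
        - Poly_Mapping.single (\<mu>, \<nu>s, block_sum (map (ar N) \<nu>s) \<tau>s \<circ> \<sigma>) 1 | \<mu> \<nu>s \<tau>s \<sigma>.
        (\<mu>, \<nu>s, \<sigma>) \<in> composite_gens M N \<and> length \<tau>s = length \<nu>s \<and>
        (\<forall>i < length \<nu>s. \<tau>s ! i permutes {1..ar N (\<nu>s ! i)})}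
   \<union> {Poly_Mapping.single (act M \<mu> \<tau>, \<nu>s, \<sigma>) 1
        - Poly_Mapping.single (\<mu>, perm_list \<tau> \<nu>s, block_perm \<tau> (map (ar N) \<nu>s) \<circ> \<sigma>)
            (koszul \<tau> (map (dgr N) \<nu>s)) | \<mu> \<nu>s \<tau> \<sigma>.
        (\<mu>, \<nu>s, \<sigma>) \<in> composite_gens M N \<and> \<tau> permutes {1..length \<nu>s}}"

definition composite_diff ::
    "('a, 'k::comm_ring_1, 'y) dg_smod_scheme \<Rightarrow> ('b, 'k, 'z) dg_smod_scheme \<Rightarrow> ('a, 'b) elem \<Rightarrow> (('a, 'b) elem \<Rightarrow>\<^sub>0 'k)" where
  "composite_diff M N = (\<lambda>(\<mu>, \<nu>s, \<sigma>).
     lin (\<lambda>\<mu>'. Poly_Mapping.single (\<mu>', \<nu>s, \<sigma>) 1) (diff M \<mu>)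
     + (\<Sum>i < length \<nu>s. pscale (ksign (dgr M \<mu> + (\<Sum>j < i. dgr N (\<nu>s ! j))))
          (lin (\<lambda>\<nu>. Poly_Mapping.single (\<mu>, \<nu>s[i := \<nu>], \<sigma>) 1) (diff N (\<nu>s ! i)))))"

definition composite ::
    "('a, 'k::comm_ring_1, 'y) dg_smod_scheme \<Rightarrow> ('b, 'k, 'z) dg_smod_scheme \<Rightarrow> (('a, 'b) elem, 'k) dg_smod" where
  "composite M N = \<lparr>
     gens = composite_gens M N,
     ar = (\<lambda>(\<mu>, \<nu>s, \<sigma>). sum_list (map (ar N) \<nu>s)),
     dgr = (\<lambda>(\<mu>, \<nu>s, \<sigma>). dgr M \<mu> + sum_list (map (dgr N) \<nu>s)),
     act = (\<lambda>(\<mu>, \<nu>s, \<sigma>) \<tau>. (\<mu>, \<nu>s, \<sigma> \<circ> \<tau>)),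
     rels = composite_rels M N,
     diff = composite_diff M N\<rparr>"

section \<open>The twisted composite product\<close>

text \<open>\<open>gam p [q\<^sub>1, \<dots>, q\<^sub>k]\<close> is the image of \<open>p \<circ> (q\<^sub>1, \<dots>, q\<^sub>k)\<close> under the composition of the operad.\<close>

record (overloaded) ('g, 'k::zero) dg_operad = "('g, 'k) dg_smod" +
  op_unit :: "'g \<Rightarrow>\<^sub>0 'k"
  gam :: "'g \<Rightarrow> 'g list \<Rightarrow> ('g \<Rightarrow>\<^sub>0 'k)"

record (overloaded) ('g, 'k::zero) dg_cooperad = "('g, 'k) dg_smod" +
  counit :: "'g \<Rightarrow> 'k"
  dec :: "'g \<Rightarrow> (('g, 'g) elem \<Rightarrow>\<^sub>0 'k)"

text \<open>
  The quadruple \<open>(\<mu>, i, \<nu>, \<sigma>)\<close> stands for the elementary element \<open>\<mu> \<circ> (1, \<dots>, 1, \<nu>, 1, \<dots>, 1)\<^sup>\<sigma>\<close> of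
  the infinitesimal composite product, with \<open>\<nu>\<close> preceded by \<open>i\<close> copies of the generator of \<open>I\<close>.
\<close>

type_synonym ('a, 'b) inf_elem = "'a \<times> nat \<times> 'b \<times> (nat \<Rightarrow> nat)"

text \<open>
  The partial decomposition: in each term of the decomposition one entry is kept and the counit is
  applied to the others.
\<close>

definition part_dec :: "('c, 'k::comm_ring_1, 'z) dg_cooperad_scheme \<Rightarrow> 'c \<Rightarrow> (('c, 'c) inf_elem \<Rightarrow>\<^sub>0 'k)" where
  "part_dec C \<mu> = lin (\<lambda>(\<mu>', \<nu>s, \<sigma>). \<Sum>i < length \<nu>s.
     Poly_Mapping.single (\<mu>', i, \<nu>s ! i, \<sigma>) (\<Prod>j \<in> {..<length \<nu>s} - {i}. counit C (\<nu>s ! j))) (dec C \<mu>)"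

text \<open>The map induced by a map \<open>\<alpha>\<close> of degree \<open>-1\<close>, which produces a sign when it passes \<open>\<mu>\<close>.\<close>

definition inf_map ::
    "('c, 'k::comm_ring_1, 'z) dg_smod_scheme \<Rightarrow> ('c \<Rightarrow> ('p \<Rightarrow>\<^sub>0 'k)) \<Rightarrow> ('c, 'c) inf_elem \<Rightarrow> (('c, 'p) inf_elem \<Rightarrow>\<^sub>0 'k)" where
  "inf_map C \<alpha> = (\<lambda>(\<mu>, i, \<nu>, \<sigma>).
     pscale (ksign (dgr C \<mu>)) (lin (\<lambda>p. Poly_Mapping.single (\<mu>, i, p, \<sigma>) 1) (\<alpha> \<nu>)))"

text \<open>
  The image of \<open>(\<mu> \<circ> (1, \<dots>, p, \<dots>, 1)\<^sup>\<sigma>) \<circ> (\<nu>\<^sub>1, \<dots>, \<nu>\<^sub>m)\<^sup>\<rho>\<close> in \<open>C \<circ> P\<close>. The permutation \<open>\<sigma>\<close> is first moved to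
  the right, as in the tensor product over \<open>S\<^sub>m\<close>; then \<open>p\<close> passes the first \<open>i\<close> of the permuted \<open>\<nu>\<close>s
  and is composed with the following \<open>ar p\<close> of them.
\<close>

definition inf_gam ::
    "('p, 'k::comm_ring_1, 'z) dg_operad_scheme \<Rightarrow> (('c, 'p) inf_elem, 'p) elem \<Rightarrow> (('c, 'p) elem \<Rightarrow>\<^sub>0 'k)" where
  "inf_gam P = (\<lambda>((\<mu>, i, p, \<sigma>), \<nu>s, \<rho>).
     let \<xi>s = perm_list \<sigma> \<nu>s; k = ar P p in
     pscale (koszul \<sigma> (map (dgr P) \<nu>s) * ksign (dgr P p * (\<Sum>j < i. dgr P (\<xi>s ! j))))
       (lin (\<lambda>q. Poly_Mapping.single
               (\<mu>, take i \<xi>s @ q # drop (i + k) \<xi>s, block_perm \<sigma> (map (ar P) \<nu>s) \<circ> \<rho>) 1)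
          (gam P p (take k (drop i \<xi>s)))))"

definition twist ::
    "('c, 'k::comm_ring_1, 'y) dg_cooperad_scheme \<Rightarrow> ('c \<Rightarrow> ('p \<Rightarrow>\<^sub>0 'k)) \<Rightarrow> ('p, 'k, 'z) dg_operad_scheme
      \<Rightarrow> ('c, 'p) elem \<Rightarrow> (('c, 'p) elem \<Rightarrow>\<^sub>0 'k)" where
  "twist C \<alpha> P = (\<lambda>(\<mu>, \<nu>s, \<rho>).
     lin (\<lambda>x. inf_gam P (x, \<nu>s, \<rho>)) (lin (inf_map C \<alpha>) (part_dec C \<mu>)))"

definition twisted_composite ::
    "('c, 'k::comm_ring_1, 'y) dg_cooperad_scheme \<Rightarrow> ('c \<Rightarrow> ('p \<Rightarrow>\<^sub>0 'k)) \<Rightarrow> ('p, 'k, 'z) dg_operad_scheme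
      \<Rightarrow> (('c, 'p) elem, 'k) dg_smod" where
  "twisted_composite C \<alpha> P = (composite C P)\<lparr>diff := (\<lambda>x. composite_diff C P x + twist C \<alpha> P x)\<rparr>"

section \<open>The operad Lie\<close>

text \<open>
  Bracket monomials. The elements of arity \<open>n\<close> of the free operad on one binary operation (without
  symmetry) are the combinations of those monomials in which each of the inputs \<open>1, \<dots>, n\<close> occurs
  exactly once; \<open>Lie\<close> is the quotient by the operadic ideal generated by antisymmetry and Jacobi.
\<close>

datatype lie_mono = Leaf nat | Br lie_mono lie_mono

primrec leaves :: "lie_mono \<Rightarrow> nat list" where
  "leaves (Leaf i) = [i]"
| "leaves (Br s t) = leaves s @ leaves t"

primrec mono_subst :: "(nat \<Rightarrow> lie_mono) \<Rightarrow> lie_mono \<Rightarrow> lie_mono" where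
  "mono_subst f (Leaf i) = f i"
| "mono_subst f (Br s t) = Br (mono_subst f s) (mono_subst f t)"

definition lie_gens :: "lie_mono set" where
  "lie_gens = {t. distinct (leaves t) \<and> set (leaves t) = {1..length (leaves t)}}"

definition lie_act :: "lie_mono \<Rightarrow> (nat \<Rightarrow> nat) \<Rightarrow> lie_mono" where
  "lie_act t \<sigma> = mono_subst (\<lambda>i. Leaf (inv \<sigma> i)) t"

inductive_set lie_ideal :: "(lie_mono \<Rightarrow>\<^sub>0 'k::comm_ring_1) set" where
  antisym: "Poly_Mapping.single (Br s t) 1 + Poly_Mapping.single (Br t s) 1 \<in> lie_ideal"
| jacobi: "Poly_Mapping.single (Br (Br s t) u) 1 + Poly_Mapping.single (Br (Br t u) s) 1
     + Poly_Mapping.single (Br (Br u s) t) 1 \<in> lie_ideal"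
| left: "x \<in> lie_ideal \<Longrightarrow> lin (\<lambda>s. Poly_Mapping.single (Br s t) 1) x \<in> lie_ideal"
| right: "x \<in> lie_ideal \<Longrightarrow> lin (\<lambda>t. Poly_Mapping.single (Br s t) 1) x \<in> lie_ideal"

text \<open>Grafting: the leaf \<open>i\<close> of \<open>p\<close> is replaced by \<open>q\<^sub>i\<close> with its leaves shifted to the \<open>i\<close>-th block.\<close>

definition lie_graft :: "lie_mono \<Rightarrow> lie_mono list \<Rightarrow> lie_mono" where
  "lie_graft p qs = mono_subst (\<lambda>i. mono_subst
     (\<lambda>k. Leaf (off (map (\<lambda>q. length (leaves q)) qs) i + k)) (qs ! (i - 1))) p"

definition lie :: "(lie_mono, 'k::comm_ring_1) dg_operad" where
  "lie = \<lparr>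
     gens = lie_gens,
     ar = (\<lambda>t. length (leaves t)),
     dgr = (\<lambda>t. 0),
     act = lie_act,
     rels = {x \<in> lie_ideal. Poly_Mapping.keys x \<subseteq> lie_gens},
     diff = (\<lambda>t. 0),
     op_unit = Poly_Mapping.single (Leaf 1) 1,
     gam = (\<lambda>p qs. Poly_Mapping.single (lie_graft p qs) 1)\<rparr>"

section \<open>The dg cooperad $\mathrm{Lie}^\diamond_3$\<close>

text \<open>\<open>Ln_ij\<close> is the generator $l_{n;i,j}$, and \<open>L1\<close> is the unit element of arity 1.\<close>

datatype lab =
    L1
  | L2 | L2_1 | L2_11 | L2_111
  | L3 | L3_1 | L3_2 | L3_11 | L3_12 | L3_22
  | L4 | L4_1 | L4_2 | L4_3
  | L5

primrec lab_ar :: "lab \<Rightarrow> nat" where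
  "lab_ar L1 = 1"
| "lab_ar L2 = 2" | "lab_ar L2_1 = 2" | "lab_ar L2_11 = 2" | "lab_ar L2_111 = 2"
| "lab_ar L3 = 3" | "lab_ar L3_1 = 3" | "lab_ar L3_2 = 3"
| "lab_ar L3_11 = 3" | "lab_ar L3_12 = 3" | "lab_ar L3_22 = 3"
| "lab_ar L4 = 4" | "lab_ar L4_1 = 4" | "lab_ar L4_2 = 4" | "lab_ar L4_3 = 4"
| "lab_ar L5 = 5"

primrec lab_dgr :: "lab \<Rightarrow> int" where
  "lab_dgr L1 = 0"
| "lab_dgr L2 = 1" | "lab_dgr L2_1 = 2" | "lab_dgr L2_11 = 3" | "lab_dgr L2_111 = 4"
| "lab_dgr L3 = 2" | "lab_dgr L3_1 = 3" | "lab_dgr L3_2 = 3"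
| "lab_dgr L3_11 = 4" | "lab_dgr L3_12 = 4" | "lab_dgr L3_22 = 4"
| "lab_dgr L4 = 3" | "lab_dgr L4_1 = 4" | "lab_dgr L4_2 = 4" | "lab_dgr L4_3 = 4"
| "lab_dgr L5 = 4"

text \<open>
  The pair \<open>(l, \<sigma>)\<close> stands for \<open>l\<^sup>\<sigma>\<close>. \<open>lgen l c\<close> and \<open>dterm m ls c\<close> are \<open>l\<^sup>\<sigma>\<close> and \<open>m \<circ> (ls)\<^sup>\<sigma>\<close> for the
  cycle \<open>\<sigma>\<close> with list of entries \<open>c\<close>, where \<open>[]\<close> gives the identity.
\<close>

type_synonym lie3_gen = "lab \<times> (nat \<Rightarrow> nat)"

definition lgen :: "lab \<Rightarrow> nat list \<Rightarrow> (lie3_gen \<Rightarrow>\<^sub>0 'k::comm_ring_1)" where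
  "lgen l c = Poly_Mapping.single (l, cycle_of_list c) 1"

definition dterm :: "lab \<Rightarrow> lab list \<Rightarrow> nat list \<Rightarrow> ((lie3_gen, lie3_gen) elem \<Rightarrow>\<^sub>0 'k::comm_ring_1)" where
  "dterm m ls c = Poly_Mapping.single ((m, id), map (\<lambda>l. (l, id)) ls, cycle_of_list c) 1"

primrec lab_diff :: "lab \<Rightarrow> (lie3_gen \<Rightarrow>\<^sub>0 'k::comm_ring_1)" where
  "lab_diff L1 = 0"
| "lab_diff L2 = 0"
| "lab_diff L2_1 = - lgen L2 [] - lgen L2 [1, 2]"
| "lab_diff L2_11 = - lgen L2_1 [] + lgen L2_1 [1, 2]"
| "lab_diff L2_111 = - lgen L2_11 [] - lgen L2_11 [1, 2]"
| "lab_diff L3 = 0"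
| "lab_diff L3_1 = - lgen L3 [] - lgen L3 [1, 2]"
| "lab_diff L3_2 = - lgen L3 [] - lgen L3 [2, 3]"
| "lab_diff L3_11 = - lgen L3_1 [] + lgen L3_1 [1, 2]"
| "lab_diff L3_12 = lgen L3_1 [] + lgen L3_1 [2, 3] + lgen L3_1 [1, 3, 2]
      - lgen L3_2 [] - lgen L3_2 [1, 2] - lgen L3_2 [1, 2, 3]"
| "lab_diff L3_22 = - lgen L3_2 [] + lgen L3_2 [2, 3]"
| "lab_diff L4 = 0"
| "lab_diff L4_1 = - lgen L4 [] - lgen L4 [1, 2]"
| "lab_diff L4_2 = - lgen L4 [] - lgen L4 [2, 3]"
| "lab_diff L4_3 = - lgen L4 [] - lgen L4 [3, 4]"
| "lab_diff L5 = 0"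

text \<open>A shuffle is increasing on each block; it is reduced if its values at the ends of the blocks increase.\<close>

definition inv_red_shuffles :: "nat list \<Rightarrow> (nat \<Rightarrow> nat) set" where
  "inv_red_shuffles ns = inv ` {\<tau>. \<tau> permutes {1..sum_list ns}
     \<and> (\<forall>a b. 1 \<le> a \<and> a < b \<and> b \<le> sum_list ns \<and> blk ns a = blk ns b \<longrightarrow> \<tau> a < \<tau> b)
     \<and> (\<forall>p q. 1 \<le> p \<and> p < q \<and> q \<le> length ns \<longrightarrow> \<tau> (sum_list (take p ns)) < \<tau> (sum_list (take q ns)))}"

definition ell :: "nat \<Rightarrow> lab" where
  "ell n = [L1, L2, L3, L4, L5] ! (n - 1)"

definition ell_dec :: "nat \<Rightarrow> ((lie3_gen, lie3_gen) elem \<Rightarrow>\<^sub>0 'k::comm_ring_1)" where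
  "ell_dec n = (\<Sum>j = 1..n. \<Sum>ns \<in> {ns. length ns = j \<and> sum_list ns = n \<and> (\<forall>i \<in> set ns. i \<ge> 1)}.
     \<Sum>\<sigma> \<in> inv_red_shuffles ns.
       Poly_Mapping.single ((ell j, id), map (\<lambda>i. (ell i, id)) ns, \<sigma>)
         ((- 1) ^ ((j - 1) * (n - j)) * (- 1) ^ (\<Sum>p = 1..j. (p - 1) * (ns ! (p - 1) - 1))
           * of_int (sign \<sigma>)))"

text \<open>The reduced decomposition; it is not used (and not meant) for \<open>L1, \<dots>, L5\<close>.\<close>

fun red_dec :: "lab \<Rightarrow> ((lie3_gen, lie3_gen) elem \<Rightarrow>\<^sub>0 'k::comm_ring_1)" where
  "red_dec L3_1 = dterm L2 [L2_1, L1] []"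
| "red_dec L3_2 = - dterm L2_1 [L2, L1] [] - dterm L2 [L1, L2_1] []
      - dterm L2_1 [L1, L2] [1, 2]"
| "red_dec L3_11 = - dterm L2 [L2_11, L1] []"
| "red_dec L3_12 = - dterm L2_1 [L2_1, L1] [] - dterm L2_1 [L1, L2_1] []
      - dterm L2_1 [L1, L2_1] [1, 2] + dterm L2_11 [L1, L2] [1, 3, 2]"
| "red_dec L3_22 = - dterm L2_11 [L2, L1] [] + dterm L2 [L1, L2_11] []
      - dterm L2_11 [L1, L2] [1, 2]"
| "red_dec L4_1 = - dterm L2 [L3_1, L1] [] - dterm L2 [L1, L3_1] [1, 2, 3]
      + dterm L2 [L2_1, L2] [] + dterm L3 [L2_1, L1, L1] []
      + dterm L3_1 [L1, L1, L2] []"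
| "red_dec L4_2 = - dterm L2 [L3_2, L1] [] - dterm L2 [L1, L3_1] []
      + dterm L2 [L2_1, L2] [1, 3, 2] + dterm L3_1 [L2, L1, L1] []
      + dterm L3_1 [L1, L2, L1] [1, 2] - dterm L3 [L1, L2_1, L1] []
      + dterm L3_1 [L1, L1, L2] [1, 3, 2]"
| "red_dec L4_3 = dterm L2_1 [L1, L3] [1, 2, 3] - dterm L2 [L1, L3_2] []
      + dterm L2 [L1, L3_2] [1, 2] + dterm L2_1 [L3, L1] [] - dterm L2 [L2, L2_1] []
      - dterm L2_1 [L2, L2] [1, 3, 2] + dterm L2_1 [L2, L2] [2, 3]
      + dterm L3_2 [L2, L1, L1] [] - dterm L3_2 [L1, L1, L2] [2, 3]
      + dterm L3_2 [L1, L1, L2] [1, 3, 2] + dterm L3 [L1, L1, L2_1] []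
      - dterm L3_2 [L1, L2, L1] [] + dterm L3_2 [L1, L2, L1] [1, 2]"
| "red_dec _ = 0"

definition lab_dec :: "lab \<Rightarrow> ((lie3_gen, lie3_gen) elem \<Rightarrow>\<^sub>0 'k::comm_ring_1)" where
  "lab_dec l =
     (if l \<in> {L1, L2, L3, L4, L5} then ell_dec (lab_ar l)
      else dterm L1 [l] [] + red_dec l + dterm l (replicate (lab_ar l) L1) [])"

definition lie_diamond3 :: "(lie3_gen, 'k::comm_ring_1) dg_cooperad" where
  "lie_diamond3 = \<lparr>
     gens = {(l, \<sigma>). \<sigma> permutes {1..lab_ar l}},
     ar = (\<lambda>(l, \<sigma>). lab_ar l),
     dgr = (\<lambda>(l, \<sigma>). lab_dgr l),
     act = (\<lambda>(l, \<sigma>) \<tau>. (l, \<sigma> \<circ> \<tau>)),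
     rels = {},
     diff = (\<lambda>(l, \<sigma>). lin (\<lambda>(m, \<tau>). Poly_Mapping.single (m, \<tau> \<circ> \<sigma>) 1) (lab_diff l)),
     counit = (\<lambda>(l, \<sigma>). if l = L1 then 1 else 0),
     dec = (\<lambda>(l, \<sigma>). lin (\<lambda>(m, ls, \<tau>). Poly_Mapping.single (m, ls, \<tau> \<circ> \<sigma>) 1) (lab_dec l))\<rparr>"

definition kappa_tilde :: "lie3_gen \<Rightarrow> (lie_mono \<Rightarrow>\<^sub>0 'k::comm_ring_1)" where
  "kappa_tilde = (\<lambda>(l, \<sigma>).
     if l = L2 then Poly_Mapping.single (lie_act (Br (Leaf 1) (Leaf 2)) \<sigma>) 1 else 0)"

end

theory Submission
  imports Defs
begin

text \<open>
  Up to arity-preserving terms, the twisted composite product is the multilinear part of the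
  Chevalley-Eilenberg complex of the free Lie algebra, with exterior powers replaced by a truncated
  resolution of the sign representations by free modules.

  The Chevalley-Eilenberg complex is acyclic by induction on the number of letters. The wedge factor
  containing the largest letter \<open>x\<close> is a unique combination of brackets \<open>[x, a\<^sub>1, \<dots>, a\<^sub>m]\<close>, which
  identifies the complex with \<open>U \<otimes> \<Lambda>\<close> for the remaining letters, where \<open>U\<close> is the tensor algebra. The
  elements with \<open>m > 0\<close> and fixed \<open>a\<^sub>1\<close> span a copy of the same complex with fewer letters, and the
  quotient by all of these is the Chevalley-Eilenberg complex of the remaining letters.

  A cycle of degree \<open>r \<le> 3\<close> is then changed by boundaries so that its component at \<open>l\<^bsub>r+1\<^esub>\<close>
  is sorted; this component is a Chevalley-Eilenberg cycle and is removed by a boundary from \<open>l\<^bsub>r+2\<^esub>\<close>.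
  What remains is a cycle for the arity-preserving differential, which is exact there.
\<close>

section \<open>Linear extension\<close>

text \<open>The bound on the degree is that of the truncation: there are no generators of degree 5,
  so nothing in degree 4 could be corrected. The delicate point is that the component of a cycle at
  the label of largest arity must itself be a Chevalley-Eilenberg cycle, although other labels of
  the same degree also have differentials landing where its differential lands. Those contributions
  come in pairs of adjacent transposes, which \<open>alt\<close> annihilates. That the differential
  squares to zero is checked by computation, for the labels used as corrections and only after
  passing to normal forms. All of this happens on labelled lists of Lie monomials.
  \<open>to_list\<close> carries the presented complex there; its relators span exactly what
  vanishes under \<open>NF\<close>, so the quotient is replaced by a free module on tuples of
  words.\<close>

abbreviation sgl :: "'g \<Rightarrow> ('g \<Rightarrow>\<^sub>0 'k::comm_ring_1)" where
  "sgl g \<equiv> Poly_Mapping.single g 1"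

lemma pscale_single [simp]: "pscale c (Poly_Mapping.single g a) = Poly_Mapping.single g (c * a)"
  by (rule poly_mapping_eqI) (simp add: lookup_pscale lookup_single when_def)

lemma pscale_minus_one [simp]: "pscale (- 1) x = - x"
  using free_mod.scale_minus_left[of 1 x] by (simp del: free_mod.scale_minus_left)

lemma lin_superset:
  assumes "finite S" "Poly_Mapping.keys x \<subseteq> S"
  shows "lin f x = (\<Sum>g\<in>S. pscale (Poly_Mapping.lookup x g) (f g))"
  unfolding lin_def
  by (rule sum.mono_neutral_left) (use assms in \<open>auto simp: in_keys_iff\<close>)

lemma lin_add [simp]: "lin f (x + y) = lin f x + lin f y"
proof -
  let ?S = "Poly_Mapping.keys x \<union> Poly_Mapping.keys y"
  have "lin f (x + y) = (\<Sum>g\<in>?S. pscale (Poly_Mapping.lookup (x + y) g) (f g))"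
    using keys_add by (rule lin_superset[rotated]) auto
  also have "\<dots> = lin f x + lin f y"
    by (simp add: lin_superset[of ?S] lookup_add free_mod.scale_left_distrib sum.distrib)
  finally show ?thesis .
qed

lemma lin_zero [simp]: "lin f 0 = 0"
  by (simp add: lin_def)

lemma lin_single [simp]: "lin f (Poly_Mapping.single g c) = pscale c (f g)"
  by (cases "c = 0") (auto simp: lin_def)

lemma lin_pscale [simp]: "lin f (pscale c x) = pscale c (lin f x)"
proof -
  have "lin f (pscale c x) = (\<Sum>g\<in>Poly_Mapping.keys x. pscale (c * Poly_Mapping.lookup x g) (f g))"
    by (subst lin_superset[of "Poly_Mapping.keys x"]) (auto simp: lookup_pscale in_keys_iff)
  then show ?thesis by (simp add: lin_def free_mod.scale_sum_right)
qed

lemma lin_uminus [simp]: "lin f (- x) = - lin f x"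
  using lin_pscale[of f "- 1" x] by simp

lemma lin_diff [simp]: "lin f (x - y) = lin f x - lin f y"
  using lin_add[of f x "- y"] by simp

lemma lin_sum [simp]: "lin f (sum g A) = (\<Sum>a\<in>A. lin f (g a))"
  by (induction A rule: infinite_finite_induct) auto

lemma lin_lin [simp]: "lin f (lin g x) = lin (\<lambda>a. lin f (g a)) x"
  by (simp add: lin_def[of g] lin_def[of "\<lambda>a. lin f (g a)"])

lemma lin_cong: "(\<And>g. g \<in> Poly_Mapping.keys x \<Longrightarrow> f g = f' g) \<Longrightarrow> lin f x = lin f' x"
  by (simp add: lin_def)

lemma lin_sgl [simp]: "lin sgl x = x"
proof (rule poly_mapping_eqI)
  fix k
  have "Poly_Mapping.lookup (lin sgl x) k
      = (\<Sum>g\<in>Poly_Mapping.keys x. if g = k then Poly_Mapping.lookup x g else 0)"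
    by (auto simp: lin_def lookup_sum lookup_single when_def intro!: sum.cong)
  then show "Poly_Mapping.lookup (lin sgl x) k = Poly_Mapping.lookup x k"
    by (simp add: sum.delta in_keys_iff)
qed

lemma lin_fun_add: "lin (\<lambda>g. f g + f' g) x = lin f x + lin f' x"
  by (simp add: lin_def free_mod.scale_right_distrib sum.distrib)

lemma lin_fun_uminus: "lin (\<lambda>g. - f g) x = - lin f x"
  by (simp add: lin_def sum_negf)

lemma lin_fun_diff: "lin (\<lambda>g. f g - f' g) x = lin f x - lin f' x"
  by (simp add: lin_def free_mod.scale_right_diff_distrib sum_subtractf)

lemma lin_fun_pscale: "lin (\<lambda>g. pscale c (f g)) x = pscale c (lin f x)"
  by (simp add: lin_def free_mod.scale_sum_right mult.commute)

lemma lin_fun_zero [simp]: "lin (\<lambda>g. 0) x = 0"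
  by (simp add: lin_def)

lemma lin_fun_sum: "lin (\<lambda>g. \<Sum>i\<in>I. f i g) x = (\<Sum>i\<in>I. lin (f i) x)"
  by (induction I rule: infinite_finite_induct) (simp_all add: lin_fun_add)

lemma lin_swap: "lin (\<lambda>a. lin (\<lambda>b. f a b) y) x = lin (\<lambda>b. lin (\<lambda>a. f a b) x) y"
proof -
  have "lin (\<lambda>a. lin (\<lambda>b. f a b) y) x
      = (\<Sum>b\<in>Poly_Mapping.keys y. lin (\<lambda>a. pscale (Poly_Mapping.lookup y b) (f a b)) x)"
    by (simp add: lin_def[of _ y] lin_fun_sum)
  then show ?thesis by (simp add: lin_fun_pscale lin_def[of _ y])
qed

lemma lin_eq_0: "(\<And>g. g \<in> Poly_Mapping.keys x \<Longrightarrow> f g = 0) \<Longrightarrow> lin f x = 0"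
  by (simp add: lin_def)

lemma lin_in_span:
  "(\<And>g. g \<in> Poly_Mapping.keys x \<Longrightarrow> f g \<in> free_mod.span S) \<Longrightarrow> lin f x \<in> free_mod.span S"
  unfolding lin_def by (intro free_mod.span_sum free_mod.span_scale)

lemma lin_span:
  assumes "x \<in> free_mod.span S" "\<And>y. y \<in> S \<Longrightarrow> lin f y \<in> free_mod.span T"
  shows "lin f x \<in> free_mod.span T"
  using assms(1)
  by (induction rule: free_mod.span_induct_alt)
    (auto intro: free_mod.span_add free_mod.span_scale free_mod.span_zero assms(2))

lemma lin_span_eq_0:
  assumes "x \<in> free_mod.span S" "\<And>y. y \<in> S \<Longrightarrow> lin f y = 0"
  shows "lin f x = 0"
  using assms(1) by (induction rule: free_mod.span_induct_alt) (auto simp: assms(2))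

section \<open>Elements supported on a set of basis vectors\<close>

definition over :: "'g set \<Rightarrow> ('g \<Rightarrow>\<^sub>0 'k::comm_ring_1) set" where
  "over B = {x. Poly_Mapping.keys x \<subseteq> B}"

lemma over_zero [simp]: "0 \<in> over B"
  by (simp add: over_def)

lemma over_add: "x \<in> over B \<Longrightarrow> y \<in> over B \<Longrightarrow> x + y \<in> over B"
  using keys_add[of x y] by (auto simp: over_def)

lemma over_pscale: "x \<in> over B \<Longrightarrow> pscale c x \<in> over B"
  using mult_zero_right by (fastforce simp: over_def in_keys_iff lookup_pscale)

lemma over_uminus: "x \<in> over B \<Longrightarrow> - x \<in> over B"
  using over_pscale[of x B "- 1"] by simp

lemma over_diff: "x \<in> over B \<Longrightarrow> y \<in> over B \<Longrightarrow> x - y \<in> over B"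
  using over_add[of x B "- y"] over_uminus by auto

lemma over_single [simp]: "g \<in> B \<Longrightarrow> Poly_Mapping.single g c \<in> over B"
  by (auto simp: over_def)

lemma over_sum: "(\<And>i. i \<in> I \<Longrightarrow> f i \<in> over B) \<Longrightarrow> sum f I \<in> over B"
  by (induction I rule: infinite_finite_induct) (auto intro: over_add)

lemma over_lin: "x \<in> over A \<Longrightarrow> (\<And>g. g \<in> A \<Longrightarrow> f g \<in> over B) \<Longrightarrow> lin f x \<in> over B"
  unfolding lin_def by (intro over_sum over_pscale) (auto simp: over_def)

lemma over_mono: "x \<in> over A \<Longrightarrow> A \<subseteq> B \<Longrightarrow> x \<in> over B"
  by (auto simp: over_def)

lemma over_lin_cong: "x \<in> over A \<Longrightarrow> (\<And>g. g \<in> A \<Longrightarrow> f g = f' g) \<Longrightarrow> lin f x = lin f' x"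
  by (rule lin_cong) (auto simp: over_def)

lemma over_lin_eq_0: "x \<in> over A \<Longrightarrow> (\<And>g. g \<in> A \<Longrightarrow> f g = 0) \<Longrightarrow> lin f x = 0"
  by (rule lin_eq_0) (auto simp: over_def)

lemmas over_intros = over_add over_uminus over_diff over_single over_zero over_pscale

section \<open>Right multiplication of words by Lie monomials\<close>

text \<open>Expansion of a Lie monomial in the tensor algebra, followed by right multiplication.\<close>

primrec rmul :: "lie_mono \<Rightarrow> nat list \<Rightarrow> (nat list \<Rightarrow>\<^sub>0 'k::comm_ring_1)" where
  "rmul (Leaf a) w = sgl (w @ [a])"
| "rmul (Br s t) w = lin (rmul t) (rmul s w) - lin (rmul s) (rmul t w)"

text \<open>The empty word gives a leaf with the unspecified letter \<open>hd []\<close>; hence the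
  recurring nonemptiness conditions on words that are used as brackets.\<close>

definition left_normed :: "nat list \<Rightarrow> lie_mono" where
  "left_normed w = foldl (\<lambda>t b. Br t (Leaf b)) (Leaf (hd w)) (tl w)"

lemma left_normed_single [simp]: "left_normed [a] = Leaf a"
  by (simp add: left_normed_def)

lemma left_normed_snoc: "w \<noteq> [] \<Longrightarrow> left_normed (w @ [b]) = Br (left_normed w) (Leaf b)"
  by (cases w) (auto simp: left_normed_def)

lemma leaves_lw [simp]: "w \<noteq> [] \<Longrightarrow> leaves (left_normed w) = w"
  by (induction w rule: rev_nonempty_induct) (auto simp: left_normed_snoc)

lemma leaves_nonempty [simp]: "leaves t \<noteq> []"
  by (induction t) auto

text \<open>Right multiplication commutes with left multiplication. Through \<open>rmul_Cons\<close>
  this makes prefixing a letter compatible with the differential.\<close>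

lemma rmul_append: "rmul t (p @ w) = lin (\<lambda>v. sgl (p @ v)) (rmul t w)"
  by (induction t arbitrary: w) auto

lemma rmul_Cons: "rmul t (a # w) = lin (\<lambda>v. sgl (a # v)) (rmul t w)"
  using rmul_append[of t "[a]" w] by simp

lemma rmul_Br: "rmul (Br s t) = (\<lambda>w. lin (rmul t) (rmul s w) - lin (rmul s) (rmul t w))"
  by auto

lemma rmul_over:
  "(rmul t w :: nat list \<Rightarrow>\<^sub>0 'k::comm_ring_1) \<in> over {w @ u | u. mset u = mset (leaves t)}"
proof (induction t arbitrary: w)
  case (Br s t)
  have "(lin (rmul t) (rmul s w) :: nat list \<Rightarrow>\<^sub>0 'k) \<in> over {w @ u | u. mset u = mset (leaves (Br s t))}"
  proof (rule over_lin[OF Br.IH(1)])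
    fix v assume "v \<in> {w @ u | u. mset u = mset (leaves s)}"
    then show "(rmul t v :: nat list \<Rightarrow>\<^sub>0 'k) \<in> over {w @ u | u. mset u = mset (leaves (Br s t))}"
      by (intro over_mono[OF Br.IH(2)]) auto
  qed
  moreover have "(lin (rmul s) (rmul t w) :: nat list \<Rightarrow>\<^sub>0 'k) \<in> over {w @ u | u. mset u = mset (leaves (Br s t))}"
  proof (rule over_lin[OF Br.IH(2)])
    fix v assume "v \<in> {w @ u | u. mset u = mset (leaves t)}"
    then show "(rmul s v :: nat list \<Rightarrow>\<^sub>0 'k) \<in> over {w @ u | u. mset u = mset (leaves (Br s t))}"
      by (intro over_mono[OF Br.IH(1)]) auto
  qed
  ultimately show ?case by (auto intro: over_diff)
qed auto

text \<open>Brackets expand to commutators of right multiplications, for which antisymmetry and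
  Jacobi are identities; the two closure rules of the ideal follow because the expansion is linear
  in each argument of the bracket.\<close>

lemma rmul_ideal: "(x :: lie_mono \<Rightarrow>\<^sub>0 'k::comm_ring_1) \<in> lie_ideal \<Longrightarrow> lin (\<lambda>t. rmul t w) x = 0"
proof (induction arbitrary: w rule: lie_ideal.induct)
  case (antisym s t)
  then show ?case by simp
next
  case (jacobi s t u)
  then show ?case by (simp add: lin_fun_diff rmul_Br)
next
  case (left x t)
  have "lin (\<lambda>s. lin (rmul s) (rmul t w)) x = 0"
    by (subst lin_swap) (simp add: left.IH)
  moreover have "lin (\<lambda>s. lin (rmul t) (rmul s w)) x = lin (rmul t) (lin (\<lambda>s. rmul s w) x)"
    by (simp only: lin_lin)
  ultimately show ?case by (simp add: lin_fun_diff left.IH)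
next
  case (right x s)
  have "lin (\<lambda>t. lin (rmul t) (rmul s w)) x = 0"
    by (subst lin_swap) (simp add: right.IH)
  moreover have "lin (\<lambda>t. lin (rmul s) (rmul t w)) x = lin (rmul s) (lin (\<lambda>t. rmul t w) x)"
    by (simp only: lin_lin)
  ultimately show ?case by (simp add: lin_fun_diff right.IH)
qed

text \<open>By Jacobi \<open>[w, [s, t]] = [[w, s], t] - [[w, t], s]\<close>, so both sides satisfy
  the same recursion in \<open>t\<close>. This is the shadow in the tensor algebra of
  \<open>Br_lw_rmul\<close>.\<close>

lemma rmul_lw_rmul:
  "w \<noteq> [] \<Longrightarrow> lin (\<lambda>v. rmul (left_normed v) u) (rmul t w) = (rmul (Br (left_normed w) t) u :: nat list \<Rightarrow>\<^sub>0 'k::comm_ring_1)"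
proof (induction t arbitrary: w u)
  case (Leaf a)
  then show ?case by (simp add: left_normed_snoc)
next
  case (Br s t)
  have *: "lin (\<lambda>v. rmul (left_normed v) u) (lin (rmul q) (rmul p w) :: nat list \<Rightarrow>\<^sub>0 'k)
      = lin (rmul q) (rmul (Br (left_normed w) p) u) - lin (rmul (Br (left_normed w) p)) (rmul q u)"
    if IHp: "\<And>u. lin (\<lambda>v. rmul (left_normed v) u) (rmul p w) = (rmul (Br (left_normed w) p) u :: nat list \<Rightarrow>\<^sub>0 'k)"
      and IHq: "\<And>w u. w \<noteq> [] \<Longrightarrow> lin (\<lambda>v. rmul (left_normed v) u) (rmul q w) = (rmul (Br (left_normed w) q) u :: nat list \<Rightarrow>\<^sub>0 'k)"
    for p q :: lie_mono
  proof -
    have "(lin (\<lambda>v. rmul (left_normed v) u) (lin (rmul q) (rmul p w)) :: nat list \<Rightarrow>\<^sub>0 'k)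
        = lin (\<lambda>v'. lin (\<lambda>v. rmul (left_normed v) u) (rmul q v')) (rmul p w)"
      by simp
    also have "\<dots> = lin (\<lambda>v'. rmul (Br (left_normed v') q) u) (rmul p w)"
      by (rule over_lin_cong[OF rmul_over]) (use Br.prems in \<open>auto simp: IHq simp del: rmul.simps\<close>)
    also have "\<dots> = lin (rmul q) (lin (\<lambda>v'. rmul (left_normed v') u) (rmul p w))
        - lin (\<lambda>y. lin (\<lambda>v'. rmul (left_normed v') y) (rmul p w)) (rmul q u)"
      by (simp add: lin_fun_diff) (rule lin_swap)
    also have "\<dots> = lin (rmul q) (rmul (Br (left_normed w) p) u) - lin (rmul (Br (left_normed w) p)) (rmul q u)"
      by (simp only: IHp)
    finally show ?thesis .
  qed
  show ?case
    using *[of s t] *[of t s] Br by (simp add: lin_fun_diff del: lin_lin) (simp add: lin_fun_diff rmul_Br)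
qed

section \<open>The Chevalley-Eilenberg complex of a free Lie algebra, multilinear part\<close>

text \<open>
  A wedge of left-normed brackets, each starting with its largest letter, is written as the list of
  their words, ordered by first letters.
\<close>

primrec dact :: "nat list \<Rightarrow> nat list list \<Rightarrow> (nat list list \<Rightarrow>\<^sub>0 'k::comm_ring_1)" where
  "dact w [] = 0"
| "dact w (v # T) = lin (\<lambda>v'. sgl (v' # T)) (rmul (left_normed w) v) + lin (\<lambda>T'. sgl (v # T')) (dact w T)"

text \<open>Unfolded, each pair \<open>i < j\<close> contributes \<open>(-1)^i\<close> times the
  list with the \<open>i\<close>-th word removed and the \<open>j\<close>-th replaced by its bracket
  with that word. The bracket stays at the later word, whose head is larger, so sorted lists remain
  sorted without any reordering.\<close>

primrec ce :: "nat list list \<Rightarrow> (nat list list \<Rightarrow>\<^sub>0 'k::comm_ring_1)" where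
  "ce [] = 0"
| "ce (w # T) = - dact w T - lin (\<lambda>T'. sgl (w # T')) (ce T)"

text \<open>Bracketing with words is a right Lie algebra action; on a single entry this is
  \<open>rmul_lw_rmul\<close>, and mixed terms at two different entries commute.\<close>

lemma dact_rmul:
  "v \<noteq> [] \<Longrightarrow> lin (\<lambda>v'. dact v' T) (rmul (left_normed w) v) = lin (dact w) (dact v T) - (lin (dact v) (dact w T) :: _ \<Rightarrow>\<^sub>0 'k::comm_ring_1)"
proof (induction T)
  case Nil
  then show ?case by simp
next
  case (Cons u T)
  have sw: "lin (\<lambda>a. lin (\<lambda>T'. sgl (a # T')) y) x = lin (\<lambda>T'. lin (\<lambda>a. sgl (a # T')) x) y"
    for x :: "nat list \<Rightarrow>\<^sub>0 'k" and y :: "nat list list \<Rightarrow>\<^sub>0 'k"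
    by (rule lin_swap)
  have "(lin (\<lambda>v'. lin (\<lambda>u'. sgl (u' # T)) (rmul (left_normed v') u)) (rmul (left_normed w) v) :: _ \<Rightarrow>\<^sub>0 'k)
      = lin (\<lambda>u'. sgl (u' # T)) (lin (\<lambda>v'. rmul (left_normed v') u) (rmul (left_normed w) v))"
    by simp
  moreover have "(lin (\<lambda>v'. lin (\<lambda>T'. sgl (u # T')) (dact v' T)) (rmul (left_normed w) v) :: _ \<Rightarrow>\<^sub>0 'k)
      = lin (\<lambda>T'. sgl (u # T')) (lin (\<lambda>v'. dact v' T) (rmul (left_normed w) v))"
    by simp
  ultimately show ?case
    by (simp add: lin_fun_add rmul_lw_rmul Cons del: lin_lin) (simp add: lin_fun_add sw)
qed

text \<open>The action is by derivations of the bracket, so it commutes with the differential. An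
  empty word is harmless in last position: the last word is acted upon but never acts.\<close>

lemma ce_dact:
  "[] \<notin> set (butlast T) \<Longrightarrow> lin ce (dact w T) = (lin (dact w) (ce T) :: _ \<Rightarrow>\<^sub>0 'k::comm_ring_1)"
proof (induction T)
  case Nil
  then show ?case by simp
next
  case (Cons v T)
  have sw: "lin (\<lambda>a. lin (\<lambda>T'. sgl (a # T')) y) x = lin (\<lambda>T'. lin (\<lambda>a. sgl (a # T')) x) y"
    for x :: "nat list \<Rightarrow>\<^sub>0 'k" and y :: "nat list list \<Rightarrow>\<^sub>0 'k"
    by (rule lin_swap)
  have "(lin (\<lambda>T'. lin (\<lambda>T'. sgl (v # T')) (ce T')) (dact w T) :: _ \<Rightarrow>\<^sub>0 'k) = lin (\<lambda>T'. sgl (v # T')) (lin (dact w) (ce T))"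
    using Cons by (cases "T = []") (auto simp flip: lin_lin)
  moreover have "v \<noteq> [] \<or> T = []"
    using Cons.prems by (auto split: if_splits)
  ultimately show ?case
    by (auto simp add: lin_fun_add lin_fun_diff lin_fun_uminus dact_rmul sw)
qed

lemma ce_ce: "[] \<notin> set (butlast T) \<Longrightarrow> (lin ce (ce T) :: _ \<Rightarrow>\<^sub>0 'k::comm_ring_1) = 0"
proof (induction T)
  case (Cons w T)
  then have "lin (\<lambda>T'. sgl (w # T')) (lin ce (ce T)) = (0 :: _ \<Rightarrow>\<^sub>0 'k)"
    by (cases "T = []") (simp_all del: lin_lin)
  moreover have "[] \<notin> set (butlast T)"
    using Cons.prems by (cases "T = []") auto
  ultimately show ?case
    by (simp add: lin_fun_diff lin_fun_uminus ce_dact)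
qed simp

lemma dact_over:
  assumes "w \<noteq> []"
  shows "(dact w T :: _ \<Rightarrow>\<^sub>0 'k::comm_ring_1) \<in> over {T[i := T ! i @ u] | i u. i < length T \<and> mset u = mset w}"
proof (induction T)
  case Nil
  then show ?case by simp
next
  case (Cons v T)
  let ?B = "{(v # T)[i := (v # T) ! i @ u] | i u. i < length (v # T) \<and> mset u = mset w}"
  have "(lin (\<lambda>v'. sgl (v' # T)) (rmul (left_normed w) v) :: _ \<Rightarrow>\<^sub>0 'k) \<in> over ?B"
  proof (rule over_lin[OF rmul_over])
    fix v' assume "v' \<in> {v @ u | u. mset u = mset (leaves (left_normed w))}"
    then obtain u where "v' = v @ u" "mset u = mset w" using assms by auto
    then show "(sgl (v' # T) :: _ \<Rightarrow>\<^sub>0 'k) \<in> over ?B"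
      by (intro over_single CollectI exI[of _ 0] exI[of _ u]) simp
  qed
  moreover have "(lin (\<lambda>T'. sgl (v # T')) (dact w T) :: _ \<Rightarrow>\<^sub>0 'k) \<in> over ?B"
  proof (rule over_lin[OF Cons])
    fix T' assume "T' \<in> {T[i := T ! i @ u] | i u. i < length T \<and> mset u = mset w}"
    then obtain i u where "T' = T[i := T ! i @ u]" "i < length T" "mset u = mset w" by auto
    then show "(sgl (v # T') :: _ \<Rightarrow>\<^sub>0 'k) \<in> over ?B"
      by (intro over_single CollectI exI[of _ "Suc i"] exI[of _ u]) simp
  qed
  ultimately show ?case by (simp only: dact.simps over_add)
qed

lemma ce_over:
  assumes "[] \<notin> set (butlast T)"
  shows "(ce T :: _ \<Rightarrow>\<^sub>0 'k::comm_ring_1) \<in>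
    over {us @ vs[i := vs ! i @ u] | us vs i u w. T = us @ w # vs \<and> i < length vs \<and> mset u = mset w}"
  using assms
proof (induction T)
  case Nil
  then show ?case by simp
next
  case (Cons w T)
  show ?case
  proof (cases "T = []")
    case True
    then show ?thesis by simp
  next
    case False
    let ?B = "{us @ vs[i := vs ! i @ u] | us vs i u w'. w # T = us @ w' # vs \<and> i < length vs \<and> mset u = mset w'}"
    have w: "w \<noteq> []" and T: "[] \<notin> set (butlast T)"
      using Cons.prems False by auto
    have "(dact w T :: _ \<Rightarrow>\<^sub>0 'k) \<in> over ?B"
    proof (rule over_mono[OF dact_over[OF w]], rule subsetI)
      fix T' assume "T' \<in> {T[i := T ! i @ u] | i u. i < length T \<and> mset u = mset w}"
      then obtain i u where "T' = T[i := T ! i @ u]" "i < length T" "mset u = mset w" by auto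
      then show "T' \<in> ?B"
        by (intro CollectI exI[of _ "[]"] exI[of _ T] exI[of _ i] exI[of _ u] exI[of _ w]) simp
    qed
    moreover have "(lin (\<lambda>T'. sgl (w # T')) (ce T) :: _ \<Rightarrow>\<^sub>0 'k) \<in> over ?B"
    proof (rule over_lin[OF Cons.IH[OF T]])
      fix T' assume "T' \<in> {us @ vs[i := vs ! i @ u] | us vs i u w. T = us @ w # vs \<and> i < length vs \<and> mset u = mset w}"
      then obtain us vs i u w' where "T' = us @ vs[i := vs ! i @ u]" "T = us @ w' # vs" "i < length vs" "mset u = mset w'"
        by auto
      then show "(sgl (w # T') :: _ \<Rightarrow>\<^sub>0 'k) \<in> over ?B"
        by (intro over_single CollectI exI[of _ "w # us"] exI[of _ vs] exI[of _ i] exI[of _ u] exI[of _ w']) simp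
    qed
    ultimately show ?thesis by (simp only: ce.simps over_diff over_uminus)
  qed
qed

section \<open>Wedges, and their description after removal of the largest letter\<close>

definition heads :: "nat list list \<Rightarrow> bool" where
  "heads T \<longleftrightarrow> (\<forall>w\<in>set T. w \<noteq> [] \<and> (\<forall>x\<in>set (tl w). x < hd w)) \<and> sorted_wrt (<) (map hd T)"

definition wedges :: "nat set \<Rightarrow> nat list list set" where
  "wedges A = {T. distinct (concat T) \<and> set (concat T) = A \<and> heads T}"

text \<open>
  The last word may be empty and need not start with its largest letter: these lists are obtained
  from wedges by dropping the overall largest letter, so that they span \<open>U \<otimes> \<Lambda>\<close> for the universal
  enveloping algebra \<open>U\<close> of the free Lie algebra on the other letters.
\<close>

definition uwedges :: "nat set \<Rightarrow> nat list list set" where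
  "uwedges A = {T. T \<noteq> [] \<and> distinct (concat T) \<and> set (concat T) = A \<and> heads (butlast T)}"

text \<open>Used in two ways: with \<open>a\<close> above all letters it identifies
  \<open>uwedges\<close> with \<open>wedges\<close> on one more letter, and with any fresh
  \<open>a\<close> it embeds the \<open>uwedges\<close> complex on fewer letters as the part whose
  last word begins with \<open>a\<close>.\<close>

definition pre :: "nat \<Rightarrow> nat list list \<Rightarrow> nat list list" where
  "pre a T = butlast T @ [a # last T]"

definition strip :: "nat list list \<Rightarrow> nat list list" where
  "strip T = butlast T @ [tl (last T)]"

lemma pre_snoc [simp]: "pre a (S @ [u]) = S @ [a # u]"
  by (simp add: pre_def)

lemma pre_neq_Nil [simp]: "pre a T \<noteq> []"
  by (simp add: pre_def)

lemma length_pre: "T \<noteq> [] \<Longrightarrow> length (pre a T) = length T"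
  by (cases T rule: rev_cases) auto

lemma last_pre [simp]: "last (pre a T) = a # last T"
  by (simp add: pre_def)

lemma pre_Cons: "T \<noteq> [] \<Longrightarrow> pre a (v # T) = v # pre a T"
  by (simp add: pre_def)

lemma strip_pre [simp]: "T \<noteq> [] \<Longrightarrow> strip (pre a T) = T"
  by (simp add: strip_def pre_def)

text \<open>The appended letters are those of \<open>w\<close>, hence at most \<open>hd w\<close>,
  which lies below the head of every later word.\<close>

lemma heads_update:
  assumes "heads (us @ w # vs)" "i < length vs" "mset u = mset w"
  shows "heads (us @ vs[i := vs ! i @ u])"
proof -
  have vi: "vs ! i \<in> set vs" using assms(2) by simp
  have w: "w \<noteq> []" "x \<le> hd w" if "x \<in> set w" for x
    using assms(1) that by (cases w; auto simp: heads_def less_imp_le)+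
  have "w \<noteq> []" using assms(1) by (simp add: heads_def)
  have v: "vs ! i \<noteq> []" "hd w < hd (vs ! i)" "\<And>x. x \<in> set (tl (vs ! i)) \<Longrightarrow> x < hd (vs ! i)"
    using assms(1) vi by (simp_all add: heads_def sorted_wrt_append)
  have "map hd (us @ vs[i := vs ! i @ u]) = map hd (us @ vs)"
    using v(1) by (simp add: map_update) (metis list_update_id map_update)
  moreover have "sorted_wrt (<) (map hd (us @ vs))"
    using assms(1) by (auto simp: heads_def sorted_wrt_append)
  moreover have "x < hd (vs ! i @ u)" if "x \<in> set (tl (vs ! i @ u))" for x
  proof -
    have "x \<in> set (tl (vs ! i)) \<or> x \<in> set w"
      using that v(1) mset_eq_setD[OF assms(3)] by auto
    then show ?thesis
      using v w(2)[of x] by auto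
  qed
  moreover have "z \<in> set us \<or> z \<in> set vs \<or> z = vs ! i @ u" if "z \<in> set (us @ vs[i := vs ! i @ u])" for z
    using that set_update_subset_insert[of vs i "vs ! i @ u"] by auto
  ultimately show ?thesis
    using assms(1) v(1) unfolding heads_def by (intro conjI ballI) (simp, fastforce+)
qed

lemma uwedges_update:
  assumes "us @ w # vs \<in> uwedges A" "i < length vs" "mset u = mset w"
  shows "us @ vs[i := vs ! i @ u] \<in> uwedges A"
proof -
  obtain vs' z where vs: "vs = vs' @ [z]"
    using assms(2) by (cases vs rule: rev_cases) auto
  have h: "heads (us @ w # vs')"
    using assms(1) by (simp add: uwedges_def vs butlast_append)
  have "concat vs = concat (take i vs @ vs ! i # drop (Suc i) vs)"
    by (rule arg_cong[OF id_take_nth_drop[OF assms(2)]])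
  then have eq: "mset (concat (us @ vs[i := vs ! i @ u])) = mset (concat (us @ w # vs))"
    using assms(2,3) by (simp add: upd_conv_take_nth_drop)
  have "distinct (concat (us @ vs[i := vs ! i @ u]))" "set (concat (us @ vs[i := vs ! i @ u])) = A"
    using assms(1) mset_eq_setD[OF eq] mset_eq_imp_distinct_iff[OF eq] by (simp_all only: uwedges_def mem_Collect_eq)
  moreover have "heads (butlast (us @ vs[i := vs ! i @ u]))"
  proof (cases "i < length vs'")
    case True
    then show ?thesis
      using heads_update[OF h True assms(3)] by (simp add: vs list_update_append nth_append butlast_append)
  next
    case False
    then have "i = length vs'" using assms(2) vs by simp
    then show ?thesis
      using h by (auto simp: vs list_update_append butlast_append heads_def sorted_wrt_append)
  qed
  ultimately show ?thesis using assms(2) by (auto simp: uwedges_def)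
qed

lemma ce_uwedges:
  assumes "T \<in> uwedges A"
  shows "(ce T :: _ \<Rightarrow>\<^sub>0 'k::comm_ring_1) \<in> over {U \<in> uwedges A. Suc (length U) = length T}"
proof (rule over_mono[OF ce_over])
  show "[] \<notin> set (butlast T)"
    using assms by (auto simp: uwedges_def heads_def)
qed (use assms in \<open>auto intro: uwedges_update\<close>)

lemma dact_pre:
  assumes "w \<noteq> []" "T \<noteq> []"
  shows "dact w (pre a T) = (lin (\<lambda>T'. sgl (pre a T')) (dact w T) :: _ \<Rightarrow>\<^sub>0 'k::comm_ring_1)"
  using assms(2)
proof (induction T rule: list_nonempty_induct)
  case (single v)
  show ?case by (simp add: pre_def rmul_Cons)
next
  case (cons v T)
  have "(lin (\<lambda>T'. sgl (pre a (v # T'))) (dact w T) :: _ \<Rightarrow>\<^sub>0 'k) = lin (\<lambda>T'. sgl (v # pre a T')) (dact w T)"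
    by (rule over_lin_cong[OF dact_over[OF assms(1)]]) (use cons in \<open>auto simp: pre_Cons\<close>)
  then show ?case using cons by (simp add: pre_Cons)
qed

text \<open>The differential can only append letters to the last word, so its first letter is inert
  and prefixing is a chain map.\<close>

lemma ce_pre:
  assumes "T \<noteq> []" "[] \<notin> set (butlast T)"
  shows "ce (pre a T) = (lin (\<lambda>T'. sgl (pre a T')) (ce T) :: _ \<Rightarrow>\<^sub>0 'k::comm_ring_1)"
  using assms
proof (induction T rule: list_nonempty_induct)
  case (single v)
  show ?case by (simp add: pre_def)
next
  case (cons v T)
  then have v: "v \<noteq> []" and T: "[] \<notin> set (butlast T)" by auto
  have "(lin (\<lambda>T'. sgl (pre a (v # T'))) (ce T) :: _ \<Rightarrow>\<^sub>0 'k) = lin (\<lambda>T'. sgl (v # pre a T')) (ce T)"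
    by (rule over_lin_cong[OF ce_over[OF T]]) (clarsimp, subst pre_Cons, auto)
  then show ?case using cons v T by (simp add: pre_Cons dact_pre)
qed


text \<open>A homotopy transported along \<open>pre\<close>. The letter is read off from the list
  itself, so one function serves all first letters at once, and also the wedges, where it is the
  largest letter.\<close>

definition hpre :: "(nat list list \<Rightarrow> (nat list list \<Rightarrow>\<^sub>0 'k::comm_ring_1)) \<Rightarrow> nat list list \<Rightarrow> (nat list list \<Rightarrow>\<^sub>0 'k)" where
  "hpre f T = lin (\<lambda>T'. sgl (pre (hd (last T)) T')) (f (strip T))"

definition cep :: "nat list list \<Rightarrow> (nat list list \<Rightarrow>\<^sub>0 'k::comm_ring_1)" where
  "cep S = ce (S @ [[]]) - lin (\<lambda>S'. sgl (S' @ [[]])) (ce S)"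

text \<open>
  The fuel is the number of letters. For a list ending in the empty word this is the homotopy of the
  extension of \<open>\<Lambda>\<close> by the subcomplex of the lists with nonempty last word, corrected by \<open>cep\<close>, the
  component of the differential from the former to the latter.
\<close>

primrec contr :: "nat \<Rightarrow> nat list list \<Rightarrow> (nat list list \<Rightarrow>\<^sub>0 'k::comm_ring_1)" where
  "contr 0 T = 0"
| "contr (Suc n) T =
    (if n = 0 then if last T = [] then 0 else - sgl (T @ [[]])
     else if last T = []
       then let H = hpre (contr n) (butlast T)
            in lin (\<lambda>S. sgl (S @ [[]])) H - lin (hpre (contr n)) (lin cep H)
     else hpre (contr n) T)"

lemma hpre_pre: "T \<noteq> [] \<Longrightarrow> hpre f (pre a T) = lin (\<lambda>T'. sgl (pre a T')) (f T)"
  by (simp add: hpre_def)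

lemma dact_snoc_Nil:
  "dact w (S @ [[]]) = lin (\<lambda>S'. sgl (S' @ [[]])) (dact w S) + (lin (\<lambda>v. sgl (S @ [v])) (rmul (left_normed w) []) :: _ \<Rightarrow>\<^sub>0 'k::comm_ring_1)"
  by (induction S) simp_all

lemma cep_Cons:
  "cep (w # S) = - lin (\<lambda>v. sgl (S @ [v])) (rmul (left_normed w) []) - (lin (\<lambda>S'. sgl (w # S')) (cep S) :: _ \<Rightarrow>\<^sub>0 'k::comm_ring_1)"
  by (simp add: cep_def dact_snoc_Nil)

text \<open>\<open>cep\<close> collects the terms in which a factor acts on the empty last word;
  that factor fills the word and disappears from the list, so the length is the one of
  \<open>S\<close>.\<close>

lemma cep_over:
  assumes "[] \<notin> set S"
  shows "(cep S :: _ \<Rightarrow>\<^sub>0 'k::comm_ring_1) \<in> over {T. T \<noteq> [] \<and> last T \<noteq> [] \<and> length T = length S}"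
  using assms
proof (induction S)
  case Nil
  then show ?case by (simp add: cep_def)
next
  case (Cons w S)
  have "(lin (\<lambda>v. sgl (S @ [v])) (rmul (left_normed w) []) :: _ \<Rightarrow>\<^sub>0 'k) \<in> over {T. T \<noteq> [] \<and> last T \<noteq> [] \<and> length T = length (w # S)}"
    using Cons.prems by (intro over_lin[OF rmul_over] over_single) auto
  moreover have "(lin (\<lambda>S'. sgl (w # S')) (cep S) :: _ \<Rightarrow>\<^sub>0 'k) \<in> over {T. T \<noteq> [] \<and> last T \<noteq> [] \<and> length T = length (w # S)}"
    using Cons.prems by (intro over_lin[OF Cons.IH] over_single) auto
  ultimately show ?case by (simp only: cep_Cons over_diff over_uminus)
qed

lemma ce_snoc_Nil: "ce (S @ [[]]) = lin (\<lambda>S'. sgl (S' @ [[]])) (ce S) + cep S"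
  by (simp add: cep_def)

text \<open>What is left of the vanishing square of the differential on \<open>S @ [[]]\<close> once
  the square on \<open>S\<close> itself is taken away.\<close>

lemma ce_cep:
  assumes "[] \<notin> set S"
  shows "lin ce (cep S) = - (lin cep (ce S) :: _ \<Rightarrow>\<^sub>0 'k::comm_ring_1)"
proof -
  have dd: "lin ce (ce S) = (0 :: _ \<Rightarrow>\<^sub>0 'k)"
    using assms by (intro ce_ce) (auto dest: in_set_butlastD)
  have "lin ce (ce (S @ [[]])) = (0 :: _ \<Rightarrow>\<^sub>0 'k)"
    using assms by (intro ce_ce) simp
  then have "lin (\<lambda>S'. ce (S' @ [[]])) (ce S) + lin ce (cep S) = (0 :: _ \<Rightarrow>\<^sub>0 'k)"
    by (simp add: ce_snoc_Nil)
  moreover have "(lin (\<lambda>S'. ce (S' @ [[]])) (ce S) :: _ \<Rightarrow>\<^sub>0 'k)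
      = lin (\<lambda>S'. sgl (S' @ [[]])) (lin ce (ce S)) + lin cep (ce S)"
    by (simp add: ce_snoc_Nil lin_fun_add)
  ultimately show ?thesis using dd by (simp add: add_eq_0_iff)
qed


text \<open>Each word is headed by its largest letter and the heads increase, so the overall largest
  letter heads the last word.\<close>

lemma wedges_pre:
  assumes "T \<in> wedges A" "A \<noteq> {}"
  obtains T' where "T = pre (Max A) T'" "T' \<in> uwedges (A - {Max A})"
proof -
  have A: "finite A" using assms(1) by (auto simp: wedges_def)
  have "T \<noteq> []" using assms by (auto simp: wedges_def)
  then obtain S w where T: "T = S @ [w]" by (cases T rule: rev_cases) auto
  then have h: "heads (S @ [w])" and d: "distinct (concat (S @ [w]))" and set: "set (concat (S @ [w])) = A"
    using assms(1) by (auto simp: wedges_def)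
  obtain a u where w: "w = a # u" using h by (cases w) (auto simp: heads_def)
  have "x \<le> a" if x: "x \<in> A" for x
  proof -
    obtain v where v: "v \<in> set (S @ [w])" "x \<in> set v" using x set by auto
    then have "x = hd v \<or> x \<in> set (tl v)" by (metis empty_iff empty_set list.collapse set_ConsD)
    then have "x \<le> hd v" using h v(1) by (auto simp: heads_def less_imp_le)
    also have "hd v \<le> a" using v(1) h by (auto simp: heads_def sorted_wrt_append w less_imp_le)
    finally show ?thesis .
  qed
  moreover have "a \<in> A" using set by (auto simp: w)
  ultimately have "Max A = a" using A by (intro Max_eqI) auto
  moreover have "S @ [u] \<in> uwedges (A - {a})"
    using h d set by (auto simp: uwedges_def w heads_def sorted_wrt_append)
  ultimately show thesis
    using that[of "S @ [u]"] by (simp add: T w)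
qed

lemma pre_wedges:
  assumes "T \<in> uwedges B" "\<And>b. b \<in> B \<Longrightarrow> b < a"
  shows "pre a T \<in> wedges (insert a B)"
proof -
  obtain S u where T: "T = S @ [u]" using assms(1) by (cases T rule: rev_cases) (auto simp: uwedges_def)
  have hd: "hd v \<in> set (concat S)" if "v \<in> set S" for v
  proof -
    have "v \<noteq> []" using that assms(1) by (auto simp: T uwedges_def heads_def)
    then show ?thesis using that by (auto intro!: bexI[of _ v])
  qed
  show ?thesis
    using assms hd by (auto simp: T uwedges_def wedges_def heads_def sorted_wrt_append)
qed

lemma pre_uwedges: "T \<in> uwedges B \<Longrightarrow> a \<notin> B \<Longrightarrow> pre a T \<in> uwedges (insert a B)"
  by (cases T rule: rev_cases) (auto simp: uwedges_def)

lemma uwedges_pre: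
  assumes "T \<in> uwedges A" "last T \<noteq> []"
  obtains a T' where "T = pre a T'" "a \<in> A" "T' \<in> uwedges (A - {a})"
proof -
  obtain S a u where T: "T = S @ [a # u]"
    using assms by (cases T rule: rev_cases) (auto simp: uwedges_def neq_Nil_conv)
  show thesis
    using that[of a "S @ [u]"] assms(1) by (auto simp: T uwedges_def)
qed

lemma uwedges_snoc_Nil: "S @ [[]] \<in> uwedges A \<longleftrightarrow> S \<in> wedges A"
  by (auto simp: uwedges_def wedges_def)

lemma wedges_no_Nil: "T \<in> wedges A \<Longrightarrow> [] \<notin> set T"
  by (auto simp: wedges_def heads_def)

lemma ce_wedges:
  assumes "T \<in> wedges A"
  shows "(ce T :: _ \<Rightarrow>\<^sub>0 'k::comm_ring_1) \<in> over {U \<in> wedges A. Suc (length U) = length T}"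
proof (cases "A = {}")
  case True
  then have "T = []"
    using assms wedges_no_Nil[OF assms] by (cases T) (auto simp: wedges_def)
  then show ?thesis by simp
next
  case False
  have A: "finite A" using assms by (auto simp: wedges_def)
  obtain T' where T: "T = pre (Max A) T'" "T' \<in> uwedges (A - {Max A})"
    using wedges_pre[OF assms False] .
  have A': "A = insert (Max A) (A - {Max A})" and lt: "\<And>b. b \<in> A - {Max A} \<Longrightarrow> b < Max A"
    using A Max_in[OF A False] by (auto simp: order_less_le)
  have T': "T' \<noteq> []" "[] \<notin> set (butlast T')"
    using T(2) by (auto simp: uwedges_def heads_def)
  show ?thesis
    unfolding T(1) ce_pre[OF T']
  proof (rule over_lin[OF ce_uwedges[OF T(2)]], rule over_single, safe)
    fix U assume U: "U \<in> uwedges (A - {Max A})" "Suc (length U) = length T'"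
    show "pre (Max A) U \<in> wedges A"
      using pre_wedges[OF U(1) lt] A' by simp
    show "Suc (length (pre (Max A) U)) = length (pre (Max A) T')"
      using U T' by (auto simp: length_pre uwedges_def)
  qed
qed

lemma cep_uwedges:
  assumes "S \<in> wedges A"
  shows "(cep S :: _ \<Rightarrow>\<^sub>0 'k::comm_ring_1) \<in> over {T \<in> uwedges A. last T \<noteq> [] \<and> length T = length S}"
proof -
  have "(ce (S @ [[]]) :: _ \<Rightarrow>\<^sub>0 'k) \<in> over (uwedges A)"
    using assms by (intro over_mono[OF ce_uwedges[of _ A]]) (auto simp: uwedges_snoc_Nil)
  moreover have "(lin (\<lambda>S'. sgl (S' @ [[]])) (ce S) :: _ \<Rightarrow>\<^sub>0 'k) \<in> over (uwedges A)"
    by (rule over_lin[OF ce_wedges[OF assms]]) (auto simp: uwedges_snoc_Nil)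
  ultimately have "(cep S :: _ \<Rightarrow>\<^sub>0 'k) \<in> over (uwedges A)"
    by (simp only: cep_def over_diff)
  then show ?thesis
    using cep_over[OF wedges_no_Nil[OF assms]] by (auto simp: over_def)
qed


lemma hpre_homotopy:
  fixes f :: "nat list list \<Rightarrow> (nat list list \<Rightarrow>\<^sub>0 'k::comm_ring_1)"
  assumes f: "\<And>T. T \<in> uwedges B \<Longrightarrow> f T \<in> over {U \<in> uwedges B. length U = Suc (length T)}"
      "\<And>T. T \<in> uwedges B \<Longrightarrow> lin ce (f T) + lin f (ce T) = sgl T"
    and T: "T \<in> uwedges B"
  shows "hpre f (pre a T) \<in> over {pre a U | U. U \<in> uwedges B \<and> length U = Suc (length T)}"
    and "lin ce (hpre f (pre a T)) + lin (hpre f) (ce (pre a T)) = sgl (pre a T)"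
proof -
  have ne: "U \<noteq> []" "[] \<notin> set (butlast U)" if "U \<in> uwedges B" for U
    using that by (auto simp: uwedges_def heads_def)
  show "hpre f (pre a T) \<in> over {pre a U | U. U \<in> uwedges B \<and> length U = Suc (length T)}"
    unfolding hpre_pre[OF ne(1)[OF T]] by (rule over_lin[OF f(1)[OF T]], rule over_single) blast
  have "lin ce (hpre f (pre a T)) = lin (\<lambda>U. ce (pre a U)) (f T)"
    by (simp add: hpre_pre[OF ne(1)[OF T]])
  also have "\<dots> = lin (\<lambda>U. lin (\<lambda>U'. sgl (pre a U')) (ce U)) (f T)"
    by (rule over_lin_cong[OF f(1)[OF T]]) (simp add: ce_pre ne)
  finally have 1: "lin ce (hpre f (pre a T)) = lin (\<lambda>U'. sgl (pre a U')) (lin ce (f T))"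
    by simp
  have "lin (hpre f) (ce (pre a T)) = lin (\<lambda>U. hpre f (pre a U)) (ce T)"
    by (simp add: ce_pre ne[OF T])
  also have "\<dots> = lin (\<lambda>U. lin (\<lambda>U'. sgl (pre a U')) (f U)) (ce T)"
    by (rule over_lin_cong[OF ce_uwedges[OF T]]) (simp add: hpre_pre ne)
  finally have "lin (hpre f) (ce (pre a T)) = lin (\<lambda>U'. sgl (pre a U')) (lin f (ce T))"
    by simp
  then have "lin ce (hpre f (pre a T)) + lin (hpre f) (ce (pre a T))
      = lin (\<lambda>U'. sgl (pre a U')) (lin ce (f T) + lin f (ce T))"
    unfolding 1 lin_add by (rule arg_cong)
  then show "lin ce (hpre f (pre a T)) + lin (hpre f) (ce (pre a T)) = sgl (pre a T)"
    by (simp only: f(2)[OF T] lin_single free_mod.scale_one)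
qed

lemma hpre_wedges:
  fixes f :: "nat list list \<Rightarrow> (nat list list \<Rightarrow>\<^sub>0 'k::comm_ring_1)"
  assumes A: "A \<noteq> {}"
    and f: "\<And>T. T \<in> uwedges (A - {Max A}) \<Longrightarrow> f T \<in> over {U \<in> uwedges (A - {Max A}). length U = Suc (length T)}"
      "\<And>T. T \<in> uwedges (A - {Max A}) \<Longrightarrow> lin ce (f T) + lin f (ce T) = sgl T"
    and S: "S \<in> wedges A"
  shows "hpre f S \<in> over {U \<in> wedges A. length U = Suc (length S)}"
    and "lin ce (hpre f S) + lin (hpre f) (ce S) = sgl S"
proof -
  have fin: "finite A" using S by (auto simp: wedges_def)
  obtain S' where S': "S = pre (Max A) S'" "S' \<in> uwedges (A - {Max A})"
    using wedges_pre[OF S A] .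
  have A': "A = insert (Max A) (A - {Max A})" and lt: "\<And>b. b \<in> A - {Max A} \<Longrightarrow> b < Max A"
    using fin Max_in[OF fin A] by (auto simp: order_less_le)
  have S'': "S' \<noteq> []" using S'(2) by (auto simp: uwedges_def)
  show "hpre f S \<in> over {U \<in> wedges A. length U = Suc (length S)}"
    unfolding S'(1)
  proof (rule over_mono[OF hpre_homotopy(1)[OF f S'(2)]], safe)
    fix U assume U: "U \<in> uwedges (A - {Max A})" "length U = Suc (length S')"
    show "pre (Max A) U \<in> wedges A"
      using pre_wedges[OF U(1) lt] A' by simp
    show "length (pre (Max A) U) = Suc (length (pre (Max A) S'))"
      using U S'' by (auto simp: length_pre uwedges_def)
  qed
  show "lin ce (hpre f S) + lin (hpre f) (ce S) = sgl S"
    unfolding S'(1) by (rule hpre_homotopy(2)[OF f S'(2)])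
qed

text \<open>The complex is an extension of the wedges by the lists with nonempty last word, glued by
  \<open>cep\<close>. With \<open>g\<close> denoting \<open>hpre\<close> of the previous homotopy,
  which serves on both parts, the new one is \<open>g\<close> on each part plus the off-diagonal
  term \<open>- g cep g\<close>. The off-diagonal terms of the identity cancel because
  \<open>cep\<close> anticommutes with the differential. At least one letter is required: on no
  letters \<open>[[]]\<close> is a cycle that bounds nothing.\<close>

lemma contr_homotopy:
  assumes "card A = Suc n" "T \<in> uwedges A"
  shows "(contr (Suc n) T :: _ \<Rightarrow>\<^sub>0 'k::comm_ring_1) \<in> over {U \<in> uwedges A. length U = Suc (length T)}
    \<and> lin ce (contr (Suc n) T) + lin (contr (Suc n)) (ce T) = (sgl T :: _ \<Rightarrow>\<^sub>0 'k)"
  using assms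
proof (induction n arbitrary: A T)
  case 0
  then obtain a where A: "A = {a}" by (auto simp: card_1_singleton_iff)
  have "xs = [a]" if "distinct xs" "set xs = {a}" for xs
    using that by (cases xs; cases "tl xs") auto
  then have c: "concat T = [a]"
    using 0(2) unfolding uwedges_def A by blast
  obtain S u where T: "T = S @ [u]" and S: "[] \<notin> set S"
    using 0(2) by (cases T rule: rev_cases) (auto simp: uwedges_def heads_def)
  \<comment> \<open>On one letter there are just the lists \<open>[[a], []]\<close> and
    \<open>[[a]]\<close>, and \<open>ce\<close> sends the first to minus the second; this is the
    origin of the sign in the base case of \<open>contr\<close>.\<close>
  have "(S = [[a]] \<and> u = []) \<or> (S = [] \<and> u = [a])"
    using c S unfolding T by (cases S; cases "hd S"; cases "tl S"; force simp: append_eq_Cons_conv)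
  then show ?case
    unfolding A T by (auto simp: uwedges_def heads_def intro!: over_uminus)
next
  case (Suc n)
  let ?f = "contr (Suc n) :: _ \<Rightarrow> _ \<Rightarrow>\<^sub>0 'k"
  let ?g = "hpre ?f" and ?F = "contr (Suc (Suc n)) :: _ \<Rightarrow> _ \<Rightarrow>\<^sub>0 'k"
  let ?app = "lin (\<lambda>S. sgl (S @ [[]])) :: _ \<Rightarrow> (_ \<Rightarrow>\<^sub>0 'k)"
  have fin: "finite A" using Suc.prems(1) by (metis card.infinite nat.distinct(1))
  have A: "A \<noteq> {}" using Suc.prems(1) by auto
  have f: "?f T \<in> over {U \<in> uwedges (A - {a}). length U = Suc (length T)}"
      "lin ce (?f T) + lin ?f (ce T) = sgl T" if "a \<in> A" "T \<in> uwedges (A - {a})" for a T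
    using Suc.IH[of "A - {a}" T] that Suc.prems(1) fin by (auto simp del: contr.simps)
  have F1: "?F U = ?g U" if "last U \<noteq> []" for U
    using that by simp
  have F0: "?F (S @ [[]]) = ?app (?g S) - lin ?g (lin cep (?g S))" for S
    by (simp only: contr.simps Let_def) simp
  have g: "?g U \<in> over {V \<in> uwedges A. length V = Suc (length U)} \<and> lin ce (?g U) + lin ?g (ce U) = sgl U
      \<and> lin ?F (ce U) = lin ?g (ce U)" if U: "U \<in> uwedges A" "last U \<noteq> []" for U
  proof -
    obtain a U' where U': "U = pre a U'" "a \<in> A" "U' \<in> uwedges (A - {a})"
      using uwedges_pre[OF U] .
    have ne: "U' \<noteq> []" "[] \<notin> set (butlast U')"
      using U'(3) by (auto simp: uwedges_def heads_def)
    have "?g U \<in> over {V \<in> uwedges A. length V = Suc (length U)}"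
      unfolding U'(1)
    proof (rule over_mono[OF hpre_homotopy(1)[OF f[OF U'(2)] U'(3)]], assumption, assumption, safe)
      fix V assume V: "V \<in> uwedges (A - {a})" "length V = Suc (length U')"
      show "pre a V \<in> uwedges A"
        using pre_uwedges[OF V(1), of a] U'(2) by (simp add: insert_absorb)
      show "length (pre a V) = Suc (length (pre a U'))"
        using V ne by (auto simp: length_pre uwedges_def)
    qed
    moreover have "lin ce (?g U) + lin ?g (ce U) = sgl U"
      unfolding U'(1) by (rule hpre_homotopy(2)[OF f[OF U'(2)] U'(3)])
    \<comment> \<open>The last word stays nonempty under the differential, and on such lists
      \<open>?F\<close> is \<open>?g\<close>.\<close>
    moreover have "lin ?F (ce U) = lin ?g (ce U)"
      unfolding U'(1) ce_pre[OF ne] lin_lin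
      by (rule lin_cong) (simp only: lin_single free_mod.scale_one F1 last_pre list.distinct simp_thms)
    ultimately show ?thesis by simp
  qed
  show ?case
  proof (cases "last T = []")
    case False
    then show ?thesis
      using g[OF Suc.prems(2) False] by (simp only: F1 not_False_eq_True simp_thms)
  next
    case True
    then obtain S where T: "T = S @ [[]]"
      using Suc.prems(2) by (cases T rule: rev_cases) (auto simp: uwedges_def)
    have S: "S \<in> wedges A" using Suc.prems(2) by (simp add: T uwedges_snoc_Nil)
    have gS: "?g S \<in> over {U \<in> wedges A. length U = Suc (length S)}"
      and gid: "lin ce (?g S) + lin ?g (ce S) = sgl S"
      using hpre_wedges[OF A f[OF Max_in[OF fin A]] S] by blast+
    define H where "H = ?g S"
    have cH: "lin cep H \<in> over {U \<in> uwedges A. last U \<noteq> [] \<and> length U = Suc (length S)}"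
      unfolding H_def by (rule over_lin[OF gS]) (rule over_mono[OF cep_uwedges], auto)
    have over: "?F T \<in> over {U \<in> uwedges A. length U = Suc (length T)}"
      unfolding T F0
    proof (rule over_diff)
      show "?app (?g S) \<in> over {U \<in> uwedges A. length U = Suc (length (S @ [[]]))}"
        by (rule over_lin[OF gS]) (auto simp: uwedges_snoc_Nil)
      show "lin ?g (lin cep (?g S)) \<in> over {U \<in> uwedges A. length U = Suc (length (S @ [[]]))}"
        by (rule over_lin[OF cH[unfolded H_def]], rule over_mono[OF conjunct1[OF g]]) auto
    qed
    have dcep: "lin ce (lin cep H) = - lin cep (lin ce H)"
    proof -
      have "lin (\<lambda>U. lin ce (cep U)) H = lin (\<lambda>U. - lin cep (ce U)) H"
        unfolding H_def by (rule over_lin_cong[OF gS], rule ce_cep) (auto dest: wedges_no_Nil)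
      then show ?thesis by (simp add: lin_fun_uminus)
    qed
    have "lin ce (lin ?g y) = y - lin ?g (lin ce y)"
      if "y \<in> over {U \<in> uwedges A. last U \<noteq> [] \<and> length U = Suc (length S)}" for y
    proof -
      have "lin (\<lambda>U. lin ce (?g U)) y = lin (\<lambda>U. sgl U - lin ?g (ce U)) y"
        using g by (intro over_lin_cong[OF that]) (auto simp: eq_diff_eq simp del: contr.simps)
      then show ?thesis by (simp only: lin_fun_diff lin_sgl lin_lin)
    qed
    from this[OF cH] have dg: "lin ce (lin ?g (lin cep H)) = lin cep H + lin ?g (lin cep (lin ce H))"
      unfolding dcep lin_uminus by simp
    have dF: "lin ce (?F T) = ?app (lin ce H) - lin ?g (lin cep (lin ce H))"
      unfolding T F0 lin_diff H_def[symmetric] dg by (simp add: ce_snoc_Nil lin_fun_add)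
    have "lin ?F (cep S) = lin ?g (cep S)"
      by (rule over_lin_cong[OF cep_uwedges[OF S]]) (auto simp: F1 simp del: contr.simps)
    then have Fd: "lin ?F (ce T) = ?app (lin ?g (ce S)) - lin ?g (lin cep (lin ?g (ce S))) + lin ?g (cep S)"
      unfolding T ce_snoc_Nil lin_add lin_lin lin_single free_mod.scale_one F0 lin_fun_diff by simp
    have "lin ce (?F T) + lin ?F (ce T)
        = ?app (lin ce H + lin ?g (ce S)) - lin ?g (lin cep (lin ce H + lin ?g (ce S))) + lin ?g (cep S)"
      unfolding dF Fd lin_add by simp
    also have "\<dots> = sgl T"
      unfolding H_def gid lin_single free_mod.scale_one T by simp
    finally show ?thesis using over by blast
  qed
qed

text \<open>Two letters are the minimum because the homotopy works on what remains after the largest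
  letter is split off, and there \<open>contr_homotopy\<close> asks for at least one.\<close>

theorem wedges_exact:
  fixes z :: "nat list list \<Rightarrow>\<^sub>0 'k::comm_ring_1"
  assumes "2 \<le> card A" "z \<in> over {T \<in> wedges A. length T = k}" "lin ce z = 0"
  obtains y where "y \<in> over {T \<in> wedges A. length T = Suc k}" "lin ce y = z"
proof -
  define n where "n = card A - 2"
  let ?g = "hpre (contr (Suc n)) :: _ \<Rightarrow> _ \<Rightarrow>\<^sub>0 'k"
  have fin: "finite A" using assms(1) by (metis card.infinite not_numeral_le_zero)
  have A: "A \<noteq> {}"
    using assms(1) by auto
  have c: "card (A - {Max A}) = Suc n"
    using assms(1) Max_in[OF fin A] by (simp add: n_def card_Diff_singleton)
  have g: "?g T \<in> over {U \<in> wedges A. length U = Suc (length T)}"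
      "lin ce (?g T) + lin ?g (ce T) = sgl T" if "T \<in> wedges A" for T
    using hpre_wedges[OF A _ _ that, of "contr (Suc n)"] contr_homotopy[OF c] by blast+
  have "lin ?g z \<in> over {T \<in> wedges A. length T = Suc k}"
    by (rule over_lin[OF assms(2)]) (rule over_mono[OF g(1)], auto)
  moreover have "lin ce (lin ?g z) = z"
  proof -
    have "lin ce (lin ?g z) + lin ?g (lin ce z) = lin (\<lambda>T. lin ce (?g T) + lin ?g (ce T)) z"
      by (simp add: lin_fun_add del: contr.simps)
    also have "\<dots> = lin sgl z"
      by (rule over_lin_cong[OF assms(2)]) (use g(2) in auto)
    finally show ?thesis using assms(3) by simp
  qed
  ultimately show thesis by (rule that)
qed

section \<open>Normal forms in the free Lie algebra\<close>

definition mx :: "lie_mono \<Rightarrow> nat" where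
  "mx t = Max (set (leaves t))"

lemma mx_Leaf [simp]: "mx (Leaf i) = i"
  by (simp add: mx_def)

lemma mx_Br [simp]: "mx (Br s t) = max (mx s) (mx t)"
  by (simp add: mx_def Max_Un)

lemma mx_in: "mx t \<in> set (leaves t)"
  by (simp add: mx_def)

lemma mx_neq: "set (leaves s) \<inter> set (leaves t) = {} \<Longrightarrow> mx s \<noteq> mx t"
  using mx_in by (metis disjoint_iff)

lemma mx_lw: "w \<noteq> [] \<Longrightarrow> \<forall>x\<in>set (tl w). x < hd w \<Longrightarrow> mx (left_normed w) = hd w"
  unfolding mx_def by (rule Max_eqI) (cases w; force simp: less_imp_le)+

text \<open>
  Coordinates in the basis of left-normed brackets starting with the largest letter. The value \<open>0\<close>
  on monomials with repeated letters makes \<open>nf\<close> vanish on all of \<open>lie_ideal\<close>.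
\<close>

primrec nf :: "lie_mono \<Rightarrow> (nat list \<Rightarrow>\<^sub>0 'k::comm_ring_1)" where
  "nf (Leaf i) = sgl [i]"
| "nf (Br s t) =
    (if distinct (leaves s @ leaves t)
     then if mx t < mx s then lin (rmul t) (nf s) else - lin (rmul s) (nf t)
     else 0)"

lemma nf_over:
  "(nf t :: _ \<Rightarrow>\<^sub>0 'k::comm_ring_1) \<in> over {w. mset w = mset (leaves t) \<and> hd w = mx t}"
proof (induction t)
  case (Br s t)
  have *: "(lin (rmul q) (nf p) :: _ \<Rightarrow>\<^sub>0 'k) \<in> over {w. mset w = mset (leaves p) + mset (leaves q) \<and> hd w = mx p}"
    if "(nf p :: _ \<Rightarrow>\<^sub>0 'k) \<in> over {w. mset w = mset (leaves p) \<and> hd w = mx p}" for p q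
  proof (rule over_lin[OF that], rule over_mono[OF rmul_over], clarify)
    fix w u assume w: "mset w = mset (leaves p)" "hd w = mx p" and u: "mset u = mset (leaves q)"
    have "w \<noteq> []" using w(1) by auto
    then show "mset (w @ u) = mset (leaves p) + mset (leaves q) \<and> hd (w @ u) = mx p"
      using w u by simp
  qed
  show ?case
    using *[OF Br.IH(1), of t] *[OF Br.IH(2), of s] mx_neq[of s t]
    by (auto simp: max_def add.commute intro!: over_uminus)
qed auto

lemma nf_overD:
  assumes "w \<in> {w. mset w = mset (leaves t) \<and> hd w = mx t}" "distinct (leaves t)"
  shows "w \<noteq> [] \<and> (\<forall>x\<in>set (tl w). x < hd w)"
proof -
  have "w \<noteq> []" using assms(1) by auto
  then obtain a u where w: "w = a # u" by (cases w) auto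
  have "distinct w" "set w = set (leaves t)"
    using assms mset_eq_setD mset_eq_imp_distinct_iff by blast+
  have "x < a" if x: "x \<in> set u" for x
  proof -
    have "x \<in> set (leaves t)" "x \<noteq> a"
      using x \<open>distinct w\<close> \<open>set w = set (leaves t)\<close> by (auto simp: w)
    then have "x \<le> mx t" "x \<noteq> mx t"
      using assms(1) unfolding mx_def w by (simp_all only: Max_ge List.finite_set) simp
    then show ?thesis
      using assms(1) by (simp add: w)
  qed
  then show ?thesis by (auto simp: w)
qed

lemma nf_lw:
  "w \<noteq> [] \<Longrightarrow> distinct w \<Longrightarrow> \<forall>x\<in>set (tl w). x < hd w \<Longrightarrow> nf (left_normed w) = (sgl w :: _ \<Rightarrow>\<^sub>0 'k::comm_ring_1)"
proof (induction w rule: rev_nonempty_induct)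
  case (snoc b w)
  then have "mx (left_normed w) = hd w" by (intro mx_lw) auto
  then show ?case using snoc by (simp add: left_normed_snoc)
qed simp

text \<open>\<open>lie_ideal\<close> holds individual relators and is not closed under sums, so each
  of its elements involves a single multiset of letters; sums enter only through spans.\<close>

lemma lie_ideal_homogeneous:
  "(x :: _ \<Rightarrow>\<^sub>0 'k::comm_ring_1) \<in> lie_ideal \<Longrightarrow> \<exists>M. x \<in> over {t. mset (leaves t) = M}"
proof (induction rule: lie_ideal.induct)
  case (antisym s t)
  show ?case
    by (rule exI[of _ "mset (leaves s) + mset (leaves t)"]) (auto intro!: over_add over_single)
next
  case (jacobi s t u)
  show ?case
    by (rule exI[of _ "mset (leaves s) + mset (leaves t) + mset (leaves u)"]) (auto intro!: over_add over_single)
next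
  case (left x t)
  then obtain M where "x \<in> over {t. mset (leaves t) = M}" by blast
  then show ?case
    by (intro exI[of _ "M + mset (leaves t)"]) (auto intro!: over_lin over_single)
next
  case (right x s)
  then obtain M where "x \<in> over {t. mset (leaves t) = M}" by blast
  then show ?case
    by (intro exI[of _ "mset (leaves s) + M"]) (auto intro!: over_lin over_single)
qed

text \<open>When \<open>s\<close> contains the largest letter, all three terms are right
  multiplications of \<open>nf s\<close>, and the identity says that \<open>rmul\<close> of a
  bracket is a commutator.\<close>

lemma nf_jacobi:
  assumes "distinct (leaves s @ leaves t @ leaves u)" "mx t < mx s" "mx u < mx s"
  shows "nf (Br (Br s t) u) + nf (Br (Br t u) s) + nf (Br (Br u s) t) = (0 :: _ \<Rightarrow>\<^sub>0 'k::comm_ring_1)"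
proof -
  have "nf (Br (Br s t) u) = (lin (rmul u) (lin (rmul t) (nf s)) :: _ \<Rightarrow>\<^sub>0 'k)"
    using assms by (auto simp: max_def)
  moreover have "nf (Br (Br t u) s) = - (lin (rmul (Br t u)) (nf s) :: _ \<Rightarrow>\<^sub>0 'k)"
    using assms by (auto simp: max_def simp del: rmul.simps)
  moreover have "nf (Br (Br u s) t) = - (lin (rmul t) (lin (rmul u) (nf s)) :: _ \<Rightarrow>\<^sub>0 'k)"
    using assms by (auto simp: max_def)
  ultimately show ?thesis
    by (simp add: rmul_Br lin_fun_diff)
qed

text \<open>The case distinction in \<open>nf\<close> depends on the letters alone and is therefore
  constant along a homogeneous relator. In one case the relator sits inside \<open>nf\<close> and
  the induction hypothesis applies, in the other inside \<open>rmul\<close> and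
  \<open>rmul_ideal\<close> applies.\<close>

lemma nf_ideal: "(x :: _ \<Rightarrow>\<^sub>0 'k::comm_ring_1) \<in> lie_ideal \<Longrightarrow> lin nf x = 0"
proof (induction rule: lie_ideal.induct)
  case (antisym s t)
  then show ?case using mx_neq[of s t] by (auto simp: Int_commute)
next
  case (jacobi s t u)
  show ?case
  proof (cases "distinct (leaves s @ leaves t @ leaves u)")
    case True
    then have "mx s \<noteq> mx t" "mx t \<noteq> mx u" "mx s \<noteq> mx u" by (auto intro!: mx_neq)
    \<comment> \<open>Jacobi is invariant under cyclic rotation, so the argument with the largest
      letter can be rotated to the front.\<close>
    then consider "mx t < mx s" "mx u < mx s" | "mx s < mx t" "mx u < mx t" | "mx s < mx u" "mx t < mx u"
      by linarith
    then have "nf (Br (Br s t) u) + nf (Br (Br t u) s) + nf (Br (Br u s) t) = (0 :: _ \<Rightarrow>\<^sub>0 'k)"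
    proof cases
      case 1
      then show ?thesis using True by (intro nf_jacobi) auto
    next
      case 2
      then have "nf (Br (Br t u) s) + nf (Br (Br u s) t) + nf (Br (Br s t) u) = (0 :: _ \<Rightarrow>\<^sub>0 'k)"
        using True by (intro nf_jacobi) auto
      then show ?thesis by (simp only: ac_simps)
    next
      case 3
      then have "nf (Br (Br u s) t) + nf (Br (Br s t) u) + nf (Br (Br t u) s) = (0 :: _ \<Rightarrow>\<^sub>0 'k)"
        using True by (intro nf_jacobi) auto
      then show ?thesis by (simp only: ac_simps)
    qed
    then show ?thesis by (simp only: lin_add lin_single free_mod.scale_one)
  next
    case False
    then have "\<not> distinct (leaves (Br s t) @ leaves u)" "\<not> distinct (leaves (Br t u) @ leaves s)"
        "\<not> distinct (leaves (Br u s) @ leaves t)"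
      by auto
    then show ?thesis by (simp only: lin_add lin_single free_mod.scale_one nf.simps if_False) simp
  qed
next
  case (left x t)
  obtain M where M: "x \<in> over {t. mset (leaves t) = M}"
    using lie_ideal_homogeneous[OF left.hyps] by blast
  obtain m where m: "mset m = M" using ex_mset by blast
  have eq: "distinct (leaves s @ leaves t) \<longleftrightarrow> distinct (m @ leaves t)" "mx s = Max (set m)"
    if "s \<in> {t. mset (leaves t) = M}" for s
    using that mset_eq_setD[of "leaves s" m] mset_eq_imp_distinct_iff[of "leaves s" m] m
    by (auto simp: mx_def)
  have 1: "lin (\<lambda>s. lin (rmul t) (nf s)) x = 0"
    using left.IH by (simp flip: lin_lin)
  have 2: "lin (\<lambda>s. lin (rmul s) (nf t)) x = 0"
    by (subst lin_swap) (simp add: rmul_ideal[OF left.hyps])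
  have "lin (\<lambda>s. nf (Br s t)) x = lin (\<lambda>s. if distinct (m @ leaves t) then
      if mx t < Max (set m) then lin (rmul t) (nf s) else - lin (rmul s) (nf t) else 0) x"
    by (rule over_lin_cong[OF M]) (simp only: nf.simps eq)
  also have "\<dots> = 0"
    using 1 2 by (cases "distinct (m @ leaves t)"; cases "mx t < Max (set m)")
      (simp_all only: if_True if_False lin_fun_uminus lin_fun_zero minus_zero)
  finally show ?case by simp
next
  case (right x s)
  obtain M where M: "x \<in> over {t. mset (leaves t) = M}"
    using lie_ideal_homogeneous[OF right.hyps] by blast
  obtain m where m: "mset m = M" using ex_mset by blast
  have eq: "distinct (leaves s @ leaves t) \<longleftrightarrow> distinct (leaves s @ m)" "mx t = Max (set m)"
    if "t \<in> {t. mset (leaves t) = M}" for t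
    using that mset_eq_setD[of "leaves t" m] mset_eq_imp_distinct_iff[of "leaves t" m] m
    by (auto simp: mx_def)
  have 1: "lin (\<lambda>t. lin (rmul s) (nf t)) x = 0"
    using right.IH by (simp flip: lin_lin)
  have 2: "lin (\<lambda>t. lin (rmul t) (nf s)) x = 0"
    by (subst lin_swap) (simp add: rmul_ideal[OF right.hyps])
  have "lin (\<lambda>t. nf (Br s t)) x = lin (\<lambda>t. if distinct (leaves s @ m) then
      if Max (set m) < mx s then lin (rmul t) (nf s) else - lin (rmul s) (nf t) else 0) x"
    by (rule over_lin_cong[OF M]) (simp only: nf.simps eq)
  also have "\<dots> = 0"
    using 1 2 by (cases "distinct (leaves s @ m)"; cases "Max (set m) < mx s")
      (simp_all only: if_True if_False lin_fun_uminus lin_fun_zero minus_zero)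
  finally show ?case by simp
qed

section \<open>Tuples of monomials in normal form, and congruence to the normal form\<close>

primrec tens :: "lie_mono list \<Rightarrow> (nat list list \<Rightarrow>\<^sub>0 'k::comm_ring_1)" where
  "tens [] = sgl []"
| "tens (t # ts) = lin (\<lambda>w. lin (\<lambda>ws. sgl (w # ws)) (tens ts)) (nf t)"

lemma tens_ideal: "x \<in> lie_ideal \<Longrightarrow> lin (\<lambda>t. tens (us @ t # vs)) x = 0"
proof (induction us)
  case Nil
  then show ?case using nf_ideal[of x] by (simp flip: lin_lin)
next
  case (Cons u us)
  have "lin (\<lambda>t. lin (\<lambda>ws. sgl (w # ws)) (tens (us @ t # vs))) x
      = lin (\<lambda>ws. sgl (w # ws)) (lin (\<lambda>t. tens (us @ t # vs)) x)" for w
    by (simp only: lin_lin)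
  then show ?case using Cons by (simp, subst lin_swap) simp
qed

definition wordy :: "nat list \<Rightarrow> bool" where
  "wordy w \<longleftrightarrow> w \<noteq> [] \<and> distinct w \<and> (\<forall>x\<in>set (tl w). x < hd w)"

lemma tens_lw: "\<forall>w\<in>set ws. wordy w \<Longrightarrow> tens (map left_normed ws) = (sgl ws :: _ \<Rightarrow>\<^sub>0 'k::comm_ring_1)"
  by (induction ws) (auto simp: nf_lw wordy_def)

lemma tens_over:
  assumes "distinct (concat (map leaves ts))"
  shows "(tens ts :: _ \<Rightarrow>\<^sub>0 'k::comm_ring_1) \<in>
    over {ws. list_all2 (\<lambda>w t. wordy w \<and> mset w = mset (leaves t) \<and> hd w = mx t) ws ts}"
  using assms
proof (induction ts)
  case (Cons t ts)
  show ?case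
    unfolding tens.simps
  proof (rule over_lin[OF nf_over])
    fix w assume w: "w \<in> {w. mset w = mset (leaves t) \<and> hd w = mx t}"
    then have "wordy w"
      using nf_overD[OF w] Cons.prems mset_eq_imp_distinct_iff unfolding wordy_def by auto
    then show "(lin (\<lambda>ws. sgl (w # ws)) (tens ts) :: _ \<Rightarrow>\<^sub>0 'k) \<in>
        over {ws. list_all2 (\<lambda>w t. wordy w \<and> mset w = mset (leaves t) \<and> hd w = mx t) ws (t # ts)}"
      using w Cons by (intro over_lin[OF Cons.IH] over_single) auto
  qed
qed simp

text \<open>Relators with prescribed letters: substituting their monomials into one slot of a valid
  list keeps the list valid.\<close>

definition lie_rel :: "nat multiset \<Rightarrow> (lie_mono \<Rightarrow>\<^sub>0 'k::comm_ring_1) set" where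
  "lie_rel M = {x \<in> lie_ideal. x \<in> over {t. mset (leaves t) = M}}"

lemma lie_rel_Br_left:
  "x \<in> free_mod.span (lie_rel M) \<Longrightarrow> lin (\<lambda>s. sgl (Br s t)) x \<in> free_mod.span (lie_rel (M + mset (leaves t)))"
  by (erule lin_span) (auto intro!: free_mod.span_base lie_ideal.left over_lin simp: lie_rel_def)

text \<open>Jacobi and antisymmetry turn \<open>[w, [p, q]]\<close> into
  \<open>[[w, p], q] - [[w, q], p]\<close>, which is the recursion defining \<open>rmul\<close>; the
  numbered facts are the congruences whose combination gives the claim.\<close>

lemma Br_lw_rmul:
  assumes "w \<noteq> []"
  shows "(sgl (Br (left_normed w) t) - lin (\<lambda>v. sgl (left_normed v)) (rmul t w) :: _ \<Rightarrow>\<^sub>0 'k::comm_ring_1)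
    \<in> free_mod.span (lie_rel (mset w + mset (leaves t)))"
  using assms
proof (induction t arbitrary: w)
  case (Leaf a)
  then show ?case by (simp add: left_normed_snoc free_mod.span_zero)
next
  case (Br p q)
  let ?L = "lin (\<lambda>v. sgl (left_normed v)) :: _ \<Rightarrow> (_ \<Rightarrow>\<^sub>0 'k)"
  let ?M = "mset w + mset (leaves (Br p q))"
  have *: "sgl (Br (Br (left_normed w) p) q) - ?L (lin (rmul q) (rmul p w)) \<in> free_mod.span (lie_rel (mset w + mset (leaves p) + mset (leaves q)))"
    if p: "\<And>w. w \<noteq> [] \<Longrightarrow> sgl (Br (left_normed w) p) - ?L (rmul p w) \<in> free_mod.span (lie_rel (mset w + mset (leaves p)))"
      and q: "\<And>w. w \<noteq> [] \<Longrightarrow> sgl (Br (left_normed w) q) - ?L (rmul q w) \<in> free_mod.span (lie_rel (mset w + mset (leaves q)))"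
    for p q
  proof -
    have "lin (\<lambda>v. sgl (Br (left_normed v) q) - ?L (rmul q v)) (rmul p w) \<in> free_mod.span (lie_rel (mset w + mset (leaves p) + mset (leaves q)))"
    proof (rule lin_in_span)
      fix v assume "v \<in> Poly_Mapping.keys (rmul p w :: _ \<Rightarrow>\<^sub>0 'k)"
      then obtain u where "v = w @ u" "mset u = mset (leaves p)"
        using rmul_over[of p w] by (auto simp: over_def)
      then show "sgl (Br (left_normed v) q) - ?L (rmul q v) \<in> free_mod.span (lie_rel (mset w + mset (leaves p) + mset (leaves q)))"
        using q[of v] Br.prems by simp
    qed
    from free_mod.span_add[OF this lie_rel_Br_left[OF p[OF Br.prems], of q]]
    show ?thesis by (simp add: lin_fun_diff)
  qed
  have 1: "sgl (Br (Br (left_normed w) p) q) - ?L (lin (rmul q) (rmul p w)) \<in> free_mod.span (lie_rel ?M)"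
    using *[OF Br.IH] by (simp add: ac_simps)
  have 2: "sgl (Br (Br (left_normed w) q) p) - ?L (lin (rmul p) (rmul q w)) \<in> free_mod.span (lie_rel ?M)"
    using *[OF Br.IH(2,1)] by (simp add: ac_simps)
  have 3: "sgl (Br (Br (left_normed w) p) q) + sgl (Br (Br p q) (left_normed w)) + sgl (Br (Br q (left_normed w)) p) \<in> free_mod.span (lie_rel ?M :: (_ \<Rightarrow>\<^sub>0 'k) set)"
    using Br.prems by (intro free_mod.span_base) (auto simp: lie_rel_def intro!: lie_ideal.jacobi over_add over_single)
  have 4: "sgl (Br (Br p q) (left_normed w)) + sgl (Br (left_normed w) (Br p q)) \<in> free_mod.span (lie_rel ?M :: (_ \<Rightarrow>\<^sub>0 'k) set)"
    using Br.prems by (intro free_mod.span_base) (auto simp: lie_rel_def intro!: lie_ideal.antisym over_add over_single)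
  have 5: "sgl (Br (Br q (left_normed w)) p) + sgl (Br (Br (left_normed w) q) p) \<in> free_mod.span (lie_rel ?M :: (_ \<Rightarrow>\<^sub>0 'k) set)"
    using lie_ideal.left[OF lie_ideal.antisym[of q "left_normed w"], of p] Br.prems
    by (intro free_mod.span_base) (auto simp: lie_rel_def intro!: over_add over_single)
  from free_mod.span_add[OF free_mod.span_add[OF free_mod.span_diff[OF free_mod.span_diff[OF 1 2] 3] 4] 5]
  show ?case by (simp add: algebra_simps)
qed

text \<open>The spanning half of the statement that left-normed brackets headed by their largest
  letter form a basis; independence is \<open>nf_ideal\<close> together with
  \<open>nf_lw\<close>.\<close>

lemma lie_cong_nf:
  "distinct (leaves t) \<Longrightarrow>
    (sgl t - lin (\<lambda>w. sgl (left_normed w)) (nf t) :: _ \<Rightarrow>\<^sub>0 'k::comm_ring_1) \<in> free_mod.span (lie_rel (mset (leaves t)))"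
proof (induction t)
  case (Leaf a)
  then show ?case by (simp add: free_mod.span_zero)
next
  case (Br s t)
  let ?L = "lin (\<lambda>v. sgl (left_normed v)) :: _ \<Rightarrow> (_ \<Rightarrow>\<^sub>0 'k)"
  have *: "sgl (Br p q) - ?L (lin (rmul q) (nf p)) \<in> free_mod.span (lie_rel (mset (leaves p) + mset (leaves q)))"
    if p: "sgl p - ?L (nf p) \<in> free_mod.span (lie_rel (mset (leaves p)))" for p q
  proof -
    have "lin (\<lambda>v. sgl (Br (left_normed v) q) - ?L (rmul q v)) (nf p) \<in> free_mod.span (lie_rel (mset (leaves p) + mset (leaves q)))"
    proof (rule lin_in_span)
      fix v assume "v \<in> Poly_Mapping.keys (nf p :: _ \<Rightarrow>\<^sub>0 'k)"
      then have v: "mset v = mset (leaves p)"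
        using nf_over[of p] by (auto simp: over_def)
      then have "v \<noteq> []" by auto
      from Br_lw_rmul[OF this, of q] show "sgl (Br (left_normed v) q) - ?L (rmul q v) \<in> free_mod.span (lie_rel (mset (leaves p) + mset (leaves q)))"
        by (simp add: v)
    qed
    from free_mod.span_add[OF this lie_rel_Br_left[OF p, of q]]
    show ?thesis by (simp add: lin_fun_diff)
  qed
  have a: "sgl (Br s t) + sgl (Br t s) \<in> free_mod.span (lie_rel (mset (leaves (Br s t))) :: (_ \<Rightarrow>\<^sub>0 'k) set)"
    by (intro free_mod.span_base) (auto simp: lie_rel_def intro!: lie_ideal.antisym over_add over_single)
  show ?case
  proof (cases "mx t < mx s")
    case True
    then show ?thesis using *[of s t] Br by simp
  next
    case False
    have "sgl (Br t s) - ?L (lin (rmul s) (nf t)) \<in> free_mod.span (lie_rel (mset (leaves (Br s t))))"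
      using *[of t s] Br by (simp add: add.commute)
    from free_mod.span_diff[OF a this] show ?thesis using False Br.prems by simp
  qed
qed


section \<open>The composite product over ordered partitions of the inputs\<close>

text \<open>
  The pair \<open>(l, [t\<^sub>1, \<dots>, t\<^sub>m])\<close> stands for \<open>l \<circ> (t\<^sub>1, \<dots>, t\<^sub>m)\<close> with the inputs of the composite as
  leaves of the \<open>t\<^sub>i\<close>; since the modules of labels are free over the symmetric groups, all
  permutations can be absorbed in this way.
\<close>

type_synonym lelem = "lab \<times> lie_mono list"

definition valid :: "nat \<Rightarrow> lelem set" where
  "valid n = {(l, ts). length ts = lab_ar l \<and> distinct (concat (map leaves ts)) \<and> set (concat (map leaves ts)) = {1..n}}"

definition slot_rels :: "nat \<Rightarrow> (lelem \<Rightarrow>\<^sub>0 'k::comm_ring_1) set" where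
  "slot_rels n = {lin (\<lambda>t. sgl (l, us @ t # vs)) x | l us vs x M.
     x \<in> lie_rel M \<and> (\<forall>t. mset (leaves t) = M \<longrightarrow> (l, us @ t # vs) \<in> valid n)}"

definition NF :: "lelem \<Rightarrow> (lab \<times> nat list list \<Rightarrow>\<^sub>0 'k::comm_ring_1)" where
  "NF = (\<lambda>(l, ts). lin (\<lambda>ws. sgl (l, ws)) (tens ts))"

definition of_words :: "lab \<times> nat list list \<Rightarrow> lelem" where
  "of_words = (\<lambda>(l, ws). (l, map left_normed ws))"

abbreviation renorm :: "(lelem \<Rightarrow>\<^sub>0 'k::comm_ring_1) \<Rightarrow> (lelem \<Rightarrow>\<^sub>0 'k)" where
  "renorm x \<equiv> lin (\<lambda>g. sgl (of_words g)) (lin NF x)"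

lemma NF_slot_rels: "x \<in> slot_rels n \<Longrightarrow> lin NF x = 0"
proof -
  assume "x \<in> slot_rels n"
  then obtain l us vs y where x: "x = lin (\<lambda>t. sgl (l, us @ t # vs)) y" and y: "y \<in> lie_ideal"
    unfolding slot_rels_def lie_rel_def by blast
  have "lin NF x = lin (\<lambda>ws. sgl (l, ws)) (lin (\<lambda>t. tens (us @ t # vs)) y)"
    by (simp add: x NF_def)
  then show ?thesis by (simp only: tens_ideal[OF y] lin_zero)
qed

lemma valid_replace:
  assumes "(l, us @ t # vs) \<in> valid n" "mset (leaves t') = mset (leaves t)"
  shows "(l, us @ t' # vs) \<in> valid n"
  using assms(1) mset_eq_setD[OF assms(2)] mset_eq_imp_distinct_iff[OF assms(2)] by (simp add: valid_def)

lemma slot_cong: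
  assumes "x \<in> free_mod.span (lie_rel (mset (leaves t)))" "(l, us @ t # vs) \<in> valid n"
  shows "lin (\<lambda>t. sgl (l, us @ t # vs)) x \<in> free_mod.span (slot_rels n)"
proof (rule lin_span[OF assms(1)], rule free_mod.span_base)
  fix y :: "lie_mono \<Rightarrow>\<^sub>0 'a" assume "y \<in> lie_rel (mset (leaves t))"
  then show "lin (\<lambda>t. sgl (l, us @ t # vs)) y \<in> slot_rels n"
    using valid_replace[OF assms(2)] unfolding slot_rels_def
    by (intro CollectI exI[of _ l] exI[of _ us] exI[of _ vs] exI[of _ y] exI[of _ "mset (leaves t)"]) simp
qed

text \<open>The slots are normalized one after the other; \<open>us\<close> collects those already
  treated.\<close>

lemma renorm_cong_aux:
  assumes "(l, us @ ts) \<in> valid n"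
  shows "(sgl (l, us @ ts) - lin (\<lambda>ws. sgl (l, us @ map left_normed ws)) (tens ts) :: _ \<Rightarrow>\<^sub>0 'k::comm_ring_1)
    \<in> free_mod.span (slot_rels n)"
  using assms
proof (induction ts arbitrary: us)
  case Nil
  then show ?case by (simp add: free_mod.span_zero)
next
  case (Cons t ts)
  have t: "distinct (leaves t)" using Cons.prems by (auto simp: valid_def)
  have "lin (\<lambda>w. sgl (l, us @ left_normed w # ts) - lin (\<lambda>ws. sgl (l, us @ left_normed w # map left_normed ws)) (tens ts)) (nf t :: _ \<Rightarrow>\<^sub>0 'k)
      \<in> free_mod.span (slot_rels n)"
  proof (rule lin_in_span)
    fix w assume "w \<in> Poly_Mapping.keys (nf t :: _ \<Rightarrow>\<^sub>0 'k)"
    then have w: "mset w = mset (leaves t)" using nf_over[of t] by (auto simp: over_def)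
    then have "w \<noteq> []" by auto
    then have "(l, us @ left_normed w # ts) \<in> valid n"
      by (intro valid_replace[OF Cons.prems]) (simp add: w)
    then show "sgl (l, us @ left_normed w # ts) - lin (\<lambda>ws. sgl (l, us @ left_normed w # map left_normed ws)) (tens ts)
        \<in> free_mod.span (slot_rels n :: (_ \<Rightarrow>\<^sub>0 'k) set)"
      using Cons.IH[of "us @ [left_normed w]"] by simp
  qed
  from free_mod.span_add[OF slot_cong[OF lie_cong_nf[OF t] Cons.prems] this]
  show ?case by (simp add: lin_fun_diff)
qed

lemma renorm_cong:
  assumes "x \<in> over (valid n)"
  shows "(x - renorm x :: _ \<Rightarrow>\<^sub>0 'k::comm_ring_1) \<in> free_mod.span (slot_rels n)"
proof -
  have "lin (\<lambda>g. sgl g - renorm (sgl g)) x \<in> free_mod.span (slot_rels n)"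
  proof (rule lin_in_span)
    fix g assume "g \<in> Poly_Mapping.keys x"
    then have "g \<in> valid n" using assms by (auto simp: over_def)
    then show "sgl g - renorm (sgl g) \<in> free_mod.span (slot_rels n :: (_ \<Rightarrow>\<^sub>0 'k) set)"
      using renorm_cong_aux[of "fst g" "[]" "snd g" n] by (cases g) (simp add: NF_def of_words_def)
  qed
  then show ?thesis by (simp add: lin_fun_diff)
qed

text \<open>Equality in the quotient becomes equality in a free module on words: \<open>NF\<close>
  kills the relators, and every list is congruent to its renormalization.\<close>

lemma NF_eq_0_iff:
  assumes "x \<in> over (valid n)"
  shows "lin NF x = 0 \<longleftrightarrow> (x :: _ \<Rightarrow>\<^sub>0 'k::comm_ring_1) \<in> free_mod.span (slot_rels n)"
proof
  assume "lin NF x = 0"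
  then show "x \<in> free_mod.span (slot_rels n)"
    using renorm_cong[OF assms] by (simp del: lin_lin)
qed (erule lin_span_eq_0, erule NF_slot_rels)

definition valid_words :: "nat \<Rightarrow> (lab \<times> nat list list) set" where
  "valid_words n = {(l, ws). length ws = lab_ar l \<and> (\<forall>w\<in>set ws. wordy w) \<and> distinct (concat ws) \<and> set (concat ws) = {1..n}}"

lemma NF_of_words: "g \<in> valid_words n \<Longrightarrow> NF (of_words g) = (sgl g :: _ \<Rightarrow>\<^sub>0 'k::comm_ring_1)"
  by (auto simp: NF_def of_words_def valid_words_def tens_lw)

lemma leaves_map_lw: "\<forall>w\<in>set ws. wordy w \<Longrightarrow> map leaves (map left_normed ws) = ws"
  by (induction ws) (auto simp: wordy_def)

lemma of_words_valid: "g \<in> valid_words n \<Longrightarrow> of_words g \<in> valid n"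
  by (cases g) (auto simp only: of_words_def valid_words_def valid_def leaves_map_lw length_map prod.case mem_Collect_eq)

lemma NF_over:
  assumes "(l, ts) \<in> valid n"
  shows "(NF (l, ts) :: _ \<Rightarrow>\<^sub>0 'k::comm_ring_1) \<in> over {g \<in> valid_words n. fst g = l}"
proof -
  have *: "mset (concat ws) = mset (concat (map leaves ts)) \<and> length ws = length ts \<and> (\<forall>w\<in>set ws. wordy w)"
    if "list_all2 (\<lambda>w t. wordy w \<and> mset w = mset (leaves t) \<and> hd w = mx t) ws ts" for ws
    using that by (induction rule: list_all2_induct) auto
  have "(l, ws) \<in> valid_words n"
    if "list_all2 (\<lambda>w t. wordy w \<and> mset w = mset (leaves t) \<and> hd w = mx t) ws ts" for ws
    using *[OF that] assms mset_eq_setD[of "concat ws" "concat (map leaves ts)"]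
      mset_eq_imp_distinct_iff[of "concat ws" "concat (map leaves ts)"]
    unfolding valid_words_def valid_def by (simp del: set_concat)
  moreover have "distinct (concat (map leaves ts))"
    using assms by (auto simp: valid_def)
  ultimately show ?thesis
    unfolding NF_def prod.case by (intro over_lin[OF tens_over] over_single) auto
qed

lemma NF_renorm:
  assumes "x \<in> over (valid n)"
  shows "lin NF (renorm x) = (lin NF x :: _ \<Rightarrow>\<^sub>0 'k::comm_ring_1)"
proof -
  have "lin NF x \<in> over (valid_words n)"
    by (rule over_lin[OF assms]) (auto intro: over_mono[OF NF_over])
  then have "lin (\<lambda>g. NF (of_words g)) (lin NF x) = lin sgl (lin NF x)"
    by (rule over_lin_cong) (rule NF_of_words)
  then show ?thesis by simp
qed

section \<open>The twisting part of the differential\<close>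

text \<open>The cycle \<open>p -> i -> i + 1 -> ... -> p\<close>; these are the reduced shuffles
  when one block has size two and the others size one.\<close>

definition shift :: "nat \<Rightarrow> nat \<Rightarrow> nat \<Rightarrow> nat" where
  "shift p i k = (if k = p then i else if i \<le> k \<and> k < p then Suc k else k)"

definition unshift :: "nat \<Rightarrow> nat \<Rightarrow> nat \<Rightarrow> nat" where
  "unshift p i k = (if k = i then p else if i < k \<and> k \<le> p then k - 1 else k)"

lemma shift_unshift: "i \<le> p \<Longrightarrow> shift p i (unshift p i k) = k" "i \<le> p \<Longrightarrow> unshift p i (shift p i k) = k"
  by (auto simp: shift_def unshift_def)

lemma inv_shift: "i \<le> p \<Longrightarrow> inv (shift p i) = unshift p i" "i \<le> p \<Longrightarrow> inv (unshift p i) = shift p i"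
  by (rule inv_unique_comp; auto simp: shift_unshift fun_eq_iff)+

lemma shift_permutes: "1 \<le> i \<Longrightarrow> i \<le> p \<Longrightarrow> p \<le> n \<Longrightarrow> shift p i permutes {1..n}"
  by (rule bij_imp_permutes) (auto intro!: bij_betw_byWitness[of _ "unshift p i"] simp: shift_unshift, auto simp: shift_def unshift_def split: if_splits)

lemma unshift_permutes: "1 \<le> i \<Longrightarrow> i \<le> p \<Longrightarrow> p \<le> n \<Longrightarrow> unshift p i permutes {1..n}"
  using permutes_inv[OF shift_permutes] by (simp add: inv_shift)

lemma sign_unshift:
  assumes "1 \<le> i" "i \<le> p"
  shows "sign (unshift p i) = (- 1) ^ (p - i)"
  using assms(2)
proof (induction p rule: dec_induct)
  case base
  have "unshift i i = id" by (auto simp: unshift_def)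
  then show ?case by simp
next
  case (step q)
  have eq: "unshift (Suc q) i = transpose q (Suc q) \<circ> unshift q i"
    using step by (auto simp: unshift_def transpose_def fun_eq_iff)
  have "permutation (unshift q i)"
    using unshift_permutes[of i q q] step assms(1) permutation_permutes by blast
  then have "sign (unshift (Suc q) i) = - sign (unshift q i)"
    unfolding eq by (simp only: sign_compose permutation_swap_id sign_swap_id) simp
  then show ?case
    using step by (simp add: Suc_diff_le)
qed

text \<open>The block sizes of \<open>l\<^bsub>n-1\<^esub> \<circ> (1, \<dots>, l\<^sub>2, \<dots>, 1)\<close>, with \<open>l\<^sub>2\<close> in position \<open>p\<close>.\<close>

definition mid :: "nat \<Rightarrow> nat \<Rightarrow> nat list" where
  "mid n p = replicate (p - 1) 1 @ 2 # replicate (n - 1 - p) 1"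

lemma length_mid: "1 \<le> p \<Longrightarrow> p < n \<Longrightarrow> length (mid n p) = n - 1"
  and sum_list_mid: "1 \<le> p \<Longrightarrow> p < n \<Longrightarrow> sum_list (mid n p) = n"
  and nth_mid: "1 \<le> p \<Longrightarrow> p < n \<Longrightarrow> k < n - 1 \<Longrightarrow> mid n p ! k = (if k = p - 1 then 2 else 1)"
  by (auto simp: mid_def sum_list_replicate nth_append nth_Cons')

lemma sum_take_mid:
  "1 \<le> p \<Longrightarrow> p < n \<Longrightarrow> q \<le> n - 1 \<Longrightarrow> sum_list (take q (mid n p)) = (if q < p then q else Suc q)"
  by (auto simp: mid_def take_Cons' sum_list_replicate min_def)

lemma blk_replicate: "1 \<le> k \<Longrightarrow> blk (replicate r 1) k = min k (Suc r)"
  by (induction r arbitrary: k) auto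

lemma blk_mid:
  assumes "1 \<le> p" "p < n" "1 \<le> k" "k \<le> n"
  shows "blk (mid n p) k = (if k \<le> p then k else k - 1)"
proof -
  have "blk (replicate m 1 @ 2 # replicate r 1) k = (if k \<le> Suc m then k else k - 1)"
    if "1 \<le> k" "k \<le> m + r + 2" for m r k
    using that
  proof (induction m arbitrary: k)
    case 0
    then show ?case using blk_replicate[of "k - 2" r] by auto
  next
    case (Suc m)
    then show ?case using Suc.IH[of "k - 1"] by auto
  qed
  from this[of k "p - 1" "n - 1 - p"] show ?thesis
    using assms by (auto simp: mid_def)
qed

text \<open>Being increasing away from \<open>p\<close>, the permutation is determined by its value
  at \<open>p\<close>. Counting the places on either side of \<open>k < p\<close> confines the value
  there to \<open>k\<close> or \<open>Suc k\<close>; induction decides between the two according to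
  whether the value taken at \<open>p\<close> has been passed.\<close>

lemma red_shuffle_mid:
  assumes p: "1 \<le> p" "p < n" and \<tau>: "\<tau> permutes {1..n}"
    and inc: "\<And>a b. 1 \<le> a \<Longrightarrow> a < b \<Longrightarrow> b \<le> n \<Longrightarrow> a \<noteq> p \<Longrightarrow> b \<noteq> p \<Longrightarrow> \<tau> a < \<tau> b"
    and inc_p: "\<tau> p < \<tau> (Suc p)"
  shows "1 \<le> \<tau> p" "\<tau> p \<le> p" "\<tau> = shift p (\<tau> p)"
proof -
  have in_range: "1 \<le> \<tau> k \<and> \<tau> k \<le> n" if "1 \<le> k" "k \<le> n" for k
    using permutes_in_image[OF \<tau>, of k] that by auto
  have inj: "inj \<tau>" using \<tau> by (rule permutes_inj)
  have inc': "\<tau> a < \<tau> b" if "1 \<le> a" "a < b" "b \<le> n" "b \<noteq> p" for a b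
  proof (cases "a = p")
    case True
    then show ?thesis
      using inc_p inc[of "Suc p" b] that by (cases "b = Suc p") auto
  qed (use inc that in auto)
  have upper: "card S \<le> n - \<tau> k" if "S \<subseteq> {k<..n}" "p \<notin> S" "1 \<le> k" for S k
  proof -
    have "\<tau> ` S \<subseteq> {\<tau> k<..n}"
      using that inc'[of k] in_range by fastforce
    then have "card (\<tau> ` S) \<le> card {\<tau> k<..n}" by (intro card_mono) auto
    then show ?thesis using inj by (simp add: card_image inj_on_def)
  qed
  have ge: "k \<le> \<tau> k" if "1 \<le> k" "k \<le> n" "k \<noteq> p" for k
  proof -
    have "\<tau> ` {1..<k} \<subseteq> {1..<\<tau> k}"
      using that inc'[of _ k] in_range by fastforce
    then have "card (\<tau> ` {1..<k}) \<le> card {1..<\<tau> k}" by (intro card_mono) auto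
    then have "k - 1 \<le> \<tau> k - 1" using inj by (simp add: card_image inj_on_def)
    then show ?thesis using in_range[of k] that by linarith
  qed
  have le: "\<tau> k \<le> k" if "p \<le> k" "k \<le> n" for k
  proof -
    have "n - k \<le> n - \<tau> k" using upper[of "{k<..n}" k] that p by simp
    then show ?thesis using that p in_range[of k] by linarith
  qed
  have le': "\<tau> k \<le> Suc k" if "1 \<le> k" "k < p" for k
    using upper[of "{k<..n} - {p}" k] that p in_range[of k] by (simp add: card_Diff_singleton)
  show i: "1 \<le> \<tau> p" "\<tau> p \<le> p" using in_range[of p] le[of p] p by auto
  have low: "\<tau> k = (if k < \<tau> p then k else Suc k)" if "1 \<le> k" "k < p" for k
    using that
  proof (induction k rule: less_induct)
    case (less k)
    have dich: "\<tau> k = k \<or> \<tau> k = Suc k"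
      using ge[of k] le'[of k] less.prems p by auto
    show ?case
    proof (cases "k < \<tau> p")
      case True
      have "\<tau> k = k"
      proof (rule ccontr)
        assume "\<tau> k \<noteq> k"
        obtain m where m: "\<tau> m = k" using permutes_surj[OF \<tau>] by (metis surjD)
        have mn: "1 \<le> m" "m \<le> n"
          using permutes_in_image[OF \<tau>, of m] m less.prems p by auto
        have "m \<noteq> p" "m \<noteq> k" using True m \<open>\<tau> k \<noteq> k\<close> by auto
        moreover have "\<not> p < m" using ge[of m] m mn less.prems by auto
        ultimately have "m < k" using ge[of m] m mn by auto
        then show False using less.IH[of m] True m mn less.prems by auto
      qed
      with True show ?thesis by simp
    next
      case False
      have "\<tau> k \<noteq> k"
      proof
        assume k: "\<tau> k = k"
        show False
        proof (cases "k = \<tau> p")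
          case True
          then have "k = p" using k injD[OF inj] by metis
          then show False using less.prems by simp
        next
          case neq: False
          then have "\<tau> (k - 1) = k" using less.IH[of "k - 1"] False i less.prems by auto
          then have "k - 1 = k" using k injD[OF inj] by metis
          then show False using less.prems by simp
        qed
      qed
      then show ?thesis using dich False by simp
    qed
  qed
  show "\<tau> = shift p (\<tau> p)"
  proof
    fix k
    consider "k < 1 \<or> n < k" | "1 \<le> k" "k < p" | "k = p" | "p < k" "k \<le> n" by linarith
    then show "\<tau> k = shift p (\<tau> p) k"
    proof cases
      case 1
      then have "\<tau> k = k" using permutes_not_in[OF \<tau>] by auto
      with 1 show ?thesis using i p by (auto simp: shift_def)
    next
      case 4
      then show ?thesis using le[of k] ge[of k] p by (auto simp: shift_def)
    qed (use low in \<open>auto simp: shift_def\<close>)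
  qed
qed

text \<open>The ends of the blocks are all places except \<open>p\<close>, so reducedness says that
  the shuffle increases away from \<open>p\<close>, and the only two places in a common block are
  \<open>p\<close> and \<open>Suc p\<close>.\<close>

lemma inv_red_shuffles_mid:
  assumes p: "1 \<le> p" "p < n"
  shows "inv_red_shuffles (mid n p) = unshift p ` {1..p}"
proof -
  have "{\<tau>. \<tau> permutes {1..sum_list (mid n p)}
     \<and> (\<forall>a b. 1 \<le> a \<and> a < b \<and> b \<le> sum_list (mid n p) \<and> blk (mid n p) a = blk (mid n p) b \<longrightarrow> \<tau> a < \<tau> b)
     \<and> (\<forall>q r. 1 \<le> q \<and> q < r \<and> r \<le> length (mid n p) \<longrightarrow> \<tau> (sum_list (take q (mid n p))) < \<tau> (sum_list (take r (mid n p))))}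
     = shift p ` {1..p}" (is "?L = ?R")
  proof (intro equalityI subsetI)
    fix \<tau> assume "\<tau> \<in> ?L"
    then have \<tau>: "\<tau> permutes {1..n}"
      and b: "\<And>a b. 1 \<le> a \<Longrightarrow> a < b \<Longrightarrow> b \<le> n \<Longrightarrow> blk (mid n p) a = blk (mid n p) b \<Longrightarrow> \<tau> a < \<tau> b"
      and e: "\<And>q r. 1 \<le> q \<Longrightarrow> q < r \<Longrightarrow> r \<le> n - 1 \<Longrightarrow>
        \<tau> (sum_list (take q (mid n p))) < \<tau> (sum_list (take r (mid n p)))"
      using p by (auto simp: sum_list_mid length_mid)
    have inc_p: "\<tau> p < \<tau> (Suc p)"
      using p by (intro b) (auto simp: blk_mid)
    have inc: "\<tau> a < \<tau> b" if ab: "1 \<le> a" "a < b" "b \<le> n" "a \<noteq> p" "b \<noteq> p" for a b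
    proof -
      \<comment> \<open>\<open>f c\<close> is the number of the block that ends at
        \<open>c\<close>.\<close>
      define f where "f c = (if c < p then c else c - 1)" for c
      have "sum_list (take (f c) (mid n p)) = c" if "1 \<le> c" "c \<le> n" "c \<noteq> p" for c
        using p that by (subst sum_take_mid) (auto simp: f_def)
      from this[of a] this[of b] have "sum_list (take (f a) (mid n p)) = a" "sum_list (take (f b) (mid n p)) = b"
        using ab by auto
      moreover have "1 \<le> f a" "f a < f b" "f b \<le> n - 1"
        using p ab by (auto simp: f_def)
      ultimately show ?thesis
        using e[of "f a" "f b"] by metis
    qed
    have "1 \<le> \<tau> p" "\<tau> p \<le> p" "\<tau> = shift p (\<tau> p)"
      by (rule red_shuffle_mid[OF p \<tau> inc inc_p]; assumption)+
    then show "\<tau> \<in> ?R"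
      by (intro image_eqI[of _ _ "\<tau> p"]) auto
  next
    fix \<tau> assume "\<tau> \<in> ?R"
    then obtain i where i: "1 \<le> i" "i \<le> p" and \<tau>: "\<tau> = shift p i" by auto
    have "\<tau> permutes {1..n}" unfolding \<tau> using i p by (intro shift_permutes) auto
    moreover have "\<tau> a < \<tau> b"
      if "1 \<le> a" "a < b" "b \<le> n" "blk (mid n p) a = blk (mid n p) b" for a b
    proof -
      have "a = p" "b = Suc p" using that p by (auto simp: blk_mid split: if_splits)
      then show ?thesis using i by (auto simp: \<tau> shift_def)
    qed
    moreover have "\<tau> (sum_list (take q (mid n p))) < \<tau> (sum_list (take r (mid n p)))"
      if "1 \<le> q" "q < r" "r \<le> n - 1" for q r
      using that p i by (auto simp: sum_take_mid \<tau> shift_def)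
    ultimately show "\<tau> \<in> ?L"
      unfolding mem_Collect_eq sum_list_mid[OF p] length_mid[OF p] by blast
  qed
  then have "inv_red_shuffles (mid n p) = inv ` shift p ` {1..p}"
    by (simp only: inv_red_shuffles_def)
  then show ?thesis by (auto simp: image_image inv_shift)
qed


text \<open>
  The terms of the infinitesimal decomposition whose second factor is \<open>l\<^sub>2\<close>, the only generator on
  which \<open>kappa_tilde\<close> does not vanish, with the sign of \<open>kappa_tilde\<close> passing the first factor.
\<close>

definition tw_term :: "(lie3_gen, lie3_gen) elem \<Rightarrow> (lab \<times> nat \<times> (nat \<Rightarrow> nat) \<Rightarrow>\<^sub>0 'k::comm_ring_1)" where
  "tw_term = (\<lambda>(\<mu>, \<nu>s, \<sigma>). \<Sum>i<length \<nu>s. Poly_Mapping.single (fst \<mu>, i, \<sigma>)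
     (ksign (lab_dgr (fst \<mu>)) * (if fst (\<nu>s ! i) = L2 then 1 else 0)
       * (\<Prod>j\<in>{..<length \<nu>s} - {i}. if fst (\<nu>s ! j) = L1 then 1 else 0)))"

definition tw :: "lab \<Rightarrow> (lab \<times> nat \<times> (nat \<Rightarrow> nat) \<Rightarrow>\<^sub>0 'k::comm_ring_1)" where
  "tw l = lin tw_term (lab_dec l)"

lemma ell_eq: "1 \<le> k \<Longrightarrow> k \<le> 5 \<Longrightarrow> ell k = L1 \<longleftrightarrow> k = 1" "1 \<le> k \<Longrightarrow> k \<le> 5 \<Longrightarrow> ell k = L2 \<longleftrightarrow> k = 2"
  and ell_ar: "1 \<le> k \<Longrightarrow> k \<le> 5 \<Longrightarrow> lab_ar (ell k) = k"
  and ell_dgr: "1 \<le> k \<Longrightarrow> k \<le> 5 \<Longrightarrow> lab_dgr (ell k) = int k - 1"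
  and ell_in: "1 \<le> k \<Longrightarrow> k \<le> 5 \<Longrightarrow> ell k \<in> {L1, L2, L3, L4, L5}"
proof -
  have *: "k = 1 \<or> k = 2 \<or> k = 3 \<or> k = 4 \<or> k = 5" if "1 \<le> k" "k \<le> 5" using that by linarith
  show "1 \<le> k \<Longrightarrow> k \<le> 5 \<Longrightarrow> ell k = L1 \<longleftrightarrow> k = 1" "1 \<le> k \<Longrightarrow> k \<le> 5 \<Longrightarrow> ell k = L2 \<longleftrightarrow> k = 2"
    "1 \<le> k \<Longrightarrow> k \<le> 5 \<Longrightarrow> lab_ar (ell k) = k" "1 \<le> k \<Longrightarrow> k \<le> 5 \<Longrightarrow> lab_dgr (ell k) = int k - 1"
    "1 \<le> k \<Longrightarrow> k \<le> 5 \<Longrightarrow> ell k \<in> {L1, L2, L3, L4, L5}"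
    using * by (auto simp: ell_def)
qed

text \<open>\<open>kappa_tilde\<close> asks for an \<open>l2\<close> in the chosen entry and the
  counit for an \<open>l1\<close> in all others, so the block sizes are one 2 among 1s.\<close>

lemma tw_term_nonzero:
  assumes "(tw_term ((ell j, id), map (\<lambda>i. (ell i, id)) ns, \<sigma>) :: _ \<Rightarrow>\<^sub>0 'k::comm_ring_1) \<noteq> 0"
    and "\<forall>i\<in>set ns. 1 \<le> i \<and> i \<le> 5"
  obtains p where "1 \<le> p" "p \<le> length ns" "ns = mid (Suc (length ns)) p"
proof -
  have "\<exists>i<length ns. ksign (lab_dgr (ell j)) * (if ell (ns ! i) = L2 then 1 else 0)
      * (\<Prod>j\<in>{..<length ns} - {i}. if ell (ns ! j) = L1 then 1 else (0::'k)) \<noteq> 0" (is "\<exists>i<_. ?c i \<noteq> 0")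
  proof (rule ccontr)
    assume "\<not> (\<exists>i<length ns. ?c i \<noteq> 0)"
    then have "?c i = 0" if "i < length ns" for i using that by blast
    then show False
      using assms(1) by (simp add: tw_term_def)
  qed
  then obtain i where "i < length ns" "?c i \<noteq> 0" by blast
  then have i: "i < length ns" "ell (ns ! i) = L2"
    and o: "(\<Prod>j\<in>{..<length ns} - {i}. if ell (ns ! j) = L1 then 1 else (0::'k)) \<noteq> 0"
    by (auto split: if_splits)
  have "ell (ns ! j) = L1" if "j < length ns" "j \<noteq> i" for j
  proof (rule ccontr)
    assume "ell (ns ! j) \<noteq> L1"
    then have "(\<Prod>j\<in>{..<length ns} - {i}. if ell (ns ! j) = L1 then 1 else (0::'k)) = 0"
      using that by (intro prod_zero) auto
    with o show False by simp
  qed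
  then have "ns ! j = (if j = i then 2 else 1)" if "j < length ns" for j
    using that i assms(2) ell_eq[of "ns ! j"] nth_mem[of j ns] by (cases "j = i") auto
  then have "ns = mid (Suc (length ns)) (Suc i)"
    using i(1) by (intro nth_equalityI) (auto simp: length_mid nth_mid)
  then show thesis using i(1) by (intro that[of "Suc i"]) auto
qed

lemma tw_term_mid:
  assumes "1 \<le> p" "p < n" "n \<le> 5"
  shows "tw_term ((ell (n - 1), id), map (\<lambda>i. (ell i, id)) (mid n p), \<sigma>)
    = (Poly_Mapping.single (ell (n - 1), p - 1, \<sigma>) ((- 1) ^ (n - 2)) :: _ \<Rightarrow>\<^sub>0 'k::comm_ring_1)"
proof -
  have l: "ell (Suc 0) = L1" "ell 2 = L2" by (auto simp: ell_def)
  have "(tw_term ((ell (n - 1), id), map (\<lambda>i. (ell i, id)) (mid n p), \<sigma>) :: _ \<Rightarrow>\<^sub>0 'k)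
    = (\<Sum>i<n - 1. if i = p - 1 then Poly_Mapping.single (ell (n - 1), i, \<sigma>) (ksign (lab_dgr (ell (n - 1)))) else 0)"
    using assms unfolding tw_term_def prod.case
  proof (intro sum.cong)
    fix i assume "i \<in> {..<n - 1}"
    moreover have "(\<Prod>j\<in>{..<n - 1} - {p - 1}. if fst (map (\<lambda>i. (ell i, id)) (mid n p) ! j) = L1 then 1 else 0) = (1::'k)"
      using assms by (intro prod.neutral) (auto simp: length_mid nth_mid l)
    ultimately show "Poly_Mapping.single (fst (ell (n - 1), id), i, \<sigma>)
          (ksign (lab_dgr (fst (ell (n - 1), id))) * (if fst (map (\<lambda>i. (ell i, id)) (mid n p) ! i) = L2 then 1 else 0) *
           (\<Prod>j\<in>{..<length (map (\<lambda>i. (ell i, id)) (mid n p))} - {i}. if fst (map (\<lambda>i. (ell i, id)) (mid n p) ! j) = L1 then 1 else 0)) =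
         (if i = p - 1 then Poly_Mapping.single (ell (n - 1), i, \<sigma>) (ksign (lab_dgr (ell (n - 1)))) else (0 :: _ \<Rightarrow>\<^sub>0 'k))"
      using assms by (auto simp: length_mid nth_mid l)
  qed (auto simp: length_mid)
  also have "\<dots> = Poly_Mapping.single (ell (n - 1), p - 1, \<sigma>) (ksign (lab_dgr (ell (n - 1))))"
    using assms by (subst sum.delta) auto
  also have "(ksign (lab_dgr (ell (n - 1))) :: 'k) = (- 1) ^ (n - 2)"
    using assms by (auto simp: ell_dgr ksign_def minus_one_power_iff even_diff_nat)
  finally show ?thesis .
qed

text \<open>With \<open>j = n - 1\<close> the first sign of the decomposition is
  \<open>(-1)^(n-2)\<close>; it cancels against \<open>kappa_tilde\<close> passing the first factor,
  of degree \<open>n - 2\<close>. The second sign contributes \<open>(-1)^(p-1)\<close> and the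
  unshuffle \<open>(-1)^(p-i)\<close>.\<close>

lemma tw_ell:
  assumes n: "2 \<le> n" "n \<le> 5"
  shows "tw (ell n) = (\<Sum>p\<in>{1..<n}. \<Sum>i\<in>{1..p}.
    Poly_Mapping.single (ell (n - 1), p - 1, unshift p i) ((- 1) ^ (p - 1 + (p - i))) :: _ \<Rightarrow>\<^sub>0 'k::comm_ring_1)"
proof -
  define C where "C j = {ns. length ns = j \<and> sum_list ns = n \<and> (\<forall>i\<in>set ns. i \<ge> 1)}" for j
  define F where "F j ns = (\<Sum>\<sigma>\<in>inv_red_shuffles ns. pscale ((- 1) ^ ((j - 1) * (n - j))
      * (- 1) ^ (\<Sum>p = 1..j. (p - 1) * (ns ! (p - 1) - 1)) * of_int (sign \<sigma>))
    (tw_term ((ell j, id), map (\<lambda>i. (ell i, id)) ns, \<sigma>) :: _ \<Rightarrow>\<^sub>0 'k))" for j ns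
  have le: "i \<le> n" if "ns \<in> C j" "i \<in> set ns" for i ns j
    using that member_le_sum_list[of i ns] by (auto simp: C_def)
  have fin: "finite (C j)" for j
    by (rule finite_subset[OF _ finite_lists_length_eq[of "{0..n}" j]]) (use le in \<open>auto simp: C_def\<close>)
  have nz: "j = n - 1 \<and> ns \<in> mid n ` {1..<n}" if ns: "ns \<in> C j" "F j ns \<noteq> 0" for j ns
  proof -
    obtain \<sigma> where "(tw_term ((ell j, id), map (\<lambda>i. (ell i, id)) ns, \<sigma>) :: _ \<Rightarrow>\<^sub>0 'k) \<noteq> 0"
      using ns(2) unfolding F_def by (metis (mono_tags, lifting) free_mod.scale_zero_right sum.neutral)
    moreover have "\<forall>i\<in>set ns. 1 \<le> i \<and> i \<le> 5"
      using le[OF ns(1)] n ns(1) by (force simp: C_def)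
    ultimately obtain p where p: "1 \<le> p" "p \<le> length ns" "ns = mid (Suc (length ns)) p"
      by (rule tw_term_nonzero)
    have "sum_list ns = Suc (length ns)"
      using sum_list_mid[of p "Suc (length ns)"] p by simp
    then have "Suc (length ns) = n" "length ns = j" using ns(1) by (auto simp: C_def)
    then show ?thesis using p by auto
  qed
  have "tw (ell n) = (\<Sum>j = 1..n. \<Sum>ns\<in>C j. F j ns)"
    using n ell_in[of n] by (simp add: tw_def lab_dec_def ell_ar ell_dec_def F_def C_def)
  also have "\<dots> = (\<Sum>ns\<in>C (n - 1). F (n - 1) ns)"
  proof -
    have "(\<Sum>j = 1..n. \<Sum>ns\<in>C j. F j ns) = (\<Sum>j\<in>{n - 1}. \<Sum>ns\<in>C j. F j ns)"
      using n nz by (intro sum.mono_neutral_right) (auto intro!: sum.neutral)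
    then show ?thesis by simp
  qed
  also have "\<dots> = (\<Sum>ns\<in>mid n ` {1..<n}. F (n - 1) ns)"
  proof (rule sum.mono_neutral_right[OF fin])
    show "mid n ` {1..<n} \<subseteq> C (n - 1)"
      by (auto simp: C_def length_mid sum_list_mid) (auto simp: mid_def)
  qed (use nz in blast)
  also have "\<dots> = (\<Sum>p\<in>{1..<n}. F (n - 1) (mid n p))"
  proof (rule sum.reindex_cong[OF _ refl refl])
    show "inj_on (mid n) {1..<n}"
    proof (rule inj_onI)
      fix p q assume "p \<in> {1..<n}" "q \<in> {1..<n}" "mid n p = mid n q"
      then have "1 \<le> p" "p < n" "1 \<le> q" "q < n" and eq: "mid n p = mid n q" by auto
      then have "(if p - 1 = q - 1 then 2 else 1) = (2::nat)"
        using nth_mid[of p n "p - 1"] nth_mid[of q n "p - 1"] by (simp del: One_nat_def)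
      then show "p = q" using \<open>1 \<le> p\<close> \<open>1 \<le> q\<close> by (simp split: if_splits)
    qed
  qed
  also have "\<dots> = (\<Sum>p\<in>{1..<n}. \<Sum>i\<in>{1..p}.
    Poly_Mapping.single (ell (n - 1), p - 1, unshift p i) ((- 1) ^ (p - 1 + (p - i))))"
  proof (rule sum.cong[OF refl])
    fix p assume "p \<in> {1..<n}"
    then have p: "1 \<le> p" "p < n" by auto
    have e: "(\<Sum>q = 1..n - 1. (q - 1) * (mid n p ! (q - 1) - 1)) = p - 1"
    proof -
      have "(\<Sum>q = 1..n - 1. (q - 1) * (mid n p ! (q - 1) - 1)) = (\<Sum>q = 1..n - 1. if q = p then p - 1 else 0)"
        using p by (intro sum.cong) (auto simp: nth_mid split: if_splits)
      then show ?thesis using p by (simp add: sum.delta)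
    qed
    have inj: "inj_on (unshift p) {1..p}"
    proof (rule inj_onI)
      fix i k assume ik: "i \<in> {1..p}" "k \<in> {1..p}" "unshift p i = unshift p k"
      have "unshift p k i = p" using fun_cong[OF ik(3), of i] by (simp add: unshift_def)
      then show "i = k" using ik by (auto simp: unshift_def split: if_splits)
    qed
    have sq: "(- 1) ^ (n - 2) * (- 1) ^ (n - 2) = (1 :: 'k)"
      by (simp flip: power_mult_distrib)
    show "F (n - 1) (mid n p) = (\<Sum>i\<in>{1..p}. Poly_Mapping.single (ell (n - 1), p - 1, unshift p i) ((- 1) ^ (p - 1 + (p - i))))"
      unfolding F_def inv_red_shuffles_mid[OF p] e
    proof (rule sum.reindex_cong[OF inj refl])
      fix i assume i: "i \<in> {1..p}"
      have c: "(n - 1 - 1) * (n - (n - 1)) = n - 2" using p by simp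
      show "pscale ((- 1) ^ ((n - 1 - 1) * (n - (n - 1))) * (- 1) ^ (p - 1) * of_int (sign (unshift p i)))
          (tw_term ((ell (n - 1), id), map (\<lambda>i. (ell i, id)) (mid n p), unshift p i))
        = (Poly_Mapping.single (ell (n - 1), p - 1, unshift p i) ((- 1) ^ (p - 1 + (p - i))) :: _ \<Rightarrow>\<^sub>0 'k)"
        using i sq unfolding c tw_term_mid[OF p n(2)] power_add by (simp add: sign_unshift algebra_simps)
    qed
  qed
  finally show ?thesis .
qed

section \<open>The twisted differential on labelled lists of monomials\<close>

definition contract :: "nat \<Rightarrow> lie_mono list \<Rightarrow> lie_mono list" where
  "contract i ts = take i ts @ Br (ts ! i) (ts ! Suc i) # drop (Suc (Suc i)) ts"

text \<open>Lie has zero differential, so only the differential of the label and the twist remain;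
  the twist brackets two neighbouring entries of the permuted list.\<close>

definition bd :: "lelem \<Rightarrow> (lelem \<Rightarrow>\<^sub>0 'k::comm_ring_1)" where
  "bd = (\<lambda>(l, ts). lin (\<lambda>(m, \<tau>). sgl (m, perm_list \<tau> ts)) (lab_diff l)
     + lin (\<lambda>(m, i, \<tau>). sgl (m, contract i (perm_list \<tau> ts))) (tw l))"

lemma tw_L1: "tw L1 = (0 :: _ \<Rightarrow>\<^sub>0 'k::comm_ring_1)"
proof -
  have "tw_term ((ell 1, id), map (\<lambda>i. (ell i, id)) ns, \<sigma>) = (0 :: _ \<Rightarrow>\<^sub>0 'k)"
    if "length ns = 1" "sum_list ns = 1" for ns \<sigma>
    using that by (auto simp: length_Suc_conv tw_term_def ell_def)
  then show ?thesis
    by (simp add: tw_def lab_dec_def ell_dec_def)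
qed

text \<open>Only terms of \<open>red_dec\<close> whose entries are one \<open>L2\<close> and
  otherwise \<open>L1\<close> survive; their coefficient is reversed when the outer label has odd
  degree.\<close>

lemma tw_simps:
  shows "tw L2_1 = 0"
    and "tw L2_11 = 0"
    and "tw L2_111 = 0"
    and "tw L3_1 = 0"
    and "tw L3_2 = - sgl (L2_1, 0, cycle_of_list []) - sgl (L2_1, 1, cycle_of_list [1, 2])"
    and "tw L3_11 = 0"
    and "tw L3_12 = - sgl (L2_11, 1, cycle_of_list [1, 3, 2])"
    and "tw L3_22 = sgl (L2_11, 0, cycle_of_list []) + sgl (L2_11, 1, cycle_of_list [1, 2])"
    and "tw L4_1 = - sgl (L3_1, 2, cycle_of_list [])"
    and "tw L4_2 = - sgl (L3_1, 0, cycle_of_list []) - sgl (L3_1, 1, cycle_of_list [1, 2]) - sgl (L3_1, 2, cycle_of_list [1, 3, 2])"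
    and "tw L4_3 = - sgl (L3_2, 0, cycle_of_list []) + sgl (L3_2, 2, cycle_of_list [2, 3]) - sgl (L3_2, 2, cycle_of_list [1, 3, 2]) + sgl (L3_2, 1, cycle_of_list []) - sgl (L3_2, 1, cycle_of_list [1, 2])"
  by (simp_all add: tw_def tw_term_def lab_dec_def dterm_def lessThan_Suc eval_nat_numeral insert_Diff_if ksign_def single_uminus
      del: cycle_of_list.simps)

lemma tw_ell_simps:
  shows "tw L2 = sgl (L1, 0, unshift 1 1)"
    and "tw L3 = sgl (L2, 0, unshift 1 1) + sgl (L2, 1, unshift 2 1) - sgl (L2, 1, unshift 2 2)"
    and "tw L4 = sgl (L3, 0, unshift 1 1) + sgl (L3, 1, unshift 2 1) - sgl (L3, 1, unshift 2 2)
      + sgl (L3, 2, unshift 3 1) - sgl (L3, 2, unshift 3 2) + sgl (L3, 2, unshift 3 3)"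
    and "tw L5 = sgl (L4, 0, unshift 1 1) + sgl (L4, 1, unshift 2 1) - sgl (L4, 1, unshift 2 2)
      + sgl (L4, 2, unshift 3 1) - sgl (L4, 2, unshift 3 2) + sgl (L4, 2, unshift 3 3)
      + sgl (L4, 3, unshift 4 1) - sgl (L4, 3, unshift 4 2) + sgl (L4, 3, unshift 4 3) - sgl (L4, 3, unshift 4 4)"
proof -
  have s: "{1..<2} = {1::nat}" "{1..<3} = {1::nat, 2}" "{1..<4} = {1::nat, 2, 3}" "{1..<5} = {1::nat, 2, 3, 4}"
    "{1..1} = {1::nat}" "{1..2} = {1::nat, 2}" "{1..3} = {1::nat, 2, 3}" "{1..4} = {1::nat, 2, 3, 4}"
    by auto
  note [simp] = s[unfolded One_nat_def] single_uminus
  show "tw L2 = sgl (L1, 0, unshift 1 1)"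
    using tw_ell[of 2] by (simp add: ell_def)
  show "tw L3 = sgl (L2, 0, unshift 1 1) + sgl (L2, 1, unshift 2 1) - sgl (L2, 1, unshift 2 2)"
    using tw_ell[of 3] by (simp add: ell_def algebra_simps)
  show "tw L4 = sgl (L3, 0, unshift 1 1) + sgl (L3, 1, unshift 2 1) - sgl (L3, 1, unshift 2 2)
      + sgl (L3, 2, unshift 3 1) - sgl (L3, 2, unshift 3 2) + sgl (L3, 2, unshift 3 3)"
    using tw_ell[of 4] by (simp add: ell_def algebra_simps)
  show "tw L5 = sgl (L4, 0, unshift 1 1) + sgl (L4, 1, unshift 2 1) - sgl (L4, 1, unshift 2 2)
      + sgl (L4, 2, unshift 3 1) - sgl (L4, 2, unshift 3 2) + sgl (L4, 2, unshift 3 3)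
      + sgl (L4, 3, unshift 4 1) - sgl (L4, 3, unshift 4 2) + sgl (L4, 3, unshift 4 3) - sgl (L4, 3, unshift 4 4)"
    using tw_ell[of 5] by (simp add: ell_def algebra_simps)
qed

lemma inv_cycle:
  "inv (cycle_of_list [a, b]) = transpose a b"
  "inv (cycle_of_list [a, b, c]) = transpose b c \<circ> transpose a b"
  by (simp_all add: o_inv_distrib)

lemma perm_list_eq: "perm_list \<sigma> xs = map (\<lambda>i. xs ! (inv \<sigma> (Suc i) - 1)) [0..<length xs]"
  unfolding perm_list_def by (rule nth_equalityI) (auto simp del: upt_Suc)

lemma perm_list_id [simp]: "perm_list id xs = xs"
  by (rule nth_equalityI) (auto simp: perm_list_eq)

text \<open>Permutations of the label have become rearrangements of the entries, because
  \<open>perm_list\<close> uses the inverse permutation. The rows for \<open>L2\<close> to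
  \<open>L5\<close> are the Chevalley-Eilenberg differential; the brackets in the other rows are the
  correction terms of the twist.\<close>

lemma bd_simps:
  shows "bd (L1, [a]) = 0"
    and "bd (L2, [a, b]) = sgl (L1, [Br a b])"
    and "bd (L2_1, [a, b]) = - sgl (L2, [a, b]) - sgl (L2, [b, a])"
    and "bd (L2_11, [a, b]) = - sgl (L2_1, [a, b]) + sgl (L2_1, [b, a])"
    and "bd (L2_111, [a, b]) = - sgl (L2_11, [a, b]) - sgl (L2_11, [b, a])"
    and "bd (L3, [a, b, c]) = sgl (L2, [Br a b, c]) + sgl (L2, [b, Br a c]) - sgl (L2, [a, Br b c])"
    and "bd (L3_1, [a, b, c]) = - sgl (L3, [a, b, c]) - sgl (L3, [b, a, c])"
    and "bd (L3_2, [a, b, c]) = - sgl (L3, [a, b, c]) - sgl (L3, [a, c, b]) - sgl (L2_1, [Br a b, c]) - sgl (L2_1, [b, Br a c])"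
    and "bd (L3_11, [a, b, c]) = - sgl (L3_1, [a, b, c]) + sgl (L3_1, [b, a, c])"
    and "bd (L3_12, [a, b, c]) = sgl (L3_1, [a, b, c]) + sgl (L3_1, [a, c, b]) + sgl (L3_1, [b, c, a]) - sgl (L3_2, [a, b, c]) - sgl (L3_2, [b, a, c]) - sgl (L3_2, [c, a, b]) - sgl (L2_11, [b, Br c a])"
    and "bd (L3_22, [a, b, c]) = - sgl (L3_2, [a, b, c]) + sgl (L3_2, [a, c, b]) + sgl (L2_11, [Br a b, c]) + sgl (L2_11, [b, Br a c])"
    and "bd (L4, [a, b, c, d]) = sgl (L3, [Br a b, c, d]) + sgl (L3, [b, Br a c, d]) - sgl (L3, [a, Br b c, d]) + sgl (L3, [b, c, Br a d]) - sgl (L3, [a, c, Br b d]) + sgl (L3, [a, b, Br c d])"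
    and "bd (L4_1, [a, b, c, d]) = - sgl (L4, [a, b, c, d]) - sgl (L4, [b, a, c, d]) - sgl (L3_1, [a, b, Br c d])"
    and "bd (L4_2, [a, b, c, d]) = - sgl (L4, [a, b, c, d]) - sgl (L4, [a, c, b, d]) - sgl (L3_1, [Br a b, c, d]) - sgl (L3_1, [b, Br a c, d]) - sgl (L3_1, [b, c, Br a d])"
    and "bd (L4_3, [a, b, c, d]) = - sgl (L4, [a, b, c, d]) - sgl (L4, [a, b, d, c]) - sgl (L3_2, [Br a b, c, d]) + sgl (L3_2, [a, c, Br b d]) - sgl (L3_2, [b, c, Br a d]) + sgl (L3_2, [a, Br b c, d]) - sgl (L3_2, [b, Br a c, d])"
    and "bd (L5, [a, b, c, d, e]) = sgl (L4, [Br a b, c, d, e]) + sgl (L4, [b, Br a c, d, e]) - sgl (L4, [a, Br b c, d, e]) + sgl (L4, [b, c, Br a d, e]) - sgl (L4, [a, c, Br b d, e]) + sgl (L4, [a, b, Br c d, e]) + sgl (L4, [b, c, d, Br a e]) - sgl (L4, [a, c, d, Br b e]) + sgl (L4, [a, b, d, Br c e]) - sgl (L4, [a, b, c, Br d e])"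
  by (simp_all add: bd_def tw_simps tw_ell_simps tw_L1 lgen_def inv_cycle inv_shift perm_list_eq
      contract_def transpose_def shift_def del: cycle_of_list.simps(1))


section \<open>The differential respects arity, degree and the Lie relations\<close>

lemma cycle_of_list_permutes: "set cs \<subseteq> S \<Longrightarrow> cycle_of_list cs permutes S"
  by (rule permutes_subset[OF cycle_permutes])

lemma lab_diff_over:
  "(lab_diff l :: _ \<Rightarrow>\<^sub>0 'k::comm_ring_1) \<in>
    over {(m, \<tau>). lab_ar m = lab_ar l \<and> lab_dgr m = lab_dgr l - 1 \<and> \<tau> permutes {1..lab_ar l}}"
  by (cases l) (auto simp: lgen_def cycle_of_list_permutes simp del: cycle_of_list.simps intro!: over_intros)

lemma tw_over:
  "(tw l :: _ \<Rightarrow>\<^sub>0 'k::comm_ring_1) \<in>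
    over {(m, i, \<tau>). lab_ar l = Suc (lab_ar m) \<and> Suc i < lab_ar l \<and> lab_dgr m = lab_dgr l - 1
      \<and> \<tau> permutes {1..lab_ar l}}"
  by (cases l) (auto simp: tw_simps tw_ell_simps tw_L1 cycle_of_list_permutes simp del: cycle_of_list.simps One_nat_def
      intro!: over_intros unshift_permutes)

lemma mset_perm_list:
  assumes "\<tau> permutes {1..length xs}"
  shows "mset (perm_list \<tau> xs) = mset xs"
proof -
  let ?f = "\<lambda>i. inv \<tau> (Suc i) - 1" and ?g = "\<lambda>i. \<tau> (Suc i) - 1" and ?n = "length xs"
  have pos: "\<tau> k \<in> {1..?n} \<longleftrightarrow> k \<in> {1..?n}" "inv \<tau> k \<in> {1..?n} \<longleftrightarrow> k \<in> {1..?n}" for k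
    using permutes_in_image[OF assms] permutes_in_image[OF permutes_inv[OF assms]] by auto
  have S: "Suc (\<tau> (Suc i) - 1) = \<tau> (Suc i)" "Suc (inv \<tau> (Suc i) - 1) = inv \<tau> (Suc i)" if "i < ?n" for i
    using pos[of "Suc i"] that by auto
  have "?f permutes {..<?n}"
  proof (rule bij_imp_permutes)
    show "bij_betw ?f {..<?n} {..<?n}"
    proof (rule bij_betw_byWitness[of _ ?g])
      show "\<forall>i\<in>{..<?n}. ?g (?f i) = i" "\<forall>i\<in>{..<?n}. ?f (?g i) = i"
        using S permutes_inverses[OF assms] by simp_all
      show "?f ` {..<?n} \<subseteq> {..<?n}"
        using pos(2)[of "Suc _"] by (auto simp: image_subset_iff) (metis Suc_le_eq Suc_pred atLeastAtMost_iff less_eq_Suc_le less_or_eq_imp_le zero_less_Suc S(2) le_simps(2))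
      show "?g ` {..<?n} \<subseteq> {..<?n}"
        using pos(1)[of "Suc _"] by (auto simp: image_subset_iff) (metis Suc_le_eq Suc_pred atLeastAtMost_iff less_eq_Suc_le less_or_eq_imp_le zero_less_Suc S(1) le_simps(2))
    qed
    show "?f i = i" if "i \<notin> {..<?n}" for i
      using permutes_not_in[OF permutes_inv[OF assms], of "Suc i"] that by auto
  qed
  then show ?thesis
    using mset_permute_list[of ?f xs] by (simp add: perm_list_eq permute_list_def)
qed

lemma length_perm_list [simp]: "length (perm_list \<tau> xs) = length xs"
  by (simp add: perm_list_eq)

lemma mset_concat_map: "mset xs = mset ys \<Longrightarrow> mset (concat (map f xs)) = mset (concat (map f ys))"
  by (simp add: mset_concat flip: sum_mset_sum_list)

lemma valid_cong:
  assumes "(l, ts) \<in> valid n" "mset (concat (map leaves us)) = mset (concat (map leaves ts))" "length us = lab_ar m"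
  shows "(m, us) \<in> valid n"
  using assms mset_eq_setD[OF assms(2)] mset_eq_imp_distinct_iff[OF assms(2)] unfolding valid_def by simp

lemma valid_perm_list:
  assumes "(l, ts) \<in> valid n" "\<tau> permutes {1..lab_ar l}" "lab_ar m = lab_ar l"
  shows "(m, perm_list \<tau> ts) \<in> valid n"
proof -
  have "length ts = lab_ar l" using assms(1) by (simp add: valid_def)
  then show ?thesis
    using assms by (intro valid_cong[OF assms(1)] mset_concat_map mset_perm_list) auto
qed

lemma length_contract: "Suc i < length ts \<Longrightarrow> Suc (length (contract i ts)) = length ts"
  by (simp add: contract_def)

lemma leaves_contract:
  assumes "Suc i < length ts"
  shows "concat (map leaves (contract i ts)) = concat (map leaves ts)"
proof -
  have "drop i ts = ts ! i # ts ! Suc i # drop (Suc (Suc i)) ts"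
    using assms by (simp add: Cons_nth_drop_Suc)
  then have "concat (map leaves (contract i ts)) = concat (map leaves (take i ts @ drop i ts))"
    by (simp add: contract_def)
  then show ?thesis by (simp only: append_take_drop_id)
qed

lemma valid_contract:
  assumes "(l, ts) \<in> valid n" "Suc i < lab_ar l" "lab_ar l = Suc (lab_ar m)"
  shows "(m, contract i ts) \<in> valid n"
  using assms leaves_contract[of i ts] length_contract[of i ts]
  by (intro valid_cong[OF assms(1)]) (auto simp: valid_def)

lemma bd_over:
  assumes "g \<in> valid n"
  shows "(bd g :: _ \<Rightarrow>\<^sub>0 'k::comm_ring_1) \<in> over {h \<in> valid n. lab_dgr (fst h) = lab_dgr (fst g) - 1}"
proof -
  obtain l ts where g: "g = (l, ts)" by fastforce
  have v: "(l, ts) \<in> valid n" using assms g by simp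
  have "(lin (\<lambda>(m, \<tau>). sgl (m, perm_list \<tau> ts)) (lab_diff l) :: _ \<Rightarrow>\<^sub>0 'k) \<in> over {h \<in> valid n. lab_dgr (fst h) = lab_dgr (fst g) - 1}"
    by (rule over_lin[OF lab_diff_over]) (auto intro!: over_single valid_perm_list[OF v] simp: g)
  moreover have "(lin (\<lambda>(m, i, \<tau>). sgl (m, contract i (perm_list \<tau> ts))) (tw l) :: _ \<Rightarrow>\<^sub>0 'k)
      \<in> over {h \<in> valid n. lab_dgr (fst h) = lab_dgr (fst g) - 1}"
    by (rule over_lin[OF tw_over]) (auto intro!: over_single valid_contract[OF valid_perm_list[OF v _ refl]] simp: g)
  ultimately show ?thesis by (simp add: bd_def g over_add)
qed

text \<open>The place to which a slot moves does not depend on its content, so a relator in a slot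
  remains a relator in a slot.\<close>

lemma perm_list_slot:
  assumes "\<tau> permutes {1..Suc (length us + length vs)}"
  obtains us' vs' where "\<And>t. perm_list \<tau> (us @ t # vs) = us' @ t # vs'" "length us' + length vs' = length us + length vs"
proof -
  let ?n = "Suc (length us + length vs)"
  define q where "q = \<tau> (Suc (length us)) - 1"
  define xs where "xs t = perm_list \<tau> (us @ t # vs)" for t
  have t: "\<tau> (Suc (length us)) \<in> {1..?n}"
    using permutes_in_image[OF assms, of "Suc (length us)"] by auto
  then have Sq: "Suc q = \<tau> (Suc (length us))" and q: "q < ?n" by (auto simp: q_def)
  have len: "length (xs t) = ?n" for t by (simp add: xs_def)
  \<comment> \<open>\<open>undefined\<close> is an arbitrary filling of the slot, from which the
    other entries are read off.\<close>
  have "xs t = (xs undefined)[q := t]" for t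
  proof (rule nth_equalityI)
    fix i assume "i < length (xs t)"
    then have i: "i < ?n" by (simp add: len)
    define k where "k = inv \<tau> (Suc i) - 1"
    have nth: "xs t ! i = (us @ t # vs) ! k" for t
      using i by (simp add: xs_def perm_list_eq k_def del: upt_Suc)
    have "inv \<tau> (Suc i) \<in> {1..?n}"
      using permutes_in_image[OF permutes_inv[OF assms], of "Suc i"] i by auto
    then have "k = length us \<longleftrightarrow> inv \<tau> (Suc i) = Suc (length us)" by (auto simp: k_def)
    also have "\<dots> \<longleftrightarrow> Suc i = Suc q"
      unfolding Sq using permutes_inverses[OF assms] by metis
    finally have k: "k = length us \<longleftrightarrow> i = q" by simp
    show "xs t ! i = (xs undefined)[q := t] ! i"
    proof (cases "i = q")
      case True
      then have "xs t ! i = t" using k nth[of t] by simp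
      then show ?thesis using True q len[of undefined] by simp
    next
      case False
      then have "k \<noteq> length us" using k by simp
      then have "(us @ t # vs) ! k = (us @ undefined # vs) ! k"
        by (cases "k < length us") (simp_all add: nth_append nth_Cons')
      then show ?thesis using False nth[of t] nth[of undefined] by simp
    qed
  qed (simp add: len)
  then have eq: "xs t = take q (xs undefined) @ t # drop (Suc q) (xs undefined)" for t
    using q by (metis len upd_conv_take_nth_drop)
  show thesis
  proof (rule that)
    show "perm_list \<tau> (us @ t # vs) = take q (xs undefined) @ t # drop (Suc q) (xs undefined)" for t
      using eq[of t] by (simp only: xs_def)
    show "length (take q (xs undefined)) + length (drop (Suc q) (xs undefined)) = length us + length vs"
      using q by (simp add: len)
  qed
qed

lemma contract_slot:
  assumes "i < length us + length vs"
  obtains us' vs' C where "\<And>t. contract i (us @ t # vs) = us' @ C t # vs'"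
    "C = (\<lambda>t. t) \<or> (\<exists>s. C = (\<lambda>t. Br t s)) \<or> (\<exists>s. C = Br s)"
proof -
  consider "Suc i < length us" | "Suc i = length us" | "i = length us" | "length us < i" by linarith
  then show thesis
  proof cases
    case 1
    then show ?thesis
      by (intro that[of "contract i us" "\<lambda>t. t" vs]) (auto simp: contract_def nth_append)
  next
    case 2
    then have "us = take i us @ [us ! i]" by (simp add: take_Suc_conv_app_nth[symmetric])
    then obtain us' s where us: "us = us' @ [s]" by blast
    then show ?thesis
      using 2 by (intro that[of us' "Br s" vs]) (auto simp: contract_def nth_append)
  next
    case 3
    then obtain s vs' where vs: "vs = s # vs'" using assms by (cases vs) auto
    then show ?thesis
      using 3 by (intro that[of us "\<lambda>t. Br t s" vs']) (auto simp: contract_def nth_append)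
  next
    case 4
    then obtain j where "i = length us + Suc j" using less_iff_Suc_add by auto
    then show ?thesis
      using assms by (intro that[of us "\<lambda>t. t" "contract j vs"]) (auto simp: contract_def nth_append eval_nat_numeral)
  qed
qed

lemma NF_ideal: "x \<in> lie_ideal \<Longrightarrow> lin (\<lambda>t. NF (l, us @ t # vs)) x = 0"
  using tens_ideal[of x us vs] unfolding NF_def by (simp flip: lin_lin)

text \<open>Permuting moves the slot, and contracting leaves it alone or makes it an argument of a
  bracket; the ideal is closed under bracketing on both sides. So the differential descends to the
  quotient.\<close>

lemma NF_bd_slot_rels:
  assumes "y \<in> slot_rels n"
  shows "lin NF (lin bd y) = (0 :: _ \<Rightarrow>\<^sub>0 'k::comm_ring_1)"
proof -
  obtain l us vs x M where y: "y = lin (\<lambda>t. sgl (l, us @ t # vs)) x" and x: "x \<in> lie_rel M"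
    and v: "\<And>t. mset (leaves t) = M \<Longrightarrow> (l, us @ t # vs) \<in> valid n"
    using assms unfolding slot_rels_def by blast
  show ?thesis
  proof (cases "Poly_Mapping.keys x = {}")
    case True
    then show ?thesis by (simp add: y lin_def)
  next
    case False
    then obtain t0 where "t0 \<in> Poly_Mapping.keys x" by blast
    then have "mset (leaves t0) = M" using x by (auto simp: lie_rel_def over_def)
    then have ar: "lab_ar l = Suc (length us + length vs)" using v[of t0] by (auto simp: valid_def)
    have xi: "x \<in> lie_ideal" using x by (simp add: lie_rel_def)
    have "lin NF (lin bd y) = lin (\<lambda>p. lin (\<lambda>t. NF (fst p, perm_list (snd p) (us @ t # vs))) x) (lab_diff l)
        + lin (\<lambda>p. lin (\<lambda>t. NF (fst p, contract (fst (snd p)) (perm_list (snd (snd p)) (us @ t # vs)))) x) (tw l)"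
      unfolding y by (simp add: bd_def case_prod_unfold lin_fun_add) (simp add: lin_swap[of _ x])
    also have "lin (\<lambda>p. lin (\<lambda>t. NF (fst p, perm_list (snd p) (us @ t # vs))) x) (lab_diff l) = (0 :: _ \<Rightarrow>\<^sub>0 'k)"
    proof (rule over_lin_eq_0[OF lab_diff_over], clarsimp simp: ar)
      fix m \<tau> assume "\<tau> permutes {Suc 0..Suc (length us + length vs)}"
      then have "\<tau> permutes {1..Suc (length us + length vs)}" by simp
      then obtain us' vs' where "\<And>t. perm_list \<tau> (us @ t # vs) = us' @ t # vs'"
          "length us' + length vs' = length us + length vs"
        by (rule perm_list_slot) (rule that)
      then show "lin (\<lambda>t. NF (m, perm_list \<tau> (us @ t # vs))) x = 0"
        using NF_ideal[OF xi] by simp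
    qed
    also have "lin (\<lambda>p. lin (\<lambda>t. NF (fst p, contract (fst (snd p)) (perm_list (snd (snd p)) (us @ t # vs)))) x) (tw l) = (0 :: _ \<Rightarrow>\<^sub>0 'k)"
    proof (rule over_lin_eq_0[OF tw_over], clarsimp simp: ar)
      fix m i \<tau> assume \<tau>: "\<tau> permutes {Suc 0..Suc (lab_ar m)}" and i: "i < lab_ar m" and m: "length us + length vs = lab_ar m"
      have "\<tau> permutes {1..Suc (length us + length vs)}" using \<tau> m by simp
      then obtain us' vs' where us': "\<And>t. perm_list \<tau> (us @ t # vs) = us' @ t # vs'"
          "length us' + length vs' = length us + length vs"
        by (rule perm_list_slot) (rule that)
      have "i < length us' + length vs'" using us' m i by simp
      then obtain us'' vs'' C where c: "\<And>t. contract i (us' @ t # vs') = us'' @ C t # vs''"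
          "C = (\<lambda>t. t) \<or> (\<exists>s. C = (\<lambda>t. Br t s)) \<or> (\<exists>s. C = Br s)"
        by (rule contract_slot) (rule that)
      have "lin (\<lambda>t. sgl (C t)) x \<in> lie_ideal"
        using c(2) lie_ideal.left[OF xi] lie_ideal.right[OF xi] xi by auto
      from NF_ideal[OF this, of m us'' vs'']
      show "lin (\<lambda>t. NF (m, contract i (perm_list \<tau> (us @ t # vs)))) x = 0"
        by (simp add: us' c)
    qed
    finally show ?thesis by simp
  qed
qed

lemma NF_bd_eq_0:
  assumes "z \<in> over (valid n)" "lin NF z = 0"
  shows "lin NF (lin bd z) = (0 :: _ \<Rightarrow>\<^sub>0 'k::comm_ring_1)"
proof -
  have "z \<in> free_mod.span (slot_rels n)" using NF_eq_0_iff assms by blast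
  then have "lin (\<lambda>g. lin NF (bd g)) z = 0"
    by (rule lin_span_eq_0) (use NF_bd_slot_rels in simp)
  then show ?thesis by simp
qed

definition lchains :: "nat \<Rightarrow> int \<Rightarrow> lelem set" where
  "lchains n r = {g \<in> valid n. lab_dgr (fst g) = r}"

lemma over_bd: "x \<in> over (lchains n r) \<Longrightarrow> lin bd x \<in> over (lchains n (r - 1))"
  by (rule over_lin, assumption, rule over_mono[OF bd_over[of _ n]]) (auto simp: lchains_def)

lemma over_chains_valid: "x \<in> over (lchains n r) \<Longrightarrow> x \<in> over (valid n)"
  by (rule over_mono) (auto simp: lchains_def)

lemma over_NF: "z \<in> over (valid n) \<Longrightarrow> lin NF z \<in> over (valid_words n)"
  by (erule over_lin) (auto intro: over_mono[OF NF_over])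

text \<open>Allows the cycle condition to be tested on normal forms, where supports are
  meaningful.\<close>

lemma NF_bd_renorm:
  assumes "z \<in> over (valid n)"
  shows "lin NF (lin bd (renorm z)) = (lin NF (lin bd z) :: _ \<Rightarrow>\<^sub>0 'k::comm_ring_1)"
proof -
  have "renorm z \<in> over (valid n)"
    by (rule over_lin[OF over_NF[OF assms]]) (blast intro: over_single of_words_valid)
  then have "lin NF (lin bd (renorm z - z)) = 0"
    using assms NF_renorm[OF assms] by (intro NF_bd_eq_0[of _ n] over_diff) (simp_all del: lin_lin)
  then show ?thesis by (simp del: lin_lin)
qed

section \<open>The square of the differential on correcting labels\<close>

lemma NF_antisym: "NF (l, us @ Br s t # vs) = - (NF (l, us @ Br t s # vs) :: _ \<Rightarrow>\<^sub>0 'k::comm_ring_1)"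
proof -
  have "lin (\<lambda>t. NF (l, us @ t # vs)) (sgl (Br s t) + sgl (Br t s)) = (0 :: _ \<Rightarrow>\<^sub>0 'k)"
    by (rule NF_ideal[OF lie_ideal.antisym])
  then show ?thesis by (simp add: eq_neg_iff_add_eq_0)
qed

lemma NF_leibniz:
  "NF (l, us @ Br (Br a b) c # vs) = NF (l, us @ Br a (Br b c) # vs) - (NF (l, us @ Br b (Br a c) # vs) :: _ \<Rightarrow>\<^sub>0 'k::comm_ring_1)"
proof -
  let ?N = "\<lambda>t. NF (l, us @ t # vs) :: _ \<Rightarrow>\<^sub>0 'k"
  have "lin ?N (sgl (Br (Br a b) c) + sgl (Br (Br b c) a) + sgl (Br (Br c a) b)) = 0"
    by (rule NF_ideal[OF lie_ideal.jacobi])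
  then have "?N (Br (Br a b) c) = - ?N (Br (Br b c) a) - ?N (Br (Br c a) b)"
    by (simp add: eq_diff_eq eq_neg_iff_add_eq_0 ac_simps)
  moreover have "lin ?N (lin (\<lambda>s. sgl (Br s b)) (sgl (Br c a) + sgl (Br a c))) = 0"
    by (rule NF_ideal[OF lie_ideal.left[OF lie_ideal.antisym]])
  then have "?N (Br (Br c a) b) = - ?N (Br (Br a c) b)"
    by (simp add: eq_neg_iff_add_eq_0)
  ultimately show ?thesis
    by (simp add: NF_antisym[of l us "Br b c" a vs] NF_antisym[of l us "Br a c" b vs])
qed

text \<open>Covers the labels by which cycles are corrected during sorting and in arity 3.
  Antisymmetry suffices except for \<open>L4_3\<close>, whose twist meets \<open>L3_2\<close> and
  then \<open>L2_1\<close>, so that two brackets are nested and Jacobi is needed.\<close>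

lemma NF_bd_bd:
  assumes "length ts = lab_ar l" "l \<in> {L2_1, L2_11, L2_111, L3_1, L3_2, L3_11, L3_12, L3_22, L4_1, L4_2, L4_3}"
  shows "lin NF (lin bd (bd (l, ts))) = (0 :: _ \<Rightarrow>\<^sub>0 'k::comm_ring_1)"
proof -
  have a0: "NF (m, [Br y x]) = - (NF (m, [Br x y]) :: _ \<Rightarrow>\<^sub>0 'k)"
    "NF (m, [Br y x, z]) = - (NF (m, [Br x y, z]) :: _ \<Rightarrow>\<^sub>0 'k)"
    "NF (m, [Br y x, z, w]) = - (NF (m, [Br x y, z, w]) :: _ \<Rightarrow>\<^sub>0 'k)"
    "NF (m, [z, Br y x]) = - (NF (m, [z, Br x y]) :: _ \<Rightarrow>\<^sub>0 'k)"
    "NF (m, [z, Br y x, w]) = - (NF (m, [z, Br x y, w]) :: _ \<Rightarrow>\<^sub>0 'k)"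
    "NF (m, [z, w, Br y x]) = - (NF (m, [z, w, Br x y]) :: _ \<Rightarrow>\<^sub>0 'k)" for m x y z w
    by (rule NF_antisym[where us = "[]", simplified] NF_antisym[where us = "[z]", simplified]
        NF_antisym[where us = "[z, w]", simplified])+
  have j: "NF (m, [Br (Br x y) z, w]) = NF (m, [Br x (Br y z), w]) - (NF (m, [Br y (Br x z), w]) :: _ \<Rightarrow>\<^sub>0 'k)"
    "NF (m, [w, Br (Br x y) z]) = NF (m, [w, Br x (Br y z)]) - (NF (m, [w, Br y (Br x z)]) :: _ \<Rightarrow>\<^sub>0 'k)"
    for m x y z w
    by (rule NF_leibniz[where us = "[]", simplified] NF_leibniz[where us = "[w]", simplified])+
  consider (2) a b where "ts = [a, b]" "lab_ar l = 2" | (3) a b c where "ts = [a, b, c]" "lab_ar l = 3"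
    | (4) a b c d where "ts = [a, b, c, d]" "lab_ar l = 4"
    using assms by (auto simp: length_Suc_conv eval_nat_numeral)
  then show ?thesis
  proof cases
    case 2
    then show ?thesis using assms a0(1)[of _ b a] by (auto simp: bd_simps)
  next
    case 3
    show ?thesis
      using assms 3 a0(2)[of _ b a] a0(4)[of _ a c b] a0(4)[of _ b c a] by (auto simp: bd_simps)
  next
    case 4
    show ?thesis
      using assms 4 a0(3)[of _ b a] a0(5)[of _ a c b] a0(6)[of _ a b d c]
        j(1)[of _ a b c d] j(2)[of _ c a b d] by (auto simp: bd_simps algebra_simps)
  qed
qed

section \<open>Exactness in low degrees\<close>

lemma wedges_wordy: "ws \<in> wedges A \<Longrightarrow> w \<in> set ws \<Longrightarrow> wordy w"
  by (auto simp: wedges_def heads_def wordy_def distinct_concat_iff)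

lemma wedges_pairs: "ws \<in> wedges A \<Longrightarrow> sorted_wrt (\<lambda>u v. hd u < hd v \<and> set u \<inter> set v = {}) ws"
proof -
  have "sorted_wrt (\<lambda>u v. hd u < hd v \<and> set u \<inter> set v = {}) ws"
    if "sorted_wrt (<) (map hd ws)" "distinct (concat ws)"
    using that by (induction ws) auto
  then show "ws \<in> wedges A \<Longrightarrow> ?thesis"
    by (auto simp: wedges_def heads_def)
qed

lemma nf_Br_lw:
  assumes "wordy u" "wordy v" "hd u < hd v" "set u \<inter> set v = {}"
  shows "nf (Br (left_normed u) (left_normed v)) = - (rmul (left_normed u) v :: _ \<Rightarrow>\<^sub>0 'k::comm_ring_1)"
proof -
  have "mx (left_normed u) = hd u" "mx (left_normed v) = hd v" using assms by (auto simp: wordy_def mx_lw)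
  then show ?thesis using assms by (simp add: nf_lw wordy_def)
qed

text \<open>In a wedge the later word has the larger head, so \<open>nf\<close> of a bracket appends
  the earlier word to the later one with a minus sign; that minus is the one in
  \<open>ce\<close>.\<close>

lemma NF_bd_ell:
  assumes ws: "ws \<in> wedges A" and k: "length ws = k" "2 \<le> k" "k \<le> 5"
  shows "lin NF (bd (ell k, map left_normed ws)) = (lin (\<lambda>T. sgl (ell (k - 1), T)) (ce ws) :: _ \<Rightarrow>\<^sub>0 'k::comm_ring_1)"
proof -
  have w: "nf (left_normed u) = (sgl u :: _ \<Rightarrow>\<^sub>0 'k)" if "u \<in> set ws" for u
    using wedges_wordy[OF ws that] by (simp add: nf_lw wordy_def)
  have wbd: "\<forall>u\<in>set ws. wordy u" using wedges_wordy[OF ws] by blast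
  note p = wedges_pairs[OF ws]
  consider (2) a b where "ws = [a, b]" "k = 2" | (3) a b c where "ws = [a, b, c]" "k = 3"
    | (4) a b c d where "ws = [a, b, c, d]" "k = 4" | (5) a b c d e where "ws = [a, b, c, d, e]" "k = 5"
  proof -
    have "k = 2 \<or> k = 3 \<or> k = 4 \<or> k = 5" using k by linarith
    then show thesis
      using that k(1) by (elim disjE) (auto simp: length_Suc_conv eval_nat_numeral)
  qed
  then show ?thesis
  proof cases
    case 2
    then show ?thesis
      using w p wbd by (simp add: ell_def bd_simps NF_def nf_Br_lw lin_fun_uminus lin_fun_add lin_fun_diff del: nf.simps)
  next
    case 3
    then show ?thesis
      using w p wbd by (simp add: ell_def bd_simps NF_def nf_Br_lw lin_fun_uminus lin_fun_add lin_fun_diff del: nf.simps)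
  next
    case 4
    then show ?thesis
      using w p wbd by (simp add: ell_def bd_simps NF_def nf_Br_lw lin_fun_uminus lin_fun_add lin_fun_diff del: nf.simps)
  next
    case 5
    then show ?thesis
      using w p wbd by (simp add: ell_def bd_simps NF_def nf_Br_lw lin_fun_uminus lin_fun_add lin_fun_diff del: nf.simps)
  qed
qed

text \<open>
  \<open>alt\<close> sorts by first letters. It changes sign under adjacent transpositions, hence vanishes on the
  differentials of the generators \<open>l\<^bsub>k;i\<^esub>\<close>.
\<close>

primrec ins :: "nat list \<Rightarrow> nat list list \<Rightarrow> (nat list list \<Rightarrow>\<^sub>0 'k::comm_ring_1)" where
  "ins u [] = sgl [u]"
| "ins u (v # T) = (if hd u < hd v then sgl (u # v # T) else - lin (\<lambda>T'. sgl (v # T')) (ins u T))"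

primrec alt :: "nat list list \<Rightarrow> (nat list list \<Rightarrow>\<^sub>0 'k::comm_ring_1)" where
  "alt [] = sgl []"
| "alt (u # T) = lin (ins u) (alt T)"

lemma ins_ins:
  "hd u \<noteq> hd v \<Longrightarrow> lin (ins u) (ins v T) = - (lin (ins v) (ins u T) :: _ \<Rightarrow>\<^sub>0 'k::comm_ring_1)"
proof (induction T)
  case Nil
  then show ?case by auto
next
  case (Cons w T)
  have *: "lin (ins p) (lin (\<lambda>T'. sgl (w # T')) X) = (if hd p < hd w then lin (\<lambda>T'. sgl (p # w # T')) X
      else - lin (\<lambda>T'. sgl (w # T')) (lin (ins p) X))" for p and X :: "_ \<Rightarrow>\<^sub>0 'k"
    by (simp add: lin_fun_uminus)
  have "lin (ins u) (ins v (w # T)) + lin (ins v) (ins u (w # T)) = (0 :: _ \<Rightarrow>\<^sub>0 'k)"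
    using Cons by (simp add: * del: lin_lin) auto
  then show ?case by (simp add: eq_neg_iff_add_eq_0)
qed

lemma alt_swap:
  assumes "hd u \<noteq> hd v"
  shows "alt (S @ u # v # T) = - (alt (S @ v # u # T) :: _ \<Rightarrow>\<^sub>0 'k::comm_ring_1)"
proof (induction S)
  case Nil
  have "lin (\<lambda>a. lin (ins u) (ins v a)) (alt T) = lin (\<lambda>a. - lin (ins v) (ins u a)) (alt T :: _ \<Rightarrow>\<^sub>0 'k)"
    by (simp only: ins_ins[OF assms])
  then show ?case by (simp add: lin_fun_uminus)
qed simp

lemma alt_wedge: "sorted_wrt (<) (map hd ws) \<Longrightarrow> alt ws = (sgl ws :: _ \<Rightarrow>\<^sub>0 'k::comm_ring_1)"
proof (induction ws)
  case (Cons u ws)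
  then have "ins u ws = (sgl (u # ws) :: _ \<Rightarrow>\<^sub>0 'k)" by (cases ws) auto
  with Cons show ?case by simp
qed simp

section \<open>Sorting by adjacent transpositions\<close>

definition adj :: "'a list \<Rightarrow> 'a list \<Rightarrow> bool" where
  "adj xs ys \<longleftrightarrow> (\<exists>us a b vs. xs = us @ a # b # vs \<and> ys = us @ b # a # vs)"

lemma adj_Cons: "adj xs ys \<Longrightarrow> adj (x # xs) (x # ys)"
  unfolding adj_def by (metis append_Cons)

lemma adj_rtranclp_Cons: "adj\<^sup>*\<^sup>* xs ys \<Longrightarrow> adj\<^sup>*\<^sup>* (x # xs) (x # ys)"
  by (induction rule: rtranclp_induct) (auto intro: rtranclp.rtrancl_into_rtrancl adj_Cons)

lemma adj_mset1: "adj xs ys \<Longrightarrow> mset ys = mset xs"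
  by (auto simp: adj_def)

lemma adj_mset: "adj\<^sup>*\<^sup>* xs ys \<Longrightarrow> mset ys = mset xs"
  by (induction rule: rtranclp_induct) (auto dest: adj_mset1)

lemma adj_insort: "sorted (map f ys) \<Longrightarrow> \<exists>zs. adj\<^sup>*\<^sup>* (x # ys) zs \<and> sorted (map f zs)"
proof (induction ys)
  case Nil
  show ?case by (rule exI[of _ "[x]"]) simp
next
  case (Cons y ys)
  show ?case
  proof (cases "f x \<le> f y")
    case True
    then show ?thesis using Cons.prems by (intro exI[of _ "x # y # ys"]) auto
  next
    case False
    obtain zs where zs: "adj\<^sup>*\<^sup>* (x # ys) zs" "sorted (map f zs)" using Cons by auto
    have "adj (x # y # ys) (y # x # ys)" unfolding adj_def by (metis append_Nil)
    then have "adj\<^sup>*\<^sup>* (x # y # ys) (y # zs)"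
      using adj_rtranclp_Cons[OF zs(1)] by (rule converse_rtranclp_into_rtranclp)
    moreover have "set zs = insert x (set ys)"
      using mset_eq_setD[OF adj_mset[OF zs(1)]] by simp
    ultimately show ?thesis
      using False zs(2) Cons.prems by (intro exI[of _ "y # zs"]) auto
  qed
qed

lemma adj_sort: "\<exists>ys. adj\<^sup>*\<^sup>* xs ys \<and> sorted (map f ys)"
proof (induction xs)
  case Nil
  show ?case by (rule exI[of _ "[]"]) simp
next
  case (Cons x xs)
  then obtain ys where ys: "adj\<^sup>*\<^sup>* xs ys" "sorted (map f ys)" by blast
  then show ?case
    using adj_insort[OF ys(2), of x] adj_rtranclp_Cons[OF ys(1), of x] by (meson rtranclp_trans)
qed

text \<open>The label is \<open>l_{k;i}\<close> with \<open>i\<close> the place of the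
  transposition; the rest of its differential comes from the twist and has arity
  \<open>k - 1\<close>.\<close>

lemma bd_swap:
  assumes "length ts = k" "2 \<le> k" "k \<le> 4" "adj ts ts'"
  shows "\<exists>l\<in>{L2_1, L3_1, L3_2, L4_1, L4_2, L4_3}. lab_ar l = k \<and> lab_dgr l = int k
    \<and> (bd (l, ts) + sgl (ell k, ts) + sgl (ell k, ts') :: _ \<Rightarrow>\<^sub>0 'k::comm_ring_1) \<in> over {g. fst g \<noteq> ell k}"
proof -
  obtain us a b vs where ts: "ts = us @ a # b # vs" "ts' = us @ b # a # vs"
    using assms(4) by (auto simp: adj_def)
  then have len: "length us + length vs = k - 2" using assms by auto
  consider "k = 2" "us = []" "vs = []"
    | c where "k = 3" "us = []" "vs = [c]" | c where "k = 3" "us = [c]" "vs = []"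
    | c d where "k = 4" "us = []" "vs = [c, d]" | c d where "k = 4" "us = [c]" "vs = [d]"
    | c d where "k = 4" "us = [c, d]" "vs = []"
  proof -
    have "k = 2 \<or> k = 3 \<or> k = 4" using assms by linarith
    then show thesis
      using that len by (cases us; cases vs; cases "tl us"; cases "tl vs") auto
  qed
  then show ?thesis
    by cases (simp_all add: ts bd_simps ell_def over_intros)
qed

section \<open>Sorting and removing the component of largest arity\<close>

definition wchains :: "nat \<Rightarrow> int \<Rightarrow> (lab \<times> nat list list) set" where
  "wchains n r = {g \<in> valid_words n. lab_dgr (fst g) = r}"

lemma over_NF_chains: "z \<in> over (lchains n r) \<Longrightarrow> lin NF z \<in> over (wchains n r)"
proof (erule over_lin)
  fix g assume "g \<in> lchains n r"
  then show "(NF g :: _ \<Rightarrow>\<^sub>0 'k::comm_ring_1) \<in> over (wchains n r)"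
    by (cases g) (auto simp: lchains_def wchains_def intro!: over_mono[OF NF_over])
qed

lemma over_of_words: "\<zeta> \<in> over (wchains n r) \<Longrightarrow> lin (\<lambda>g. sgl (of_words g)) \<zeta> \<in> over (lchains n r)"
proof (erule over_lin)
  fix g assume "g \<in> wchains n r"
  then show "(sgl (of_words g) :: _ \<Rightarrow>\<^sub>0 'k::comm_ring_1) \<in> over (lchains n r)"
    using of_words_valid[of g n]
    by (intro over_single) (auto simp: lchains_def wchains_def of_words_def split: prod.split)
qed

text \<open>Lie has no operations of arity 0, so the arity of a label is at most that of the
  composite; in arity 1 only the unit is left, in degree 0.\<close>

lemma chains_empty:
  assumes "n < 2" "(n, r) \<noteq> (1, 0)"
  shows "lchains n r = {}"
proof (rule ccontr)
  assume "lchains n r \<noteq> {}"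
  then obtain l ts where v: "(l, ts) \<in> valid n" and r: "lab_dgr l = r" by (auto simp: lchains_def)
  have "length ts \<le> length (concat (map leaves ts))"
  proof -
    have pos: "1 \<le> length (leaves t)" for t
      using leaves_nonempty[of t] by (simp add: Suc_le_eq del: leaves_nonempty)
    show ?thesis
    proof (induction ts)
      case (Cons t ts)
      then show ?case
        using pos[of t] by (simp only: list.map concat.simps length_append list.size)
    qed simp
  qed
  also have "\<dots> = n"
    using v distinct_card[of "concat (map leaves ts)"] by (auto simp: valid_def)
  finally have "lab_ar l \<le> n" using v by (simp add: valid_def)
  then have "n = 1 \<and> l = L1" using assms(1) by (cases l) auto
  then show False using r assms(2) by auto
qed

text \<open>Normal forms keep the largest letter of an entry as the head of its word, so sorting the
  entries by \<open>mx\<close> sorts the words by heads; disjointness makes the order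
  strict.\<close>

lemma NF_sorted_wedges:
  assumes v: "(l, ts) \<in> valid n" and s: "sorted (map mx ts)"
  shows "(NF (l, ts) :: _ \<Rightarrow>\<^sub>0 'k::comm_ring_1) \<in> over {g \<in> valid_words n. fst g = l \<and> snd g \<in> wedges {1..n}}"
proof -
  have hds: "map hd ws = map mx ts"
    if "list_all2 (\<lambda>w t. wordy w \<and> mset w = mset (leaves t) \<and> hd w = mx t) ws ts" for ws
    using that by (induction rule: list_all2_induct) auto
  have d: "distinct (map hd ws)" if "distinct (concat ws)" "\<forall>w\<in>set ws. w \<noteq> []" for ws :: "nat list list"
    using that
  proof (induction ws)
    case (Cons w ws)
    have "hd w \<noteq> hd v" if "v \<in> set ws" for v
    proof -
      have "set w \<inter> set v = {}" "w \<noteq> []" "v \<noteq> []" using Cons.prems that by auto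
      then show ?thesis using hd_in_set[of w] hd_in_set[of v] by (metis disjoint_iff)
    qed
    then show ?case using Cons by auto
  qed simp
  have "(NF (l, ts) :: _ \<Rightarrow>\<^sub>0 'k) \<in> over {g. list_all2 (\<lambda>w t. wordy w \<and> mset w = mset (leaves t) \<and> hd w = mx t) (snd g) ts}"
    using v unfolding NF_def prod.case valid_def by (intro over_lin[OF tens_over] over_single) auto
  then have K: "Poly_Mapping.keys (NF (l, ts) :: _ \<Rightarrow>\<^sub>0 'k) \<subseteq>
      {g. g \<in> valid_words n \<and> fst g = l \<and> list_all2 (\<lambda>w t. wordy w \<and> mset w = mset (leaves t) \<and> hd w = mx t) (snd g) ts}"
    using NF_over[OF v] by (auto simp: over_def)
  have W: "snd g \<in> wedges {1..n}"
    if "g \<in> valid_words n" "list_all2 (\<lambda>w t. wordy w \<and> mset w = mset (leaves t) \<and> hd w = mx t) (snd g) ts" for g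
  proof -
    have "sorted (map hd (snd g))" using s hds[OF that(2)] by simp
    moreover have "distinct (map hd (snd g))" using that(1) by (intro d) (auto simp: valid_words_def wordy_def)
    ultimately have "sorted_wrt (<) (map hd (snd g))" by (simp add: strict_sorted_iff)
    then show ?thesis using that(1) by (cases g) (simp add: wedges_def heads_def valid_words_def wordy_def)
  qed
  have "Poly_Mapping.keys (NF (l, ts) :: _ \<Rightarrow>\<^sub>0 'k) \<subseteq> {g \<in> valid_words n. fst g = l \<and> snd g \<in> wedges {1..n}}"
    by (rule subset_trans[OF K]) (use W in blast)
  then show ?thesis by (simp only: over_def mem_Collect_eq)
qed

definition sorted_top :: "nat \<Rightarrow> nat \<Rightarrow> (lab \<times> nat list list) set" where
  "sorted_top n k = {g \<in> wchains n (int k - 1). fst g = ell k \<longrightarrow> snd g \<in> wedges {1..n}}"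

text \<open>Along a chain of adjacent transpositions each list is traded, modulo a boundary and
  terms at other labels, for minus the next one. The condition on the square is carried along so
  that subtracting the boundary preserves cycles.\<close>

lemma sort_top_gen:
  assumes k: "1 \<le> k" "k \<le> 4" and v: "(ell k, ts) \<in> valid n"
  shows "\<exists>y\<in>over (lchains n (int k)). lin NF (lin bd (lin bd y)) = 0
    \<and> lin NF (sgl (ell k, ts) - lin bd y) \<in> (over (sorted_top n k) :: (_ \<Rightarrow>\<^sub>0 'k::comm_ring_1) set)"
proof -
  obtain us where us: "adj\<^sup>*\<^sup>* ts us" "sorted (map mx us)" using adj_sort by blast
  from us(1) v show ?thesis
  proof (induction rule: converse_rtranclp_induct)
    case base
    have "(NF (ell k, us) :: _ \<Rightarrow>\<^sub>0 'k) \<in> over (sorted_top n k)"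
      by (rule over_mono[OF NF_sorted_wedges[OF base us(2)]])
        (use k in \<open>auto simp: sorted_top_def wchains_def ell_dgr\<close>)
    then show ?case by (intro bexI[of _ 0]) auto
  next
    case (step ts ts')
    have len: "length ts = k" using step.prems k by (simp add: valid_def ell_ar)
    have "2 \<le> length ts" using step.hyps(1) by (auto simp: adj_def)
    then obtain l where l: "l \<in> {L2_1, L3_1, L3_2, L4_1, L4_2, L4_3}" "lab_ar l = k" "lab_dgr l = int k"
      and low: "(bd (l, ts) + sgl (ell k, ts) + sgl (ell k, ts') :: _ \<Rightarrow>\<^sub>0 'k) \<in> over {g. fst g \<noteq> ell k}" (is "?low \<in> _")
      using bd_swap[OF len _ k(2) step.hyps(1)] len by blast
    have v': "(ell k, ts') \<in> valid n"
      using adj_mset1[OF step.hyps(1)] mset_eq_length[OF adj_mset1[OF step.hyps(1)]] len k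
      by (intro valid_cong[OF step.prems] mset_concat_map) (auto simp: ell_ar)
    have vl: "(l, ts) \<in> valid n" using step.prems l k by (auto simp: valid_def ell_ar)
    from step.IH[OF v'] obtain y where y: "y \<in> over (lchains n (int k))" "lin NF (lin bd (lin bd y)) = 0"
      "lin NF (sgl (ell k, ts') - lin bd y) \<in> (over (sorted_top n k) :: (_ \<Rightarrow>\<^sub>0 'k) set)"
      by blast
    let ?y = "- sgl (l, ts) - y"
    have "?low \<in> over (lchains n (int k - 1))"
      using bd_over[OF vl] l k step.prems v' by (intro over_intros) (auto simp: lchains_def ell_dgr)
    with low have "?low \<in> over (lchains n (int k - 1) \<inter> {g. fst g \<noteq> ell k})"
      by (auto simp: over_def)
    then have "lin NF ?low \<in> (over (sorted_top n k) :: (_ \<Rightarrow>\<^sub>0 'k) set)"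
    proof (rule over_lin)
      fix g assume g: "g \<in> lchains n (int k - 1) \<inter> {g. fst g \<noteq> ell k}"
      then show "(NF g :: _ \<Rightarrow>\<^sub>0 'k) \<in> over (sorted_top n k)"
        by (cases g) (auto simp: lchains_def wchains_def sorted_top_def intro!: over_mono[OF NF_over])
    qed
    moreover have "sgl (ell k, ts) - lin bd ?y = ?low - (sgl (ell k, ts') - lin bd y)"
      by simp
    ultimately have "lin NF (sgl (ell k, ts) - lin bd ?y) \<in> (over (sorted_top n k) :: (_ \<Rightarrow>\<^sub>0 'k) set)"
      using over_diff[OF _ y(3)] by (simp only: lin_diff)
    moreover have "?y \<in> over (lchains n (int k))"
      using y(1) vl l by (intro over_intros) (auto simp: lchains_def)
    moreover have "lin NF (lin bd (bd (l, ts))) = (0 :: _ \<Rightarrow>\<^sub>0 'k)"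
      using vl l by (intro NF_bd_bd) (auto simp: valid_def)
    then have "lin NF (lin bd (lin bd ?y)) = 0"
      using y(2) by simp
    ultimately show ?case by blast
  qed
qed

lemma sort_top:
  assumes k: "1 \<le> k" "k \<le> 4" and z: "(z :: _ \<Rightarrow>\<^sub>0 'k::comm_ring_1) \<in> over (lchains n (int k - 1))"
  obtains y where "y \<in> over (lchains n (int k))" "lin NF (lin bd (lin bd y)) = 0"
    "lin NF (z - lin bd y) \<in> over (sorted_top n k)"
proof -
  have "\<exists>y\<in>over (lchains n (int k)). lin NF (lin bd (lin bd y)) = 0
    \<and> lin NF (sgl g - lin bd y) \<in> (over (sorted_top n k) :: (_ \<Rightarrow>\<^sub>0 'k::comm_ring_1) set)"
    if g: "g \<in> lchains n (int k - 1)" for g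
  proof (cases "fst g = ell k")
    case True
    then show ?thesis using sort_top_gen[OF k, of "snd g" n] g by (cases g) (auto simp: lchains_def)
  next
    case False
    then have "(NF g :: _ \<Rightarrow>\<^sub>0 'k) \<in> over (sorted_top n k)"
      using g by (cases g) (auto simp: lchains_def wchains_def sorted_top_def intro!: over_mono[OF NF_over])
    then show ?thesis by (intro bexI[of _ 0]) auto
  qed
  then obtain f :: "_ \<Rightarrow> _ \<Rightarrow>\<^sub>0 'k" where f: "\<And>g. g \<in> lchains n (int k - 1) \<Longrightarrow> f g \<in> over (lchains n (int k))
      \<and> lin NF (lin bd (lin bd (f g))) = 0 \<and> lin NF (sgl g - lin bd (f g)) \<in> over (sorted_top n k)"
    by metis
  show thesis
  proof (rule that[of "lin f z"])
    show "lin f z \<in> over (lchains n (int k))" using f by (intro over_lin[OF z]) auto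
    have "lin (\<lambda>g. lin NF (lin bd (lin bd (f g)))) z = 0"
      by (rule over_lin_eq_0[OF z]) (use f in blast)
    then show "lin NF (lin bd (lin bd (lin f z))) = 0" by simp
    have "lin (\<lambda>g. lin NF (sgl g - lin bd (f g))) z \<in> over (sorted_top n k)"
      by (rule over_lin[OF z]) (use f in blast)
    then show "lin NF (z - lin bd (lin f z)) \<in> over (sorted_top n k)"
      by (simp add: lin_fun_diff)
  qed
qed


abbreviation wbd :: "(lab \<times> nat list list) \<Rightarrow> (lab \<times> nat list list \<Rightarrow>\<^sub>0 'k::comm_ring_1)" where
  "wbd g \<equiv> lin NF (bd (of_words g))"

lemma wd_top:
  assumes k: "1 \<le> k" "k \<le> 5" and T: "T \<in> wedges A" "length T = k"
  shows "wbd (ell k, T) = (lin (\<lambda>T. sgl (ell (k - 1), T)) (ce T) :: _ \<Rightarrow>\<^sub>0 'k::comm_ring_1)"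
proof (cases "k = 1")
  case True
  then obtain w where "T = [w]" using T(2) by (cases T) auto
  then show ?thesis using True by (simp add: of_words_def ell_def bd_simps)
next
  case False
  then show ?thesis using NF_bd_ell[OF T] k by (simp add: of_words_def)
qed

text \<open>For a sorted top component \<open>alt\<close> changes nothing and leaves
  \<open>ce\<close>. Any other label of this degree reaches \<open>ell (k - 1)\<close> only in pairs
  of adjacent transposes, if at all, and \<open>alt\<close> cancels such pairs.\<close>

lemma alt_wd:
  assumes k: "2 \<le> k" "k \<le> 4" and g: "g \<in> sorted_top n k"
  shows "lin (\<lambda>h. if fst h = ell (k - 1) then alt (snd h) else 0) (wbd g)
    = (if fst g = ell k then ce (snd g) else 0 :: _ \<Rightarrow>\<^sub>0 'k::comm_ring_1)"
proof -
  define \<Psi> where "\<Psi> = (\<lambda>h. if fst h = ell (k - 1) then alt (snd h) else 0 :: _ \<Rightarrow>\<^sub>0 'k)"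
  have gv: "g \<in> valid_words n" "lab_dgr (fst g) = int k - 1"
    using g by (auto simp: sorted_top_def wchains_def)
  have "lin \<Psi> (wbd g) = (if fst g = ell k then ce (snd g) else 0)"
  proof (cases "fst g = ell k")
    case True
    have T: "snd g \<in> wedges {1..n}" "length (snd g) = k"
      using g True gv k by (auto simp: sorted_top_def valid_words_def ell_ar)
    have "lin \<Psi> (wbd (ell k, snd g)) = lin alt (ce (snd g))"
    proof -
      have w: "wbd (ell k, snd g) = (lin (\<lambda>T. sgl (ell (k - 1), T)) (ce (snd g)) :: _ \<Rightarrow>\<^sub>0 'k)"
        by (rule wd_top[OF _ _ T]) (use k in auto)
      show ?thesis unfolding w by (simp add: \<Psi>_def)
    qed
    also have "\<dots> = lin sgl (ce (snd g))"
      by (rule over_lin_cong[OF ce_wedges[OF T(1)]]) (auto simp: wedges_def heads_def intro!: alt_wedge)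
    finally show ?thesis using True by (cases g) simp
  next
    case False
    obtain l ws where gl: "g = (l, ws)" by fastforce
    have len: "length ws = lab_ar l" and wo: "\<forall>w\<in>set ws. wordy w" and d: "distinct (concat ws)"
      using gv by (auto simp: valid_words_def gl)
    have \<Psi>_low: "lin \<Psi> (NF (m, ts)) = 0" if "m \<noteq> ell (k - 1)" for m ts
      using that by (simp add: NF_def \<Psi>_def)
    have \<Psi>_words: "lin \<Psi> (NF (m, map left_normed us)) = (if m = ell (k - 1) then alt us else 0)"
      if "\<forall>w\<in>set us. wordy w" for m us
      using that by (simp add: NF_def tens_lw \<Psi>_def)
    have hds: "hd u \<noteq> hd v" if "wordy u" "wordy v" "set u \<inter> set v = {}" for u v :: "nat list"
      using that hd_in_set[of u] hd_in_set[of v] unfolding wordy_def by (metis disjoint_iff)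
    \<comment> \<open>All labels of degree \<open>k - 1\<close> other than \<open>ell k\<close>; for
      \<open>k = 2\<close> there are none.\<close>
    have l: "(k = 3 \<and> l = L2_1) \<or> (k = 4 \<and> l \<in> {L2_11, L3_1, L3_2})"
    proof -
      have "k = 2 \<or> k = 3 \<or> k = 4" using k by linarith
      then show ?thesis using False gv(2) by (cases l) (auto simp: gl ell_def)
    qed
    have "lin \<Psi> (wbd g) = 0"
    proof (cases "l \<in> {L3_1, L3_2}")
      case True
      then obtain u v w where ws: "ws = [u, v, w]"
        using len by (auto simp: length_Suc_conv eval_nat_numeral)
      have k4: "k = 4" using l True by auto
      have [simp]: "map left_normed [a, b, c] = [left_normed a, left_normed b, left_normed c]" for a b c by simp
      have w3: "lin \<Psi> (NF (L3, [left_normed a, left_normed b, left_normed c])) = alt [a, b, c]" if "wordy a" "wordy b" "wordy c" for a b c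
        using \<Psi>_words[of "[a, b, c]" L3] that k4 by (simp add: ell_def)
      have "hd u \<noteq> hd v" "hd v \<noteq> hd w" using wo d hds by (auto simp: ws)
      then have "alt [v, u, w] = - (alt [u, v, w] :: _ \<Rightarrow>\<^sub>0 'k)" "alt [u, w, v] = - (alt [u, v, w] :: _ \<Rightarrow>\<^sub>0 'k)"
        using alt_swap[of v u "[]" "[w]"] alt_swap[of w v "[u]" "[]"] by (simp_all del: alt.simps)
      moreover have "lin \<Psi> (NF (L2_1, ts)) = 0" for ts
        using k4 by (intro \<Psi>_low) (simp add: ell_def)
      ultimately show ?thesis
        using True wo k4 by (auto simp: gl ws of_words_def bd_simps w3 simp del: alt.simps lin_lin)
    next
      case F: False
      then obtain u v where ws: "ws = [u, v]"
        using len l by (auto simp: length_Suc_conv eval_nat_numeral)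
      have w2: "lin \<Psi> (NF (m, [left_normed a, left_normed b])) = (if m = ell (k - 1) then alt [a, b] else 0)" if "wordy a" "wordy b" for a b m
        using \<Psi>_words[of "[a, b]" m] that by simp
      have "hd u \<noteq> hd v" using wo d hds by (auto simp: ws)
      then have "alt [v, u] = - (alt [u, v] :: _ \<Rightarrow>\<^sub>0 'k)"
        using alt_swap[of v u "[]" "[]"] by (simp del: alt.simps)
      then show ?thesis
        using l F wo by (auto simp: gl ws of_words_def bd_simps w2 ell_def simp del: alt.simps lin_lin)
    qed
    then show ?thesis using False by simp
  qed
  then show ?thesis by (simp only: \<Psi>_def)
qed

text \<open>The top component \<open>t\<close> is a cycle for \<open>ce\<close>, by
  \<open>alt_wd\<close> when \<open>k > 1\<close>, and so has a filling by wedges. Placed at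
  \<open>ell (Suc k)\<close>, wedges have differential exactly \<open>ce\<close> with no other
  components, so \<open>t\<close> is removed and the rest is untouched.\<close>

lemma kill_top:
  assumes k: "1 \<le> k" "k \<le> 4" and n: "(n, int k - 1) \<noteq> (1, 0)"
    and \<zeta>: "(\<zeta> :: _ \<Rightarrow>\<^sub>0 'k::comm_ring_1) \<in> over (sorted_top n k)" and cyc: "lin wbd \<zeta> = 0"
  obtains y where "y \<in> over (lchains n (int k))" "\<zeta> - lin NF (lin bd y) \<in> over {g \<in> wchains n (int k - 1). fst g \<noteq> ell k}"
    "lin wbd (\<zeta> - lin NF (lin bd y)) = 0"
proof (cases "n < 2")
  case True
  \<comment> \<open>Exactness of wedges needs two letters; below that the chain groups vanish apart
    from the excluded one.\<close>
  have "g \<notin> sorted_top n k" for g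
  proof
    assume "g \<in> sorted_top n k"
    then have "of_words g \<in> lchains n (int k - 1)"
      using of_words_valid[of g n] by (cases g) (auto simp: sorted_top_def wchains_def lchains_def of_words_def)
    then show False using chains_empty[OF True n] by simp
  qed
  then have "Poly_Mapping.keys \<zeta> = {}" using \<zeta> unfolding over_def by blast
  then have "\<zeta> = 0" by simp
  then show thesis using that[of 0] by simp
next
  case False
  define t where "t = lin (\<lambda>g. if fst g = ell k then sgl (snd g) else 0) \<zeta>"
  define low where "low = lin (\<lambda>g. if fst g = ell k then 0 else sgl g) \<zeta>"
  have t: "t \<in> over {T \<in> wedges {1..n}. length T = k}"
    unfolding t_def by (rule over_lin[OF \<zeta>]) (use k in \<open>auto simp: sorted_top_def wchains_def valid_words_def ell_ar\<close>)
  have low: "low \<in> over {g \<in> wchains n (int k - 1). fst g \<noteq> ell k}"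
    unfolding low_def by (rule over_lin[OF \<zeta>]) (auto simp: sorted_top_def)
  have \<zeta>_eq: "\<zeta> = lin (\<lambda>T. sgl (ell k, T)) t + low"
  proof -
    have "lin (\<lambda>T. sgl (ell k, T)) t + low = lin (\<lambda>g. (if fst g = ell k then sgl (ell k, snd g) else 0) + (if fst g = ell k then 0 else sgl g)) \<zeta>"
      unfolding t_def low_def lin_lin lin_fun_add by (simp add: if_distrib[of "lin _"] cong: if_cong)
    also have "\<dots> = lin sgl \<zeta>" by (rule lin_cong) auto
    finally show ?thesis by simp
  qed
  have wd_t: "lin wbd (lin (\<lambda>T. sgl (ell k, T)) t) = lin (\<lambda>T. sgl (ell (k - 1), T)) (lin ce t)"
  proof -
    have "lin (\<lambda>T. wbd (ell k, T)) t = lin (\<lambda>T. lin (\<lambda>T. sgl (ell (k - 1), T)) (ce T)) t"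
      using k by (intro over_lin_cong[OF t] wd_top) auto
    then show ?thesis by simp
  qed
  have ct: "lin ce t = 0"
  proof (cases "k = 1")
    case True
    have "ce T = (0 :: _ \<Rightarrow>\<^sub>0 'k)" if "length T = 1" for T
      using that by (auto simp: length_Suc_conv)
    then show ?thesis using True by (intro over_lin_eq_0[OF t]) auto
  next
    case False
    let ?\<Psi> = "\<lambda>h. if fst h = ell (k - 1) then alt (snd h) else 0 :: _ \<Rightarrow>\<^sub>0 'k"
    have "0 = lin ?\<Psi> (lin wbd \<zeta>)" using cyc by simp
    also have "\<dots> = lin (\<lambda>g. lin ?\<Psi> (wbd g)) \<zeta>" by (simp only: lin_lin)
    also have "\<dots> = lin (\<lambda>g. if fst g = ell k then ce (snd g) else 0) \<zeta>"
      using False k by (intro over_lin_cong[OF \<zeta>] alt_wd) auto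
    also have "\<dots> = lin ce t"
      unfolding t_def lin_lin by (simp add: if_distrib[of "lin _"] cong: if_cong)
    finally show ?thesis by simp
  qed
  have "2 \<le> card {1..n}" using False by simp
  then obtain u where u: "u \<in> over {T \<in> wedges {1..n}. length T = Suc k}" "lin ce u = t"
    using wedges_exact[OF _ t ct] by blast
  define y where "y = lin (\<lambda>T. sgl (of_words (ell (Suc k), T))) u"
  have "lin (\<lambda>T. sgl (ell (Suc k), T)) u \<in> over (wchains n (int k))"
  proof (rule over_lin[OF u(1)])
    fix T assume T: "T \<in> {T \<in> wedges {1..n}. length T = Suc k}"
    then have "(ell (Suc k), T) \<in> wchains n (int k)"
      using k wedges_wordy[of T "{1..n}"] by (auto simp: wchains_def valid_words_def ell_ar ell_dgr wedges_def)
    then show "(sgl (ell (Suc k), T) :: _ \<Rightarrow>\<^sub>0 'k) \<in> over (wchains n (int k))" by (rule over_single)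
  qed
  from over_of_words[OF this] have y: "y \<in> over (lchains n (int k))"
    by (simp add: y_def)
  have "lin (\<lambda>T. wbd (ell (Suc k), T)) u = lin (\<lambda>T. lin (\<lambda>T. sgl (ell (Suc k - 1), T)) (ce T)) u"
    using k by (intro over_lin_cong[OF u(1)] wd_top) auto
  then have "lin NF (lin bd y) = lin (\<lambda>T. sgl (ell k, T)) (lin ce u)"
    by (simp add: y_def)
  then have eq: "\<zeta> - lin NF (lin bd y) = low"
    using u(2) \<zeta>_eq by simp
  have "lin wbd \<zeta> = lin wbd (lin (\<lambda>T. sgl (ell k, T)) t) + lin wbd low"
    by (subst \<zeta>_eq) (rule lin_add)
  then have "lin wbd low = 0"
    unfolding cyc wd_t ct by simp
  then show thesis
    using low by (intro that[OF y]) (simp_all only: eq)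
qed

text \<open>
  Contracting homotopies for the arity-preserving part of the differential in arities 2 and 3, relative
  to the sorted order of the first letters. In arity 3 the generators \<open>l\<^sub>3\<close>, \<open>l\<^bsub>3;1\<^esub>\<close>, \<open>l\<^bsub>3;2\<^esub>\<close> span the
  cellular chains of the hexagon of orderings (up to the cells \<open>l\<^bsub>3;1,1\<^esub>\<close>, \<open>l\<^bsub>3;2,2\<^esub>\<close> identifying the two
  orientations of an edge); \<open>sort_htpy3\<close> comes from the spanning tree that omits the edge between
  \<open>cba\<close> and \<open>cab\<close>, and \<open>l\<^bsub>3;1,2\<^esub>\<close> fills the hexagon.
\<close>

definition sort_htpy2 :: "lab \<times> nat list list \<Rightarrow> (lelem \<Rightarrow>\<^sub>0 'k::comm_ring_1)" where
  "sort_htpy2 g = (let u = snd g ! 0; v = snd g ! 1 in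
     if hd v < hd u then
       if fst g = L2 then - sgl (L2_1, [left_normed v, left_normed u])
       else if fst g = L2_1 then sgl (L2_11, [left_normed v, left_normed u])
       else if fst g = L2_11 then - sgl (L2_111, [left_normed u, left_normed v])
       else 0
     else 0)"

definition sort_htpy3 :: "lab \<times> nat list list \<Rightarrow> (lelem \<Rightarrow>\<^sub>0 'k::comm_ring_1)" where
  "sort_htpy3 g = (let u = snd g ! 0; v = snd g ! 1; w = snd g ! 2 in
     if fst g = L3 then
       if hd v < hd u \<and> hd u < hd w then - sgl (L3_1, [left_normed v, left_normed u, left_normed w])
       else if hd u < hd w \<and> hd w < hd v then - sgl (L3_2, [left_normed u, left_normed w, left_normed v])
       else if hd w < hd u \<and> hd u < hd v then sgl (L3_1, [left_normed w, left_normed u, left_normed v]) - sgl (L3_2, [left_normed u, left_normed w, left_normed v])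
       else if hd v < hd w \<and> hd w < hd u then sgl (L3_2, [left_normed v, left_normed w, left_normed u]) - sgl (L3_1, [left_normed v, left_normed u, left_normed w])
       else if hd w < hd v \<and> hd v < hd u
         then sgl (L3_2, [left_normed v, left_normed w, left_normed u]) - sgl (L3_1, [left_normed v, left_normed u, left_normed w]) - sgl (L3_1, [left_normed w, left_normed v, left_normed u])
       else 0
     else if fst g = L3_1 then
       if hd v < hd u then sgl (L3_11, [left_normed v, left_normed u, left_normed w]) else 0
     else if fst g = L3_2 then
       (if hd w < hd v then sgl (L3_22, [left_normed u, left_normed w, left_normed v]) else 0)
       - (if hd v < hd w \<and> hd w < hd u then sgl (L3_12, [left_normed v, left_normed w, left_normed u])
          else if hd w < hd v \<and> hd v < hd u then sgl (L3_12, [left_normed w, left_normed v, left_normed u]) else 0)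
     else 0)"

lemma NF_fst: "(NF (m, ts) :: _ \<Rightarrow>\<^sub>0 'k::comm_ring_1) \<in> over {h. fst h = m}"
  unfolding NF_def prod.case by (rule over_lin[where A = UNIV]) (auto simp: over_def)

lemma NF_lw: "\<forall>w\<in>set ws. wordy w \<Longrightarrow> NF (m, map left_normed ws) = (sgl (m, ws) :: _ \<Rightarrow>\<^sub>0 'k::comm_ring_1)"
  by (simp add: NF_def tens_lw)

lemma hd_neq: "wordy u \<Longrightarrow> wordy v \<Longrightarrow> set u \<inter> set v = {} \<Longrightarrow> hd u \<noteq> hd v"
  unfolding wordy_def by (metis disjoint_iff hd_in_set)

text \<open>In arity 2 the labels form the periodic resolution for the group of order two, with
  \<open>1 + (12)\<close> and \<open>1 - (12)\<close> alternating up to sign; unsorted pairs are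
  traded for sorted ones. \<open>L2_1\<close>, \<open>L2_11\<close> and \<open>L2_111\<close> have
  no twist, so there is no error term. \<open>L2\<close> is the end of the resolution, where
  homology survives.\<close>

lemma sort_htpy2_homotopy:
  assumes "g \<in> valid_words n" "fst g \<in> {L2_1, L2_11}"
  shows "lin NF (lin bd (sort_htpy2 g)) + lin NF (lin sort_htpy2 (wbd g)) = (sgl g :: _ \<Rightarrow>\<^sub>0 'k::comm_ring_1)"
proof -
  obtain l ws where "g = (l, ws)" by fastforce
  moreover obtain u v where "ws = [u, v]"
    using assms calculation by (auto simp: valid_words_def length_Suc_conv eval_nat_numeral)
  ultimately have g: "g = (l, [u, v])" by simp
  have w: "wordy u" "wordy v" and d: "set u \<inter> set v = {}" using assms by (auto simp: valid_words_def g)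
  have NF2: "NF (m, [left_normed a, left_normed b]) = (sgl (m, [a, b]) :: _ \<Rightarrow>\<^sub>0 'k)" if "wordy a" "wordy b" for m a b
  proof -
    have "NF (m, map left_normed [a, b]) = (sgl (m, [a, b]) :: _ \<Rightarrow>\<^sub>0 'k)" by (rule NF_lw) (use that in auto)
    then show ?thesis by simp
  qed
  consider "hd u < hd v" | "hd v < hd u" using hd_neq[OF w d] by linarith
  then show ?thesis
    using assms(2) w by cases (auto simp: g of_words_def bd_simps NF2 sort_htpy2_def)
qed

text \<open>The identity holds exactly for the arity-preserving part, by inspection of the six
  orderings. The error consists of the twists of \<open>L3_12\<close> and \<open>L3_22\<close>,
  which lie at \<open>L2_11\<close>; the twist of \<open>L3_2\<close> lands at \<open>L2_1\<close>,
  where \<open>sort_htpy3\<close> is zero.\<close>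

lemma sort_htpy3_homotopy:
  assumes "g \<in> valid_words n" "fst g \<in> {L3_1, L3_2}"
  shows "(sgl g - lin NF (lin bd (sort_htpy3 g)) - lin NF (lin sort_htpy3 (wbd g)) :: _ \<Rightarrow>\<^sub>0 'k::comm_ring_1) \<in> over {h. fst h = L2_11}"
proof -
  obtain l ws where "g = (l, ws)" by fastforce
  moreover obtain u v w where "ws = [u, v, w]"
    using assms calculation by (auto simp: valid_words_def length_Suc_conv eval_nat_numeral)
  ultimately have g: "g = (l, [u, v, w])" by simp
  have w: "wordy u" "wordy v" "wordy w"
    and ds: "set u \<inter> set v = {}" "set v \<inter> set w = {}" "set u \<inter> set w = {}"
    using assms(1) by (auto simp: valid_words_def g)
  have d: "hd u \<noteq> hd v" "hd v \<noteq> hd w" "hd u \<noteq> hd w"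
    using hd_neq w ds by blast+
  have NF3: "NF (m, [left_normed a, left_normed b, left_normed c]) = (sgl (m, [a, b, c]) :: _ \<Rightarrow>\<^sub>0 'k)" if "wordy a" "wordy b" "wordy c" for m a b c
  proof -
    have "NF (m, map left_normed [a, b, c]) = (sgl (m, [a, b, c]) :: _ \<Rightarrow>\<^sub>0 'k)" by (rule NF_lw) (use that in auto)
    then show ?thesis by simp
  qed
  have low: "lin sort_htpy3 (NF (L2_1, ts)) = (0 :: _ \<Rightarrow>\<^sub>0 'k)" for ts
    by (rule over_lin_eq_0[OF NF_fst]) (auto simp: sort_htpy3_def)
  consider "hd u < hd v" "hd v < hd w" | "hd v < hd u" "hd u < hd w" | "hd u < hd w" "hd w < hd v"
    | "hd w < hd u" "hd u < hd v" | "hd v < hd w" "hd w < hd u" | "hd w < hd v" "hd v < hd u"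
    using d by linarith
  then show ?thesis
    using assms(2) w
    by cases (auto simp: g of_words_def bd_simps NF3 low sort_htpy3_def algebra_simps simp del: lin_lin
      intro!: over_add over_diff over_uminus NF_fst)
qed

lemma hs_over:
  assumes g: "g \<in> wchains n r"
  shows "fst g \<in> {L2_1, L2_11} \<Longrightarrow> (sort_htpy2 g :: _ \<Rightarrow>\<^sub>0 'k::comm_ring_1) \<in> over (lchains n (r + 1))"
    and "fst g \<in> {L3_1, L3_2, L2_11} \<Longrightarrow> (sort_htpy3 g :: _ \<Rightarrow>\<^sub>0 'k::comm_ring_1) \<in> over (lchains n (r + 1))"
proof -
  obtain l ws where gl: "g = (l, ws)" by fastforce
  have v: "(l, map left_normed ws) \<in> valid n" and r: "lab_dgr l = r" and len: "length ws = lab_ar l"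
    using g of_words_valid[of g n] by (auto simp: wchains_def gl of_words_def valid_words_def)
  have perm: "(m, ts) \<in> lchains n s" if "mset ts = mset (map left_normed ws)" "lab_ar m = lab_ar l" "lab_dgr m = s" for m ts s
    using that v len mset_eq_length[OF that(1)]
    by (auto simp: lchains_def intro!: valid_cong[OF v] mset_concat_map)
  show "fst g \<in> {L2_1, L2_11} \<Longrightarrow> (sort_htpy2 g :: _ \<Rightarrow>\<^sub>0 'k) \<in> over (lchains n (r + 1))"
  proof -
    assume l: "fst g \<in> {L2_1, L2_11}"
    then obtain u v where ws: "ws = [u, v]" using len by (auto simp: gl length_Suc_conv eval_nat_numeral)
    show ?thesis
      using l r by (auto simp: sort_htpy2_def gl ws intro!: over_intros perm)
  qed
  show "fst g \<in> {L3_1, L3_2, L2_11} \<Longrightarrow> (sort_htpy3 g :: _ \<Rightarrow>\<^sub>0 'k) \<in> over (lchains n (r + 1))"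
  proof (cases "l = L2_11")
    case False
    assume "fst g \<in> {L3_1, L3_2, L2_11}"
    then have l: "l \<in> {L3_1, L3_2}" using False by (auto simp: gl)
    then obtain u v w where ws: "ws = [u, v, w]" using len by (auto simp: length_Suc_conv eval_nat_numeral)
    show ?thesis
      using l r by (auto simp: sort_htpy3_def gl ws intro!: over_intros perm)
  qed (simp add: gl sort_htpy3_def)
qed

lemma kill2:
  assumes "(\<zeta> :: _ \<Rightarrow>\<^sub>0 'k::comm_ring_1) \<in> over {g \<in> wchains n r. fst g \<in> {L2_1, L2_11}}" "lin wbd \<zeta> = 0"
  obtains y where "y \<in> over (lchains n (r + 1))" "lin NF (lin bd y) = \<zeta>"
proof (rule that[of "lin sort_htpy2 \<zeta>"])
  show "lin sort_htpy2 \<zeta> \<in> over (lchains n (r + 1))"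
    by (rule over_lin[OF assms(1)]) (use hs_over(1) in blast)
  have "lin (\<lambda>g. lin NF (lin bd (sort_htpy2 g)) + lin NF (lin sort_htpy2 (wbd g))) \<zeta> = lin sgl \<zeta>"
    by (rule over_lin_cong[OF assms(1)], rule sort_htpy2_homotopy) (auto simp: wchains_def)
  then have "lin NF (lin bd (lin sort_htpy2 \<zeta>)) + lin NF (lin sort_htpy2 (lin wbd \<zeta>)) = \<zeta>"
    by (simp add: lin_fun_add)
  then show "lin NF (lin bd (lin sort_htpy2 \<zeta>)) = \<zeta>" using assms(2) by simp
qed

text \<open>Only \<open>k = 4\<close> involves two arities. There the part of arity 3 is removed
  first; what remains lies at \<open>L2_11\<close>, is again a cycle because the square of the
  differential vanishes on the labels \<open>L3_11\<close>, \<open>L3_12\<close>,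
  \<open>L3_22\<close>, and is a boundary by the homotopy in arity 2.\<close>

lemma kill_low:
  assumes k: "1 \<le> k" "k \<le> 4"
    and \<zeta>: "(\<zeta> :: _ \<Rightarrow>\<^sub>0 'k::comm_ring_1) \<in> over {g \<in> wchains n (int k - 1). fst g \<noteq> ell k}" and cyc: "lin wbd \<zeta> = 0"
  obtains y where "y \<in> over (lchains n (int k))" "lin NF (lin bd y) = \<zeta>"
proof -
  have dgr: "lab_dgr (fst g) = int k - 1 \<and> fst g \<noteq> ell k" if "g \<in> {g \<in> wchains n (int k - 1). fst g \<noteq> ell k}" for g
    using that by (auto simp: wchains_def)
  consider "k \<le> 2" | "k = 3" | "k = 4" using k by linarith
  then show thesis
  proof cases
    case 1
    have "g \<notin> {g \<in> wchains n (int k - 1). fst g \<noteq> ell k}" for g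
      using dgr[of g] 1 k by (cases "fst g"; cases "k = 1") (auto simp: ell_def)
    then have "Poly_Mapping.keys \<zeta> = {}" using \<zeta> unfolding over_def by blast
    then show ?thesis using that[of 0] by simp
  next
    case 2
    have "fst g \<in> {L2_1, L2_11}" if "g \<in> {g \<in> wchains n (int k - 1). fst g \<noteq> ell k}" for g
      using dgr[OF that] 2 by (cases "fst g") (auto simp: ell_def)
    then have "\<zeta> \<in> over {g \<in> wchains n (int k - 1). fst g \<in> {L2_1, L2_11}}"
      by (intro over_mono[OF \<zeta>]) auto
    then show ?thesis using kill2[OF _ cyc, of n "int k - 1"] that by auto
  next
    case 3
    have lab: "fst g \<in> {L3_1, L3_2, L2_11}" if "g \<in> {g \<in> wchains n (int k - 1). fst g \<noteq> ell k}" for g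
      using dgr[OF that] 3 by (cases "fst g") (auto simp: ell_def)
    define y where "y = lin sort_htpy3 \<zeta>"
    have y: "y \<in> over (lchains n (int k))"
      unfolding y_def by (rule over_lin[OF \<zeta>]) (use hs_over(2)[of _ n "int k - 1"] lab in auto)
    have low: "sgl g - lin NF (lin bd (sort_htpy3 g)) - lin NF (lin sort_htpy3 (wbd g)) \<in> (over {h. fst h = L2_11} :: (_ \<Rightarrow>\<^sub>0 'k) set)"
      if g: "g \<in> {g \<in> wchains n (int k - 1). fst g \<noteq> ell k}" for g
    proof (cases "fst g = L2_11")
      case True
      then obtain u v where gl: "g = (L2_11, [u, v])"
        using g by (cases g) (auto simp: wchains_def valid_words_def length_Suc_conv eval_nat_numeral)
      have "lin sort_htpy3 (NF (L2_1, ts)) = (0 :: _ \<Rightarrow>\<^sub>0 'k)" for ts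
        by (rule over_lin_eq_0[OF NF_fst]) (auto simp: sort_htpy3_def)
      then show ?thesis
        by (auto simp: gl of_words_def bd_simps sort_htpy3_def simp del: lin_lin)
    next
      case False
      then show ?thesis using lab[OF g] g by (intro sort_htpy3_homotopy) (auto simp: wchains_def)
    qed
    have "lin (\<lambda>g. sgl g - lin NF (lin bd (sort_htpy3 g)) - lin NF (lin sort_htpy3 (wbd g))) \<zeta> \<in> over {h. fst h = L2_11}"
      by (rule over_lin[OF \<zeta>]) (rule low)
    moreover have "lin (\<lambda>g. sgl g - lin NF (lin bd (sort_htpy3 g)) - lin NF (lin sort_htpy3 (wbd g))) \<zeta>
        = \<zeta> - lin NF (lin bd y) - lin NF (lin sort_htpy3 (lin wbd \<zeta>))"
      by (simp add: lin_fun_diff y_def)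
    ultimately have "\<zeta> - lin NF (lin bd y) \<in> over {h. fst h = L2_11}" using cyc by simp
    moreover have "\<zeta> - lin NF (lin bd y) \<in> over (wchains n (int k - 1))"
      using over_NF_chains[OF over_bd[OF y]] by (intro over_diff over_mono[OF \<zeta>]) auto
    ultimately have low': "\<zeta> - lin NF (lin bd y) \<in> over {g \<in> wchains n (int k - 1). fst g \<in> {L2_1, L2_11}}"
      by (auto simp: over_def)
    have "lin wbd (lin NF (lin bd y)) = lin NF (lin bd (renorm (lin bd y)))" by simp
    also have "\<dots> = lin NF (lin bd (lin bd y))"
      by (rule NF_bd_renorm[OF over_chains_valid[OF over_bd[OF y]]])
    also have "\<dots> = lin (\<lambda>g. lin NF (lin bd (lin bd (sort_htpy3 g)))) \<zeta>" by (simp add: y_def)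
    also have "\<dots> = 0"
    proof (rule over_lin_eq_0[OF \<zeta>])
      fix g assume g: "g \<in> {g \<in> wchains n (int k - 1). fst g \<noteq> ell k}"
      have "lin NF (lin bd (bd (m, [a, b, c]))) = (0 :: _ \<Rightarrow>\<^sub>0 'k)" if "m \<in> {L3_11, L3_12, L3_22}" for m a b c
        using that by (intro NF_bd_bd) auto
      then show "lin NF (lin bd (lin bd (sort_htpy3 g))) = (0 :: _ \<Rightarrow>\<^sub>0 'k)"
        using lab[OF g] by (auto simp: sort_htpy3_def Let_def simp del: lin_lin)
    qed
    finally have "lin wbd (\<zeta> - lin NF (lin bd y)) = 0" using cyc by (simp del: lin_lin)
    then obtain y' where "y' \<in> over (lchains n (int k))" "lin NF (lin bd y') = \<zeta> - lin NF (lin bd y)"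
      using kill2[OF low'] by auto
    then show ?thesis
      using y by (intro that[of "y + y'"]) (auto intro: over_add simp del: lin_lin)
  qed
qed

theorem chains_exact:
  fixes z :: "lelem \<Rightarrow>\<^sub>0 'k::comm_ring_1"
  assumes r: "r \<le> 3" and nr: "(n, r) \<noteq> (1, 0)" and z: "z \<in> over (lchains n r)" and cyc: "lin NF (lin bd z) = 0"
  obtains y where "y \<in> over (lchains n (r + 1))" "lin NF (z - lin bd y) = 0"
proof (cases "r < 0")
  case True
  have "0 \<le> lab_dgr l" for l by (cases l) auto
  then have "lab_dgr (fst g) \<noteq> r" for g :: lelem
    using True by (metis linorder_not_less)
  then have "lchains n r = {}" by (auto simp: lchains_def)
  then have "z = 0" using z by (simp add: over_def)
  then show thesis using that[of 0] by simp
next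
  case False
  \<comment> \<open>\<open>ell k\<close> is the label of largest arity in degree \<open>r\<close>,
    since its degree is \<open>k - 1\<close>.\<close>
  define k where "k = nat (r + 1)"
  have k: "1 \<le> k" "k \<le> 4" and rk: "r = int k - 1" using False r by (auto simp: k_def)
  obtain y1 where y1: "y1 \<in> over (lchains n (int k))" "lin NF (lin bd (lin bd y1)) = 0"
      "lin NF (z - lin bd y1) \<in> over (sorted_top n k)"
    using sort_top[OF k z[unfolded rk]] by blast
  let ?z = "z - lin bd y1"
  have "?z \<in> over (valid n)"
    using over_bd[OF y1(1)] z rk by (intro over_diff over_chains_valid) auto
  from NF_bd_renorm[OF this] have "lin wbd (lin NF ?z) = lin NF (lin bd ?z)" by simp
  also have "\<dots> = 0" using cyc y1(2) by (simp del: lin_lin)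
  finally have cyc1: "lin wbd (lin NF ?z) = 0" .
  obtain y2 where y2: "y2 \<in> over (lchains n (int k))"
      "lin NF ?z - lin NF (lin bd y2) \<in> over {g \<in> wchains n (int k - 1). fst g \<noteq> ell k}"
      "lin wbd (lin NF ?z - lin NF (lin bd y2)) = 0"
    using kill_top[OF k nr[unfolded rk] y1(3) cyc1] by blast
  obtain y3 where y3: "y3 \<in> over (lchains n (int k))" "lin NF (lin bd y3) = lin NF ?z - lin NF (lin bd y2)"
    using kill_low[OF k y2(2,3)] by blast
  show thesis
    by (rule that[of "y1 + y2 + y3"]) (use y1(1) y2(1) y3 rk in \<open>auto intro!: over_add simp del: lin_lin\<close>)
qed

section \<open>Block permutations\<close>

lemma off_Suc: "off ns (Suc i) = sum_list (take i ns)"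
  by (simp add: off_def)

lemma blk_block:
  "i < length ns \<Longrightarrow> 1 \<le> k \<Longrightarrow> k \<le> ns ! i \<Longrightarrow> blk ns (sum_list (take i ns) + k) = Suc i"
proof (induction ns arbitrary: i)
  case (Cons n ns)
  then show ?case by (cases i) auto
qed simp

lemma block_le:
  "i < length ns \<Longrightarrow> k \<le> ns ! i \<Longrightarrow> sum_list (take i ns) + k \<le> sum_list (ns :: nat list)"
proof (induction ns arbitrary: i)
  case (Cons n ns)
  then show ?case by (cases i) auto
qed simp

lemma block_cases:
  assumes "1 \<le> x" "x \<le> sum_list (ns :: nat list)"
  obtains i k where "i < length ns" "1 \<le> k" "k \<le> ns ! i" "x = sum_list (take i ns) + k"
proof -
  have "\<exists>i k. i < length ns \<and> 1 \<le> k \<and> k \<le> ns ! i \<and> x = sum_list (take i ns) + k"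
    using assms
  proof (induction ns arbitrary: x)
    case (Cons n ns)
    show ?case
    proof (cases "x \<le> n")
      case True
      then show ?thesis using Cons.prems by (intro exI[of _ 0] exI[of _ x]) auto
    next
      case False
      then have "1 \<le> x - n" "x - n \<le> sum_list ns" using Cons.prems by auto
      then obtain i k where "i < length ns" "1 \<le> k" "k \<le> ns ! i" "x - n = sum_list (take i ns) + k"
        using Cons.IH by blast
      then show ?thesis using False by (intro exI[of _ "Suc i"] exI[of _ k]) auto
    qed
  qed simp
  then show thesis using that by blast
qed

lemma block_sum_block:
  assumes "i < length ns" "1 \<le> k" "k \<le> ns ! i"
  shows "block_sum ns \<tau>s (sum_list (take i ns) + k) = sum_list (take i ns) + (\<tau>s ! i) k"
  using assms block_le[OF assms(1,3)] by (simp add: block_sum_def blk_block Let_def off_Suc)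

lemma permutes_block:
  assumes "\<And>i. i < length ns \<Longrightarrow> \<tau>s ! i permutes {1..ns ! i}" "i < length ns" "1 \<le> k" "k \<le> ns ! i"
  shows "1 \<le> (\<tau>s ! i) k" "(\<tau>s ! i) k \<le> ns ! i"
  using permutes_in_image[OF assms(1)[OF assms(2)], of k] assms(3,4) by auto

lemma block_sum_permutes:
  assumes \<tau>s: "length \<tau>s = length ns" "\<And>i. i < length ns \<Longrightarrow> \<tau>s ! i permutes {1..ns ! i}"
  shows "block_sum ns \<tau>s permutes {1..sum_list ns}"
    and "i < length ns \<Longrightarrow> 1 \<le> k \<Longrightarrow> k \<le> ns ! i \<Longrightarrow>
      inv (block_sum ns \<tau>s) (sum_list (take i ns) + k) = sum_list (take i ns) + inv (\<tau>s ! i) k"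
proof -
  have inv\<tau>: "map inv \<tau>s ! i permutes {1..ns ! i}" if "i < length ns" for i
    using permutes_inv[OF \<tau>s(2)[OF that]] that \<tau>s(1) by simp
  have out: "block_sum ns \<rho>s x = x" if "x \<notin> {1..sum_list ns}" for \<rho>s x
    using that by (simp only: block_sum_def if_False)
  have 1: "block_sum ns (map inv \<tau>s) (block_sum ns \<tau>s x) = x" for x
  proof (cases "x \<in> {1..sum_list ns}")
    case True
    then obtain i k where i: "i < length ns" "1 \<le> k" "k \<le> ns ! i" and x: "x = sum_list (take i ns) + k"
      using block_cases[of x ns] by auto
    show ?thesis
      using permutes_block[of ns \<tau>s, OF \<tau>s(2) i] i \<tau>s(1) permutes_inverses(2)[OF \<tau>s(2)[OF i(1)]]
      by (simp add: x block_sum_block)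
  qed (simp add: out del: atLeastAtMost_iff)
  have 2: "block_sum ns \<tau>s (block_sum ns (map inv \<tau>s) x) = x" for x
  proof (cases "x \<in> {1..sum_list ns}")
    case True
    then obtain i k where i: "i < length ns" "1 \<le> k" "k \<le> ns ! i" and x: "x = sum_list (take i ns) + k"
      using block_cases[of x ns] by auto
    show ?thesis
      using permutes_block[of ns "map inv \<tau>s", OF inv\<tau> i] i \<tau>s(1) permutes_inverses(1)[OF \<tau>s(2)[OF i(1)]]
      by (simp add: x block_sum_block)
  qed (simp add: out del: atLeastAtMost_iff)
  have "bij (block_sum ns \<tau>s)"
    by (rule o_bij[of "block_sum ns (map inv \<tau>s)"]) (auto simp: fun_eq_iff 1 2)
  then show "block_sum ns \<tau>s permutes {1..sum_list ns}"
    using out by (auto simp: permutes_def bij_iff)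
  have "inv (block_sum ns \<tau>s) = block_sum ns (map inv \<tau>s)"
    by (rule inv_unique_comp) (auto simp: fun_eq_iff 1 2)
  then show "i < length ns \<Longrightarrow> 1 \<le> k \<Longrightarrow> k \<le> ns ! i \<Longrightarrow>
      inv (block_sum ns \<tau>s) (sum_list (take i ns) + k) = sum_list (take i ns) + inv (\<tau>s ! i) k"
    using \<tau>s(1) by (simp add: block_sum_block)
qed

lemma nth_perm_list: "i < length xs \<Longrightarrow> perm_list \<tau> xs ! i = xs ! (inv \<tau> (Suc i) - 1)"
  by (simp add: perm_list_eq del: upt_Suc)

lemma nth_perm_list':
  assumes "\<tau> permutes {1..length xs}" "i < length xs"
  shows "perm_list \<tau> xs ! (\<tau> (Suc i) - 1) = xs ! i" "\<tau> (Suc i) - 1 < length xs" "Suc (\<tau> (Suc i) - 1) = \<tau> (Suc i)"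
proof -
  have "\<tau> (Suc i) \<in> {1..length xs}" using permutes_in_image[OF assms(1), of "Suc i"] assms(2) by auto
  then show "\<tau> (Suc i) - 1 < length xs" "Suc (\<tau> (Suc i) - 1) = \<tau> (Suc i)" by auto
  then show "perm_list \<tau> xs ! (\<tau> (Suc i) - 1) = xs ! i"
    using permutes_inverses(2)[OF assms(1)] by (simp add: nth_perm_list)
qed

lemma perm_list_map: "perm_list \<tau> (map f xs) = map f (perm_list \<tau> xs)" if "\<tau> permutes {1..length xs}"
proof (rule nth_equalityI)
  fix i assume "i < length (perm_list \<tau> (map f xs))"
  then have i: "i < length xs" by simp
  then have "inv \<tau> (Suc i) \<in> {1..length xs}"
    using permutes_in_image[OF permutes_inv[OF that], of "Suc i"] by auto
  then have "inv \<tau> (Suc i) - 1 < length xs" by auto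
  then show "perm_list \<tau> (map f xs) ! i = map f (perm_list \<tau> xs) ! i"
    using i by (simp add: nth_perm_list)
qed simp

lemma perm_list_perm_list:
  assumes "\<sigma> permutes {1..length xs}" "\<tau> permutes {1..length xs}"
  shows "perm_list \<sigma> (perm_list \<tau> xs) = perm_list (\<sigma> \<circ> \<tau>) xs"
proof (rule nth_equalityI)
  fix i assume "i < length (perm_list \<sigma> (perm_list \<tau> xs))"
  then have i: "i < length xs" by simp
  then have j: "inv \<sigma> (Suc i) \<in> {1..length xs}"
    using permutes_in_image[OF permutes_inv[OF assms(1)], of "Suc i"] by auto
  then have "inv \<sigma> (Suc i) - 1 < length xs" "Suc (inv \<sigma> (Suc i) - 1) = inv \<sigma> (Suc i)" by auto
  moreover have "inv (\<sigma> \<circ> \<tau>) = inv \<tau> \<circ> inv \<sigma>"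
    using assms by (intro o_inv_distrib) (auto intro: permutes_bij)
  ultimately show "perm_list \<sigma> (perm_list \<tau> xs) ! i = perm_list (\<sigma> \<circ> \<tau>) xs ! i"
    using i by (simp add: nth_perm_list)
qed simp

text \<open>The blocks sent to the left of block \<open>i\<close> are the first
  \<open>\<tau> (Suc i) - 1\<close> ones in the permuted list of sizes; lists count from 0 and
  permutations from 1.\<close>

lemma block_perm_block:
  assumes \<tau>: "\<tau> permutes {1..length ns}" and i: "i < length ns" "1 \<le> k" "k \<le> ns ! i"
  shows "block_perm \<tau> ns (sum_list (take i ns) + k) = sum_list (take (\<tau> (Suc i) - 1) (perm_list \<tau> ns)) + k"
proof -
  let ?q = "\<tau> (Suc i) - 1" and ?S = "{j \<in> {1..length ns}. \<tau> j < \<tau> (Suc i)}"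
  note q = nth_perm_list'(2,3)[OF \<tau> i(1)]
  have "sum_list (take ?q (perm_list \<tau> ns)) = (\<Sum>j<?q. perm_list \<tau> ns ! j)"
    using q by (subst sum_list_sum_nth) (simp add: atLeast0LessThan min_def)
  also have "\<dots> = (\<Sum>j<?q. ns ! (inv \<tau> (Suc j) - 1))"
    using q by (intro sum.cong) (auto simp: nth_perm_list)
  also have "\<dots> = (\<Sum>j\<in>?S. ns ! (j - 1))"
  proof (rule sum.reindex_bij_witness[of _ "\<lambda>j. \<tau> j - 1" "\<lambda>j. inv \<tau> (Suc j)"])
    fix j assume "j \<in> {..<?q}"
    then have j: "j < ?q" by simp
    show "\<tau> (inv \<tau> (Suc j)) - 1 = j" using permutes_inverses(1)[OF \<tau>] by simp
    have "inv \<tau> (Suc j) \<in> {1..length ns}"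
      using permutes_in_image[OF permutes_inv[OF \<tau>], of "Suc j"] j q by auto
    then show "inv \<tau> (Suc j) \<in> ?S" using j q permutes_inverses(1)[OF \<tau>] by auto
  next
    fix j assume j: "j \<in> ?S"
    then have "\<tau> j \<in> {1..length ns}" using permutes_in_image[OF \<tau>, of j] by auto
    then have "Suc (\<tau> j - 1) = \<tau> j" by auto
    then show "inv \<tau> (Suc (\<tau> j - 1)) = j" using permutes_inverses(2)[OF \<tau>] by simp
    show "\<tau> j - 1 \<in> {..<?q}" using j \<open>Suc (\<tau> j - 1) = \<tau> j\<close> q by auto
  qed auto
  finally show ?thesis
    using i block_le[OF i(1,3)] by (simp add: block_perm_def blk_block Let_def off_Suc)
qed

lemma sum_list_perm_list: "\<tau> permutes {1..length ns} \<Longrightarrow> sum_list (perm_list \<tau> ns) = sum_list (ns :: nat list)"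
  using mset_perm_list[of \<tau> ns] by (metis sum_mset_sum_list)

lemma block_perm_permutes:
  assumes \<tau>: "\<tau> permutes {1..length ns}"
  shows "block_perm \<tau> ns permutes {1..sum_list ns}"
    and "i < length ns \<Longrightarrow> 1 \<le> k \<Longrightarrow> k \<le> ns ! i \<Longrightarrow>
      inv (block_perm \<tau> ns) (sum_list (take (\<tau> (Suc i) - 1) (perm_list \<tau> ns)) + k) = sum_list (take i ns) + k"
proof -
  let ?A = "{1..sum_list ns}" and ?f = "block_perm \<tau> ns"
  have "?A \<subseteq> ?f ` ?A"
  proof
    fix x assume "x \<in> ?A"
    then obtain j k where j: "j < length ns" "1 \<le> k" "k \<le> perm_list \<tau> ns ! j" and x: "x = sum_list (take j (perm_list \<tau> ns)) + k"
      using block_cases[of x "perm_list \<tau> ns"] sum_list_perm_list[OF \<tau>] by auto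
    define i where "i = inv \<tau> (Suc j) - 1"
    have "inv \<tau> (Suc j) \<in> {1..length ns}"
      using permutes_in_image[OF permutes_inv[OF \<tau>], of "Suc j"] j by auto
    then have i: "i < length ns" "\<tau> (Suc i) = Suc j" using permutes_inverses(1)[OF \<tau>] by (auto simp: i_def)
    have k: "k \<le> ns ! i" using j by (simp add: nth_perm_list i_def)
    have "x = ?f (sum_list (take i ns) + k)"
      using block_perm_block[OF \<tau> i(1) j(2) k] i(2) by (simp add: x)
    moreover have "sum_list (take i ns) + k \<in> ?A" using block_le[OF i(1) k] j(2) by simp
    ultimately show "x \<in> ?f ` ?A" by blast
  qed
  moreover have "finite ?A" by simp
  ultimately have "inj_on ?f ?A \<and> ?f ` ?A = ?A"
    by (metis card_image_le card_seteq eq_card_imp_inj_on finite_imageI le_antisym card_mono)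
  then have "bij_betw ?f ?A ?A" by (simp add: bij_betw_def)
  then show p: "?f permutes ?A"
    by (rule bij_imp_permutes) (simp only: block_perm_def if_False)
  show "i < length ns \<Longrightarrow> 1 \<le> k \<Longrightarrow> k \<le> ns ! i \<Longrightarrow>
      inv (block_perm \<tau> ns) (sum_list (take (\<tau> (Suc i) - 1) (perm_list \<tau> ns)) + k) = sum_list (take i ns) + k"
    using permutes_inverses(2)[OF p] block_perm_block[OF \<tau>] by metis
qed

section \<open>Comparison with the presented complex\<close>

abbreviation rename :: "(nat \<Rightarrow> nat) \<Rightarrow> lie_mono \<Rightarrow> lie_mono" where
  "rename f \<equiv> mono_subst (\<lambda>k. Leaf (f k))"

lemma leaves_rename [simp]: "leaves (rename f t) = map f (leaves t)"
  by (induction t) auto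

lemma rename_rename: "rename f (rename g t) = rename (\<lambda>k. f (g k)) t"
  by (induction t) auto

lemma rename_cong: "(\<And>k. k \<in> set (leaves t) \<Longrightarrow> f k = g k) \<Longrightarrow> rename f t = rename g t"
  by (induction t) auto

lemma rename_id: "(\<And>k. k \<in> set (leaves t) \<Longrightarrow> f k = k) \<Longrightarrow> rename f t = t"
  by (induction t) auto

lemma rename_lie_ideal: "x \<in> lie_ideal \<Longrightarrow> lin (\<lambda>t. sgl (rename f t)) x \<in> lie_ideal"
proof (induction rule: lie_ideal.induct)
  case (left x t)
  have "lin (\<lambda>s. sgl (Br s (rename f t))) (lin (\<lambda>t. sgl (rename f t)) x) \<in> lie_ideal"
    by (rule lie_ideal.left[OF left.IH])
  then show ?case by simp
next
  case (right x s)
  have "lin (\<lambda>t. sgl (Br (rename f s) t)) (lin (\<lambda>t. sgl (rename f t)) x) \<in> lie_ideal"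
    by (rule lie_ideal.right[OF right.IH])
  then show ?case by simp
qed (auto intro: lie_ideal.antisym lie_ideal.jacobi)

abbreviation arity :: "lie_mono \<Rightarrow> nat" where
  "arity t \<equiv> length (leaves t)"

text \<open>Leaf \<open>k\<close> of an entry is the place \<open>k\<close> of its block in the
  juxtaposition of all entries; the right action of \<open>\<sigma>\<close> renames places by the
  inverse, as in \<open>lie_act\<close>.\<close>

definition relab :: "lie_mono list \<Rightarrow> (nat \<Rightarrow> nat) \<Rightarrow> lie_mono list" where
  "relab \<nu>s \<sigma> = map (\<lambda>i. rename (\<lambda>k. inv \<sigma> (sum_list (take i (map arity \<nu>s)) + k)) (\<nu>s ! i)) [0..<length \<nu>s]"

lemma length_relab [simp]: "length (relab \<nu>s \<sigma>) = length \<nu>s"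
  by (simp add: relab_def)

lemma nth_relab: "i < length \<nu>s \<Longrightarrow>
    relab \<nu>s \<sigma> ! i = rename (\<lambda>k. inv \<sigma> (sum_list (take i (map arity \<nu>s)) + k)) (\<nu>s ! i)"
  by (simp add: relab_def)

type_synonym gelem = "(lie3_gen, lie_mono) elem"

text \<open>The permutation of the label is moved onto the entries by the tensor product over the
  symmetric group; since Lie sits in degree 0, no Koszul sign appears.\<close>

definition to_list :: "gelem \<Rightarrow> lelem" where
  "to_list = (\<lambda>((l, \<tau>), \<nu>s, \<sigma>). (l, perm_list \<tau> (relab \<nu>s \<sigma>)))"

abbreviation C3 :: "(lie3_gen, 'k::comm_ring_1) dg_cooperad" where
  "C3 \<equiv> lie_diamond3"

abbreviation Lie :: "(lie_mono, 'k::comm_ring_1) dg_operad" where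
  "Lie \<equiv> lie"

definition ggens :: "gelem set" where
  "ggens = {((l, \<tau>), \<nu>s, \<sigma>). \<tau> permutes {1..lab_ar l} \<and> set \<nu>s \<subseteq> lie_gens \<and> length \<nu>s = lab_ar l
     \<and> \<sigma> permutes {1..sum_list (map arity \<nu>s)}}"

lemma composite_gens_eq: "composite_gens C3 Lie = ggens"
  by (auto simp: composite_gens_def ggens_def lie_diamond3_def lie_def)

lemma lie_gens_leaves: "t \<in> lie_gens \<Longrightarrow> k \<in> set (leaves t) \<longleftrightarrow> 1 \<le> k \<and> k \<le> arity t"
proof -
  assume "t \<in> lie_gens"
  then have "set (leaves t) = {1..arity t}" by (simp only: lie_gens_def mem_Collect_eq)
  then show ?thesis by (simp only: atLeastAtMost_iff)
qed

lemma lie_gens_mset: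
  assumes "t \<in> lie_gens"
  shows "mset (leaves t) = mset [1..<Suc (arity t)]"
proof (rule set_eq_iff_mset_eq_distinct[THEN iffD1])
  show "distinct (leaves t)" "set (leaves t) = set [1..<Suc (arity t)]"
    using assms unfolding lie_gens_def mem_Collect_eq set_upt by (simp_all only: atLeastLessThanSuc_atLeastAtMost)
qed simp

lemma mset_blocks:
  "set \<nu>s \<subseteq> lie_gens \<Longrightarrow>
    mset (concat (map (\<lambda>i. map (\<lambda>k. sum_list (take i (map arity \<nu>s)) + k) (leaves (\<nu>s ! i))) [0..<length \<nu>s]))
      = mset [1..<Suc (sum_list (map arity \<nu>s))]"
proof (induction \<nu>s rule: rev_induct)
  case (snoc \<nu> \<nu>s)
  let ?s = "sum_list (map arity \<nu>s)"
  have "mset (map (\<lambda>k. ?s + k) (leaves \<nu>)) = mset (map (\<lambda>k. ?s + k) [1..<Suc (arity \<nu>)])"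
    using snoc.prems lie_gens_mset[of \<nu>] by (simp only: mset_map) simp
  also have "map (\<lambda>k. ?s + k) [1..<Suc (arity \<nu>)] = [Suc ?s..<Suc (?s + arity \<nu>)]"
    by (rule nth_equalityI) (simp_all del: upt_Suc)
  finally have *: "mset (map (\<lambda>k. ?s + k) (leaves \<nu>)) = mset [Suc ?s..<Suc (?s + arity \<nu>)]" .
  have A: "[1..<Suc (?s + arity \<nu>)] = [1..<Suc ?s] @ [Suc ?s..<Suc (?s + arity \<nu>)]"
    using upt_add_eq_append[of 1 "Suc ?s" "arity \<nu>"] by simp
  have E: "map (\<lambda>i. map (\<lambda>k. sum_list (take i (map arity (\<nu>s @ [\<nu>]))) + k) (leaves ((\<nu>s @ [\<nu>]) ! i))) [0..<length \<nu>s]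
      = map (\<lambda>i. map (\<lambda>k. sum_list (take i (map arity \<nu>s)) + k) (leaves (\<nu>s ! i))) [0..<length \<nu>s]"
    by (rule map_cong) (auto simp: nth_append)
  have U: "[0..<length (\<nu>s @ [\<nu>])] = [0..<length \<nu>s] @ [length \<nu>s]" by simp
  have "concat (map (\<lambda>i. map (\<lambda>k. sum_list (take i (map arity (\<nu>s @ [\<nu>]))) + k) (leaves ((\<nu>s @ [\<nu>]) ! i))) [0..<length (\<nu>s @ [\<nu>])])
      = concat (map (\<lambda>i. map (\<lambda>k. sum_list (take i (map arity \<nu>s)) + k) (leaves (\<nu>s ! i))) [0..<length \<nu>s]) @ map (\<lambda>k. ?s + k) (leaves \<nu>)"
    unfolding U map_append[of _ "[0..<length \<nu>s]"] concat_append E by simp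
  then show ?case
    using snoc * A by (simp only: mset_append) simp
qed simp

lemma to_list_valid:
  assumes "((l, \<tau>), \<nu>s, \<sigma>) \<in> ggens"
  shows "to_list ((l, \<tau>), \<nu>s, \<sigma>) \<in> valid (sum_list (map arity \<nu>s))"
proof -
  let ?n = "sum_list (map arity \<nu>s)"
  let ?B = "concat (map (\<lambda>i. map (\<lambda>k. sum_list (take i (map arity \<nu>s)) + k) (leaves (\<nu>s ! i))) [0..<length \<nu>s])"
  have g: "\<tau> permutes {1..lab_ar l}" "set \<nu>s \<subseteq> lie_gens" "length \<nu>s = lab_ar l" "\<sigma> permutes {1..?n}"
    using assms by (auto simp: ggens_def)
  have B: "mset ?B = mset [1..<Suc ?n]" by (rule mset_blocks[OF g(2)])
  have eq: "concat (map leaves (relab \<nu>s \<sigma>)) = map (inv \<sigma>) ?B"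
    by (simp add: relab_def map_concat comp_def)
  have "distinct (concat (map leaves (relab \<nu>s \<sigma>)))"
  proof -
    have "distinct ?B" using mset_eq_imp_distinct_iff[OF B] by (simp only: distinct_upt)
    moreover have "inj_on (inv \<sigma>) (set ?B)"
      using permutes_inj[OF permutes_inv[OF g(4)]] by (rule inj_on_subset) simp
    ultimately show ?thesis unfolding eq distinct_map by blast
  qed
  moreover have "set (concat (map leaves (relab \<nu>s \<sigma>))) = {1..?n}"
    unfolding eq set_map mset_eq_setD[OF B] set_upt atLeastLessThanSuc_atLeastAtMost
    by (rule permutes_image[OF permutes_inv[OF g(4)]])
  ultimately have "(l, relab \<nu>s \<sigma>) \<in> valid ?n"
    using g by (simp add: valid_def)
  then show ?thesis
    using valid_perm_list[OF _ g(1) refl] by (simp add: to_list_def)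
qed

text \<open>The induction relators are invisible on lists, as \<open>block_sum\<close> acts inside
  each block the way the entries are acted upon.\<close>

lemma relab_block_sum:
  assumes "set \<nu>s \<subseteq> lie_gens" "length \<tau>s = length \<nu>s" "\<And>i. i < length \<nu>s \<Longrightarrow> \<tau>s ! i permutes {1..arity (\<nu>s ! i)}"
    "\<sigma> permutes {1..sum_list (map arity \<nu>s)}"
  shows "relab (map2 lie_act \<nu>s \<tau>s) \<sigma> = relab \<nu>s (block_sum (map arity \<nu>s) \<tau>s \<circ> \<sigma>)"
proof (rule nth_equalityI)
  fix i assume "i < length (relab (map2 lie_act \<nu>s \<tau>s) \<sigma>)"
  then have i: "i < length \<nu>s" using assms(2) by simp
  let ?ns = "map arity \<nu>s"
  have \<tau>s: "\<tau>s ! i permutes {1..?ns ! i}" if "i < length ?ns" for i using assms(3) that by simp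
  have bp: "block_sum ?ns \<tau>s permutes {1..sum_list ?ns}"
    using block_sum_permutes(1)[of \<tau>s ?ns] assms(2) \<tau>s by simp
  have inv: "inv (block_sum ?ns \<tau>s \<circ> \<sigma>) = inv \<sigma> \<circ> inv (block_sum ?ns \<tau>s)"
    using bp assms(4) by (intro o_inv_distrib) (auto intro: permutes_bij)
  have ar: "map arity (map2 lie_act \<nu>s \<tau>s) = ?ns"
    using assms(2) by (intro nth_equalityI) (auto simp: lie_act_def)
  have "rename (\<lambda>k. inv \<sigma> (sum_list (take i ?ns) + inv (\<tau>s ! i) k)) (\<nu>s ! i)
      = rename (\<lambda>k. inv (block_sum ?ns \<tau>s \<circ> \<sigma>) (sum_list (take i ?ns) + k)) (\<nu>s ! i)"
  proof (rule rename_cong)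
    fix k assume "k \<in> set (leaves (\<nu>s ! i))"
    moreover have "\<nu>s ! i \<in> lie_gens" using assms(1) i by auto
    ultimately have "1 \<le> k" "k \<le> ?ns ! i" using i lie_gens_leaves[of "\<nu>s ! i" k] by simp_all
    then show "inv \<sigma> (sum_list (take i ?ns) + inv (\<tau>s ! i) k) = inv (block_sum ?ns \<tau>s \<circ> \<sigma>) (sum_list (take i ?ns) + k)"
      using block_sum_permutes(2)[of \<tau>s ?ns i k] assms(2) \<tau>s i by (simp add: inv)
  qed
  then show "relab (map2 lie_act \<nu>s \<tau>s) \<sigma> ! i = relab \<nu>s (block_sum ?ns \<tau>s \<circ> \<sigma>) ! i"
    using i assms(2) unfolding nth_relab[of i \<nu>s, OF i] by (subst nth_relab) (auto simp: ar lie_act_def rename_rename simp del: map_map)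
qed (use assms(2) in simp)

text \<open>Moving whole blocks merely permutes the list of relabelled entries, which accounts for
  the relators of the tensor product over the symmetric group.\<close>

lemma relab_block_perm:
  assumes "set \<nu>s \<subseteq> lie_gens" "\<tau> permutes {1..length \<nu>s}" "\<sigma> permutes {1..sum_list (map arity \<nu>s)}"
  shows "relab (perm_list \<tau> \<nu>s) (block_perm \<tau> (map arity \<nu>s) \<circ> \<sigma>) = perm_list \<tau> (relab \<nu>s \<sigma>)"
proof (rule nth_equalityI)
  fix j assume "j < length (relab (perm_list \<tau> \<nu>s) (block_perm \<tau> (map arity \<nu>s) \<circ> \<sigma>))"
  then have j: "j < length \<nu>s" by simp
  let ?ns = "map arity \<nu>s"
  define i where "i = inv \<tau> (Suc j) - 1"
  have "inv \<tau> (Suc j) \<in> {1..length \<nu>s}"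
    using permutes_in_image[OF permutes_inv[OF assms(2)], of "Suc j"] j by auto
  then have i: "i < length \<nu>s" "\<tau> (Suc i) = Suc j" using permutes_inverses(1)[OF assms(2)] by (auto simp: i_def)
  have \<tau>: "\<tau> permutes {1..length ?ns}" using assms(2) by simp
  have inv: "inv (block_perm \<tau> ?ns \<circ> \<sigma>) = inv \<sigma> \<circ> inv (block_perm \<tau> ?ns)"
    using block_perm_permutes(1)[OF \<tau>] assms(3) by (intro o_inv_distrib) (auto intro: permutes_bij)
  have pj: "perm_list \<tau> \<nu>s ! j = \<nu>s ! i" "perm_list \<tau> (relab \<nu>s \<sigma>) ! j = relab \<nu>s \<sigma> ! i"
    using j by (simp_all add: nth_perm_list i_def)
  have "rename (\<lambda>k. inv (block_perm \<tau> ?ns \<circ> \<sigma>) (sum_list (take j (perm_list \<tau> ?ns)) + k)) (\<nu>s ! i)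
      = rename (\<lambda>k. inv \<sigma> (sum_list (take i ?ns) + k)) (\<nu>s ! i)"
  proof (rule rename_cong)
    fix k assume "k \<in> set (leaves (\<nu>s ! i))"
    moreover have "\<nu>s ! i \<in> lie_gens" using assms(1) i by auto
    ultimately have "1 \<le> k" "k \<le> ?ns ! i" using i lie_gens_leaves[of "\<nu>s ! i" k] by simp_all
    then show "inv (block_perm \<tau> ?ns \<circ> \<sigma>) (sum_list (take j (perm_list \<tau> ?ns)) + k) = inv \<sigma> (sum_list (take i ?ns) + k)"
      using block_perm_permutes(2)[OF \<tau>, of i k] i by (simp add: inv)
  qed
  then show "relab (perm_list \<tau> \<nu>s) (block_perm \<tau> ?ns \<circ> \<sigma>) ! j = perm_list \<tau> (relab \<nu>s \<sigma>) ! j"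
    using i j by (simp add: nth_relab pj perm_list_map[OF assms(2), symmetric] del: map_map)
qed simp

section \<open>The relators vanish in normal form\<close>

abbreviation crels :: "(gelem \<Rightarrow>\<^sub>0 'k::comm_ring_1) set" where
  "crels \<equiv> composite_rels C3 Lie"

abbreviation tl_lin :: "(gelem \<Rightarrow>\<^sub>0 'k::comm_ring_1) \<Rightarrow> (lelem \<Rightarrow>\<^sub>0 'k)" where
  "tl_lin \<equiv> lin (\<lambda>g. sgl (to_list g))"

lemma lie_sel [simp]:
  "ar lie = arity" "act lie = lie_act" "dgr lie = (\<lambda>t. 0)" "diff lie = (\<lambda>t. 0)" "gens lie = lie_gens"
  "gam lie = (\<lambda>p qs. sgl (lie_graft p qs))"
  "rels lie = {x \<in> lie_ideal. Poly_Mapping.keys x \<subseteq> lie_gens}"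
  by (simp_all add: lie_def)

lemma lie_diamond3_sel [simp]:
  "rels lie_diamond3 = {}" "act lie_diamond3 = (\<lambda>(l, \<sigma>) \<tau>. (l, \<sigma> \<circ> \<tau>))" "dgr lie_diamond3 = (\<lambda>(l, \<sigma>). lab_dgr l)"
  "ar lie_diamond3 = (\<lambda>(l, \<sigma>). lab_ar l)" "counit lie_diamond3 = (\<lambda>(l, \<sigma>). if l = L1 then 1 else 0)"
  "diff lie_diamond3 = (\<lambda>(l, \<sigma>). lin (\<lambda>(m, \<tau>). sgl (m, \<tau> \<circ> \<sigma>)) (lab_diff l))"
  "dec lie_diamond3 = (\<lambda>(l, \<sigma>). lin (\<lambda>(m, ls, \<tau>). sgl (m, ls, \<tau> \<circ> \<sigma>)) (lab_dec l))"
  by (simp_all add: lie_diamond3_def)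

lemma koszul_zero [simp]: "koszul \<tau> (map (\<lambda>t. 0) xs) = (1 :: 'k::comm_ring_1)"
proof -
  have "(\<Sum>(i, j)\<in>{(i, j). 1 \<le> i \<and> i < j \<and> j \<le> length (map (\<lambda>t. 0 :: int) xs) \<and> \<tau> j < \<tau> i}.
      map (\<lambda>t. 0) xs ! (i - 1) * map (\<lambda>t. 0) xs ! (j - 1)) = (0 :: int)"
    by (rule sum.neutral) auto
  then show ?thesis by (simp only: koszul_def ksign_def) simp
qed

text \<open>Labels have no relators, so one of the four families contributes nothing, and every
  Koszul sign is 1.\<close>

lemma crels_eq: "(crels :: (_ \<Rightarrow>\<^sub>0 'k::comm_ring_1) set) =
     {lin (\<lambda>\<nu>. sgl (\<mu>, \<nu>s[i := \<nu>], \<sigma>)) x | x \<mu> \<nu>s i \<sigma>.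
        x \<in> {x \<in> lie_ideal. Poly_Mapping.keys x \<subseteq> lie_gens} \<and> i < length \<nu>s
        \<and> (\<forall>\<nu> \<in> Poly_Mapping.keys x. (\<mu>, \<nu>s[i := \<nu>], \<sigma>) \<in> ggens)}
   \<union> {sgl (\<mu>, map2 lie_act \<nu>s \<tau>s, \<sigma>) - sgl (\<mu>, \<nu>s, block_sum (map arity \<nu>s) \<tau>s \<circ> \<sigma>) | \<mu> \<nu>s \<tau>s \<sigma>.
        (\<mu>, \<nu>s, \<sigma>) \<in> ggens \<and> length \<tau>s = length \<nu>s \<and> (\<forall>i < length \<nu>s. \<tau>s ! i permutes {1..arity (\<nu>s ! i)})}
   \<union> {sgl ((case \<mu> of (l, \<sigma>) \<Rightarrow> \<lambda>\<tau>. (l, \<sigma> \<circ> \<tau>)) \<tau>, \<nu>s, \<sigma>)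
        - sgl (\<mu>, perm_list \<tau> \<nu>s, block_perm \<tau> (map arity \<nu>s) \<circ> \<sigma>) | \<mu> \<nu>s \<tau> \<sigma>.
        (\<mu>, \<nu>s, \<sigma>) \<in> ggens \<and> \<tau> permutes {1..length \<nu>s}}"
  unfolding composite_rels_def composite_gens_eq lie_sel lie_diamond3_sel koszul_zero by simp

lemma relab_update:
  assumes "i < length \<nu>s" "arity \<nu> = arity (\<nu>s ! i)"
  shows "relab (\<nu>s[i := \<nu>]) \<sigma> = (relab \<nu>s \<sigma>)[i := rename (\<lambda>k. inv \<sigma> (sum_list (take i (map arity \<nu>s)) + k)) \<nu>]"
proof -
  have "map arity (\<nu>s[i := \<nu>]) = map arity \<nu>s"
    using assms by (simp add: map_update) (metis list_update_id length_map nth_map)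
  then show ?thesis
    using assms by (intro nth_equalityI) (auto simp: nth_relab nth_list_update)
qed

lemma to_list_update:
  assumes "((l, \<tau>), \<nu>s, \<sigma>) \<in> ggens" "i < length \<nu>s"
  obtains us vs where "\<And>\<nu>. arity \<nu> = arity (\<nu>s ! i) \<Longrightarrow> to_list ((l, \<tau>), \<nu>s[i := \<nu>], \<sigma>)
    = (l, us @ rename (\<lambda>k. inv \<sigma> (sum_list (take i (map arity \<nu>s)) + k)) \<nu> # vs)"
proof -
  let ?us = "take i (relab \<nu>s \<sigma>)" and ?vs = "drop (Suc i) (relab \<nu>s \<sigma>)"
  have "\<tau> permutes {1..Suc (length ?us + length ?vs)}"
    using assms by (auto simp: ggens_def)
  then obtain us vs where "\<And>t. perm_list \<tau> (?us @ t # ?vs) = us @ t # vs"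
      "length us + length vs = length ?us + length ?vs"
    by (rule perm_list_slot) (rule that)
  then show thesis
    using assms(2) by (intro that[of us vs])
      (simp add: to_list_def relab_update, simp add: upd_conv_take_nth_drop)
qed

text \<open>A relator in a slot becomes a renamed element of the Lie ideal, on which
  \<open>NF\<close> vanishes; the other two families are differences of elements with equal
  lists.\<close>

lemma NF_crels:
  assumes "x \<in> crels"
  shows "lin NF (tl_lin x) = (0 :: _ \<Rightarrow>\<^sub>0 'k::comm_ring_1)"
proof -
  consider (a) y \<mu> \<nu>s i \<sigma> where "x = lin (\<lambda>\<nu>. sgl (\<mu>, \<nu>s[i := \<nu>], \<sigma>)) y" "y \<in> lie_ideal" "i < length \<nu>s"
      "\<forall>\<nu>\<in>Poly_Mapping.keys y. (\<mu>, \<nu>s[i := \<nu>], \<sigma>) \<in> ggens"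
    | (b) \<mu> \<nu>s \<tau>s \<sigma> where "x = sgl (\<mu>, map2 lie_act \<nu>s \<tau>s, \<sigma>) - sgl (\<mu>, \<nu>s, block_sum (map arity \<nu>s) \<tau>s \<circ> \<sigma>)"
      "(\<mu>, \<nu>s, \<sigma>) \<in> ggens" "length \<tau>s = length \<nu>s" "\<forall>i<length \<nu>s. \<tau>s ! i permutes {1..arity (\<nu>s ! i)}"
    | (c) \<mu> \<nu>s \<tau> \<sigma> where "x = sgl ((case \<mu> of (l, \<sigma>) \<Rightarrow> \<lambda>\<tau>. (l, \<sigma> \<circ> \<tau>)) \<tau>, \<nu>s, \<sigma>)
        - sgl (\<mu>, perm_list \<tau> \<nu>s, block_perm \<tau> (map arity \<nu>s) \<circ> \<sigma>)"
      "(\<mu>, \<nu>s, \<sigma>) \<in> ggens" "\<tau> permutes {1..length \<nu>s}"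
    using assms unfolding crels_eq Un_iff by (elim disjE) (simp only: mem_Collect_eq, elim exE conjE, metis)+
  then show ?thesis
  proof cases
    case a
    obtain l \<tau> where \<mu>: "\<mu> = (l, \<tau>)" by fastforce
    show ?thesis
    proof (cases "Poly_Mapping.keys y = {}")
      case True
      then show ?thesis by (simp add: a(1) lin_def)
    next
      case False
      then obtain \<nu>0 where \<nu>0: "\<nu>0 \<in> Poly_Mapping.keys y" by blast
      \<comment> \<open>Homogeneity gives all monomials of \<open>y\<close> the same arity, hence
        the same block offsets.\<close>
      note y = a(2)
      then obtain M where "y \<in> over {t. mset (leaves t) = M}" using lie_ideal_homogeneous by blast
      then have ar: "arity \<nu> = arity \<nu>0" if "\<nu> \<in> Poly_Mapping.keys y" for \<nu>
        using that \<nu>0 unfolding over_def by (metis (mono_tags, lifting) mem_Collect_eq size_mset subsetD)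
      have g: "((l, \<tau>), \<nu>s[i := \<nu>0], \<sigma>) \<in> ggens" using a(4) \<nu>0 by (auto simp: \<mu>)
      obtain us vs where uv: "\<And>\<nu>. arity \<nu> = arity (\<nu>s[i := \<nu>0] ! i) \<Longrightarrow> to_list ((l, \<tau>), \<nu>s[i := \<nu>0, i := \<nu>], \<sigma>)
          = (l, us @ rename (\<lambda>k. inv \<sigma> (sum_list (take i (map arity (\<nu>s[i := \<nu>0]))) + k)) \<nu> # vs)"
        using to_list_update[OF g, of i] a(3) by (metis length_list_update)
      let ?f = "\<lambda>k. inv \<sigma> (sum_list (take i (map arity (\<nu>s[i := \<nu>0]))) + k)"
      have "lin NF (tl_lin x) = lin (\<lambda>\<nu>. NF (to_list ((l, \<tau>), \<nu>s[i := \<nu>], \<sigma>))) y"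
        by (simp add: a(1) \<mu>)
      also have "\<dots> = lin (\<lambda>\<nu>. NF (l, us @ rename ?f \<nu> # vs)) y"
        using uv ar a(3) by (intro lin_cong) simp
      also have "\<dots> = lin (\<lambda>t. NF (l, us @ t # vs)) (lin (\<lambda>t. sgl (rename ?f t)) y)"
        by simp
      also have "\<dots> = 0" by (rule NF_ideal[OF rename_lie_ideal[OF y]])
      finally show ?thesis .
    qed
  next
    case b
    obtain l \<tau> where \<mu>: "\<mu> = (l, \<tau>)" by fastforce
    have "relab (map2 lie_act \<nu>s \<tau>s) \<sigma> = relab \<nu>s (block_sum (map arity \<nu>s) \<tau>s \<circ> \<sigma>)"
      using b by (intro relab_block_sum) (auto simp: ggens_def)
    then show ?thesis by (simp add: b(1) \<mu> to_list_def)
  next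
    case c
    obtain l \<tau>0 where \<mu>: "\<mu> = (l, \<tau>0)" by fastforce
    have g: "((l, \<tau>0), \<nu>s, \<sigma>) \<in> ggens" using c(2) by (simp add: \<mu>)
    have "relab (perm_list \<tau> \<nu>s) (block_perm \<tau> (map arity \<nu>s) \<circ> \<sigma>) = perm_list \<tau> (relab \<nu>s \<sigma>)"
      using g c(3) by (intro relab_block_perm) (auto simp: ggens_def)
    moreover have "perm_list \<tau>0 (perm_list \<tau> (relab \<nu>s \<sigma>)) = perm_list (\<tau>0 \<circ> \<tau>) (relab \<nu>s \<sigma>)"
      using g c(3) by (intro perm_list_perm_list) (auto simp: ggens_def)
    ultimately show ?thesis
      by (simp add: c(1) \<mu> to_list_def)
  qed
qed

section \<open>Lifting lists to the presented complex\<close>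

lemma crel_block_sum:
  assumes "(\<mu>, \<nu>s, \<sigma>) \<in> ggens" "length \<tau>s = length \<nu>s" "\<And>i. i < length \<nu>s \<Longrightarrow> \<tau>s ! i permutes {1..arity (\<nu>s ! i)}"
  shows "(sgl (\<mu>, map2 lie_act \<nu>s \<tau>s, \<sigma>) - sgl (\<mu>, \<nu>s, block_sum (map arity \<nu>s) \<tau>s \<circ> \<sigma>) :: _ \<Rightarrow>\<^sub>0 'k::comm_ring_1) \<in> crels"
  using assms unfolding crels_eq
  by (intro UnI1[OF UnI2] CollectI exI[of _ \<mu>] exI[of _ \<nu>s] exI[of _ \<tau>s] exI[of _ \<sigma>]) simp

lemma crel_block_perm:
  assumes "((l, id), \<nu>s, \<sigma>) \<in> ggens" "\<tau> permutes {1..length \<nu>s}"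
  shows "(sgl ((l, \<tau>), \<nu>s, \<sigma>) - sgl ((l, id), perm_list \<tau> \<nu>s, block_perm \<tau> (map arity \<nu>s) \<circ> \<sigma>) :: _ \<Rightarrow>\<^sub>0 'k::comm_ring_1) \<in> crels"
  using assms unfolding crels_eq
  by (intro UnI2 CollectI exI[of _ "(l, id)"] exI[of _ \<nu>s] exI[of _ \<tau>] exI[of _ \<sigma>]) simp

lemma crel_slot:
  assumes "y \<in> lie_ideal" "Poly_Mapping.keys y \<subseteq> lie_gens" "i < length \<nu>s"
    "\<And>\<nu>. \<nu> \<in> Poly_Mapping.keys y \<Longrightarrow> (\<mu>, \<nu>s[i := \<nu>], \<sigma>) \<in> ggens"
  shows "(lin (\<lambda>\<nu>. sgl (\<mu>, \<nu>s[i := \<nu>], \<sigma>)) y :: _ \<Rightarrow>\<^sub>0 'k::comm_ring_1) \<in> crels"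
  using assms unfolding crels_eq
  by (intro UnI1 CollectI exI[of _ y] exI[of _ \<mu>] exI[of _ \<nu>s] exI[of _ i] exI[of _ \<sigma>]) simp

lemma ggens_normal:
  assumes "((l, \<tau>), \<nu>s, \<sigma>) \<in> ggens"
  obtains \<nu>s' \<sigma>' where "((l, id), \<nu>s', \<sigma>') \<in> ggens" "to_list ((l, id), \<nu>s', \<sigma>') = to_list ((l, \<tau>), \<nu>s, \<sigma>)"
    "(sgl ((l, \<tau>), \<nu>s, \<sigma>) - sgl ((l, id), \<nu>s', \<sigma>') :: _ \<Rightarrow>\<^sub>0 'k::comm_ring_1) \<in> crels"
proof -
  have g: "\<tau> permutes {1..length \<nu>s}" "set \<nu>s \<subseteq> lie_gens" "length \<nu>s = lab_ar l"
      "\<sigma> permutes {1..sum_list (map arity \<nu>s)}"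
    using assms by (auto simp: ggens_def)
  let ?\<nu>s = "perm_list \<tau> \<nu>s" and ?\<sigma> = "block_perm \<tau> (map arity \<nu>s) \<circ> \<sigma>"
  have bp: "block_perm \<tau> (map arity \<nu>s) permutes {1..sum_list (map arity \<nu>s)}"
    using g(1) by (intro block_perm_permutes) simp
  have m: "mset ?\<nu>s = mset \<nu>s" by (rule mset_perm_list[OF g(1)])
  then have s: "sum_list (map arity ?\<nu>s) = sum_list (map arity \<nu>s)"
    by (simp only: sum_mset_sum_list[symmetric] mset_map)
  have "((l, id), ?\<nu>s, ?\<sigma>) \<in> ggens"
    using g mset_eq_setD[OF m] permutes_compose[OF g(4) bp] by (simp add: ggens_def s permutes_id)
  moreover have "to_list ((l, id), ?\<nu>s, ?\<sigma>) = to_list ((l, \<tau>), \<nu>s, \<sigma>)"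
    using relab_block_perm[OF g(2,1,4)] by (simp add: to_list_def)
  moreover have "((l, id), \<nu>s, \<sigma>) \<in> ggens"
    using g by (simp add: ggens_def permutes_id)
  then have "(sgl ((l, \<tau>), \<nu>s, \<sigma>) - sgl ((l, id), ?\<nu>s, ?\<sigma>) :: _ \<Rightarrow>\<^sub>0 'k) \<in> crels"
    using g(1) by (rule crel_block_perm)
  ultimately show thesis by (rule that)
qed

text \<open>Equal relabelled lists force \<open>\<gamma> = \<sigma>' \<circ> inv \<sigma>\<close> to
  preserve every block, because corresponding entries have the same inputs. So
  \<open>\<gamma>\<close> lies in the Young subgroup, and a single induction relator identifies the
  two elements.\<close>

lemma relab_inj:
  assumes g: "((l, id), \<nu>s, \<sigma>) \<in> ggens" and g': "((l, id), \<nu>s', \<sigma>') \<in> ggens" and eq: "relab \<nu>s \<sigma> = relab \<nu>s' \<sigma>'"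
  shows "(sgl ((l, id), \<nu>s, \<sigma>) - sgl ((l, id), \<nu>s', \<sigma>') :: _ \<Rightarrow>\<^sub>0 'k::comm_ring_1) \<in> crels"
proof -
  let ?ns = "map arity \<nu>s'" and ?s = "\<lambda>i. sum_list (take i (map arity \<nu>s'))"
  have len: "length \<nu>s = length \<nu>s'" using arg_cong[OF eq, of length] by simp
  have slot: "rename (\<lambda>k. inv \<sigma> (sum_list (take i (map arity \<nu>s)) + k)) (\<nu>s ! i)
      = rename (\<lambda>k. inv \<sigma>' (?s i + k)) (\<nu>s' ! i)" if "i < length \<nu>s'" for i
    using arg_cong[OF eq, of "\<lambda>ts. ts ! i"] that len by (simp add: nth_relab)
  have ar: "arity (\<nu>s ! i) = arity (\<nu>s' ! i)" if "i < length \<nu>s'" for i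
    using arg_cong[OF slot[OF that], of arity] by simp
  have ns: "map arity \<nu>s = ?ns" using len ar by (intro nth_equalityI) auto
  have \<sigma>: "\<sigma> permutes {1..sum_list ?ns}" and \<sigma>': "\<sigma>' permutes {1..sum_list ?ns}"
    and lg: "set \<nu>s \<subseteq> lie_gens" "set \<nu>s' \<subseteq> lie_gens"
    using g g' by (auto simp: ggens_def simp flip: ns)
  define \<gamma> where "\<gamma> = \<sigma>' \<circ> inv \<sigma>"
  have \<gamma>p: "\<gamma> permutes {1..sum_list ?ns}"
    unfolding \<gamma>_def by (rule permutes_compose[OF permutes_inv[OF \<sigma>] \<sigma>'])
  have \<gamma>: "\<exists>k'. 1 \<le> k' \<and> k' \<le> ?ns ! i \<and> \<gamma> (?s i + k) = ?s i + k'" if i: "i < length \<nu>s'" and k: "1 \<le> k" "k \<le> ?ns ! i" for i k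
  proof -
    have "k \<in> set (leaves (\<nu>s ! i))"
      using lie_gens_leaves[of "\<nu>s ! i" k] lg(1) i k ar[OF i] len by (simp add: subset_iff)
    then have "inv \<sigma> (?s i + k) \<in> set (leaves (rename (\<lambda>k. inv \<sigma> (?s i + k)) (\<nu>s ! i)))" by simp
    then obtain k' where k': "k' \<in> set (leaves (\<nu>s' ! i))" "inv \<sigma> (?s i + k) = inv \<sigma>' (?s i + k')"
      using slot[OF i] unfolding ns by auto
    then have "1 \<le> k' \<and> k' \<le> ?ns ! i" using lie_gens_leaves[of "\<nu>s' ! i" k'] lg(2) i by (simp add: subset_iff)
    moreover have "\<gamma> (?s i + k) = ?s i + k'"
      using permutes_inverses(1)[OF \<sigma>'] by (simp add: \<gamma>_def k'(2))
    ultimately show ?thesis by blast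
  qed
  define \<tau>s where "\<tau>s = map (\<lambda>i k. if k \<in> {1..?ns ! i} then \<gamma> (?s i + k) - ?s i else k) [0..<length \<nu>s']"
  have \<tau>s_nth: "(\<tau>s ! i) k = \<gamma> (?s i + k) - ?s i" if "i < length \<nu>s'" "1 \<le> k" "k \<le> ?ns ! i" for i k
    using that by (simp add: \<tau>s_def)
  have \<tau>s: "\<tau>s ! i permutes {1..?ns ! i}" if i: "i < length \<nu>s'" for i
  proof (rule bij_imp_permutes)
    have "inj_on (\<tau>s ! i) {1..?ns ! i}"
    proof (rule inj_onI)
      fix a b assume ab: "a \<in> {1..?ns ! i}" "b \<in> {1..?ns ! i}" "(\<tau>s ! i) a = (\<tau>s ! i) b"
      then have "\<gamma> (?s i + a) = \<gamma> (?s i + b)"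
        using \<gamma>[OF i, of a] \<gamma>[OF i, of b] \<tau>s_nth[OF i, of a] \<tau>s_nth[OF i, of b] by auto
      then show "a = b" using permutes_inj[OF \<gamma>p] by (simp add: inj_eq)
    qed
    moreover have "(\<tau>s ! i) ` {1..?ns ! i} \<subseteq> {1..?ns ! i}"
    proof (rule image_subsetI)
      fix a assume "a \<in> {1..?ns ! i}"
      then show "(\<tau>s ! i) a \<in> {1..?ns ! i}"
        using \<gamma>[OF i, of a] \<tau>s_nth[OF i, of a] by auto
    qed
    ultimately show "bij_betw (\<tau>s ! i) {1..?ns ! i} {1..?ns ! i}"
      by (simp add: bij_betw_def endo_inj_surj)
    show "(\<tau>s ! i) k = k" if "k \<notin> {1..?ns ! i}" for k
      using i that by (simp add: \<tau>s_def del: atLeastAtMost_iff)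
  qed
  have l\<tau>s: "length \<tau>s = length ?ns" by (simp add: \<tau>s_def)
  have bs: "block_sum ?ns \<tau>s = \<gamma>"
  proof
    fix x
    show "block_sum ?ns \<tau>s x = \<gamma> x"
    proof (cases "x \<in> {1..sum_list ?ns}")
      case True
      then obtain i k where i: "i < length ?ns" "1 \<le> k" "k \<le> ?ns ! i" and x: "x = ?s i + k"
        using block_cases[of x ?ns] by auto
      show ?thesis
        using block_sum_block[OF i] i \<gamma>[of i k] \<tau>s_nth[of i k] by (auto simp: x)
    next
      case False
      then show ?thesis
        using permutes_not_in[OF \<gamma>p False] by (simp only: block_sum_def if_False)
    qed
  qed
  have \<gamma>inv: "inv \<gamma> = \<sigma> \<circ> inv \<sigma>'"
    unfolding \<gamma>_def using permutes_inverses[OF \<sigma>] permutes_inverses[OF \<sigma>']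
    by (intro inv_unique_comp) (auto simp: fun_eq_iff)
  have act: "lie_act (\<nu>s' ! i) (\<tau>s ! i) = \<nu>s ! i" if i: "i < length \<nu>s'" for i
  proof -
    have "rename (\<lambda>a. \<sigma> a - ?s i) (rename (\<lambda>k. inv \<sigma> (?s i + k)) (\<nu>s ! i)) = \<nu>s ! i"
      unfolding rename_rename by (rule rename_id) (simp add: permutes_inverses(1)[OF \<sigma>])
    then have "\<nu>s ! i = rename (\<lambda>a. \<sigma> a - ?s i) (rename (\<lambda>k. inv \<sigma>' (?s i + k)) (\<nu>s' ! i))"
      using slot[OF i] unfolding ns by simp
    also have "\<dots> = rename (inv (\<tau>s ! i)) (\<nu>s' ! i)"
      unfolding rename_rename
    proof (rule rename_cong)
      fix k assume k: "k \<in> set (leaves (\<nu>s' ! i))"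
      have "1 \<le> k" "k \<le> ?ns ! i"
        using k lie_gens_leaves[of "\<nu>s' ! i" k] lg(2) i by (simp_all add: subset_iff)
      then have "inv \<gamma> (?s i + k) = ?s i + inv (\<tau>s ! i) k"
        using block_sum_permutes(2)[of \<tau>s ?ns i k] l\<tau>s \<tau>s i unfolding bs by simp
      then show "\<sigma> (inv \<sigma>' (?s i + k)) - ?s i = inv (\<tau>s ! i) k"
        by (simp add: \<gamma>inv)
    qed
    finally show ?thesis by (simp add: lie_act_def)
  qed
  have "map2 lie_act \<nu>s' \<tau>s = \<nu>s"
    using l\<tau>s len act by (intro nth_equalityI) auto
  moreover have "block_sum ?ns \<tau>s \<circ> \<sigma> = \<sigma>'"
    unfolding bs \<gamma>_def using permutes_inverses[OF \<sigma>] by (auto simp: fun_eq_iff)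
  moreover have "((l, id), \<nu>s', \<sigma>) \<in> ggens"
    using g' \<sigma> by (simp add: ggens_def)
  ultimately show ?thesis
    using crel_block_sum[of "(l, id)" \<nu>s' \<sigma> \<tau>s] l\<tau>s \<tau>s by simp
qed

lemma to_list_inj:
  assumes "g \<in> ggens" "g' \<in> ggens" "to_list g = to_list g'"
  shows "(sgl g - sgl g' :: _ \<Rightarrow>\<^sub>0 'k::comm_ring_1) \<in> free_mod.span crels"
proof -
  obtain l \<tau> \<nu>s \<sigma> where gl: "g = ((l, \<tau>), \<nu>s, \<sigma>)" by (metis prod.exhaust)
  obtain l' \<tau>' \<nu>s' \<sigma>' where gl': "g' = ((l', \<tau>'), \<nu>s', \<sigma>')" by (metis prod.exhaust)
  have l: "l' = l" using assms(3) by (simp add: gl gl' to_list_def)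
  obtain \<nu>1 \<sigma>1 where 1: "((l, id), \<nu>1, \<sigma>1) \<in> ggens" "to_list ((l, id), \<nu>1, \<sigma>1) = to_list g"
      "(sgl g - sgl ((l, id), \<nu>1, \<sigma>1) :: _ \<Rightarrow>\<^sub>0 'k) \<in> crels"
    by (rule ggens_normal[OF assms(1)[unfolded gl]]) (rule that, simp_all only: gl)
  obtain \<nu>2 \<sigma>2 where 2: "((l, id), \<nu>2, \<sigma>2) \<in> ggens" "to_list ((l, id), \<nu>2, \<sigma>2) = to_list g'"
      "(sgl g' - sgl ((l, id), \<nu>2, \<sigma>2) :: _ \<Rightarrow>\<^sub>0 'k) \<in> crels"
    by (rule ggens_normal[OF assms(2)[unfolded gl' l]]) (rule that, simp_all only: gl' l)
  have "to_list ((l, id), \<nu>1, \<sigma>1) = to_list ((l, id), \<nu>2, \<sigma>2)"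
    using 1(2) 2(2) assms(3) by (simp only:)
  then have "relab \<nu>1 \<sigma>1 = relab \<nu>2 \<sigma>2"
    by (simp add: to_list_def)
  then have 3: "(sgl ((l, id), \<nu>1, \<sigma>1) - sgl ((l, id), \<nu>2, \<sigma>2) :: _ \<Rightarrow>\<^sub>0 'k) \<in> crels"
    by (rule relab_inj[OF 1(1) 2(1)])
  have "sgl g - sgl g' = (sgl g - sgl ((l, id), \<nu>1, \<sigma>1)) + (sgl ((l, id), \<nu>1, \<sigma>1) - sgl ((l, id), \<nu>2, \<sigma>2))
      - (sgl g' - sgl ((l, id), \<nu>2, \<sigma>2) :: _ \<Rightarrow>\<^sub>0 'k)"
    by simp
  also have "\<dots> \<in> free_mod.span crels"
    by (intro free_mod.span_add free_mod.span_diff free_mod.span_base 1(3) 2(3) 3)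
  finally show ?thesis .
qed

lemma nth_concat_block:
  "i < length xss \<Longrightarrow> k < length (xss ! i) \<Longrightarrow> concat xss ! (sum_list (take i (map length xss)) + k) = xss ! i ! k"
proof (induction xss arbitrary: i)
  case (Cons xs xss)
  then show ?case by (cases i) (auto simp: nth_append)
qed simp

lemma to_list_surj:
  assumes v: "(l, ts) \<in> valid n"
  obtains \<nu>s \<sigma> where "((l, id), \<nu>s, \<sigma>) \<in> ggens" "to_list ((l, id), \<nu>s, \<sigma>) = (l, ts)"
    "sum_list (map arity \<nu>s) = n"
proof -
  let ?cs = "concat (map leaves ts)" and ?s = "\<lambda>i. sum_list (take i (map arity ts))"
  have d: "distinct ?cs" "set ?cs = {1..n}" and lt: "length ts = lab_ar l" using v by (auto simp: valid_def)
  have lcs: "length ?cs = n" using distinct_card[OF d(1)] d(2) by simp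
  have sum: "sum_list (map arity ts) = n" using lcs by (simp add: length_concat comp_def)
  \<comment> \<open>\<open>\<pi>\<close> reads the leaves of the whole list from left to right;
    after renaming by its inverse each block has leaves \<open>1, 2, ...\<close> in order, hence a
    monomial in \<open>lie_gens\<close>.\<close>
  define \<pi> where "\<pi> k = (if k \<in> {1..n} then ?cs ! (k - 1) else k)" for k
  have "bij_betw (\<lambda>k. ?cs ! (k - 1)) {1..n} {1..n}"
  proof (rule bij_betw_imageI)
    show "inj_on (\<lambda>k. ?cs ! (k - 1)) {1..n}"
    proof (rule inj_onI)
      fix a b assume ab: "a \<in> {1..n}" "b \<in> {1..n}" "?cs ! (a - 1) = ?cs ! (b - 1)"
      then have "a - 1 = b - 1" using nth_eq_iff_index_eq[OF d(1), of "a - 1" "b - 1"] lcs by auto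
      then show "a = b" using ab by auto
    qed
    have "(\<lambda>k. ?cs ! (k - 1)) ` {1..n} = (!) ?cs ` (\<lambda>k. k - 1) ` {1..n}" by (simp only: image_image)
    also have "(\<lambda>k. k - 1) ` {1..n} = {..<n}"
    proof (intro equalityI subsetI)
      fix x assume "x \<in> {..<n}"
      then have "x = Suc x - 1" "Suc x \<in> {1..n}" by auto
      then show "x \<in> (\<lambda>k. k - 1) ` {1..n}" by (rule image_eqI)
    qed auto
    also have "(!) ?cs ` {..<n} = set ?cs"
      unfolding set_conv_nth lcs by auto
    finally show "(\<lambda>k. ?cs ! (k - 1)) ` {1..n} = {1..n}" using d(2) by simp
  qed
  then have "bij_betw \<pi> {1..n} {1..n}"
    by (rule bij_betw_cong[THEN iffD1, rotated]) (simp add: \<pi>_def)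
  then have \<pi>: "\<pi> permutes {1..n}"
    by (rule bij_imp_permutes) (simp only: \<pi>_def if_False)
  define \<sigma> where "\<sigma> = inv \<pi>"
  have \<sigma>: "\<sigma> permutes {1..n}" unfolding \<sigma>_def by (rule permutes_inv[OF \<pi>])
  have inv\<sigma>: "inv \<sigma> = \<pi>" unfolding \<sigma>_def by (rule inv_inv_eq[OF permutes_bij[OF \<pi>]])
  have leaf: "\<sigma> (leaves (ts ! i) ! k) = ?s i + Suc k" if i: "i < length ts" "k < arity (ts ! i)" for i k
  proof -
    have "?s i + k < n"
      using block_le[of i "map arity ts" "Suc k"] i sum by simp
    moreover have "?cs ! (?s i + k) = leaves (ts ! i) ! k"
      using nth_concat_block[of i "map leaves ts" k] i by (simp add: comp_def)
    ultimately have "\<pi> (?s i + Suc k) = leaves (ts ! i) ! k" by (simp add: \<pi>_def)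
    then show ?thesis unfolding \<sigma>_def using permutes_inverses(2)[OF \<pi>] by metis
  qed
  define \<nu>s where "\<nu>s = map (\<lambda>i. rename (\<lambda>a. \<sigma> a - ?s i) (ts ! i)) [0..<length ts]"
  have nth: "\<nu>s ! i = rename (\<lambda>a. \<sigma> a - ?s i) (ts ! i)" if "i < length ts" for i
    using that by (simp add: \<nu>s_def)
  have len: "length \<nu>s = length ts" by (simp add: \<nu>s_def)
  have lv: "leaves (\<nu>s ! i) = [1..<Suc (arity (ts ! i))]" if i: "i < length ts" for i
    using i by (intro nth_equalityI) (simp_all add: nth leaf del: upt_Suc)
  have ns: "map arity \<nu>s = map arity ts"
    using len nth by (intro nth_equalityI) auto
  have "\<nu>s ! i \<in> lie_gens" if "i < length ts" for i
    unfolding lie_gens_def mem_Collect_eq lv[OF that] by (auto simp del: upt_Suc)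
  then have "set \<nu>s \<subseteq> lie_gens" using len by (auto simp: in_set_conv_nth)
  then have "((l, id), \<nu>s, \<sigma>) \<in> ggens"
    using lt len \<sigma> sum ns by (simp add: ggens_def permutes_id)
  moreover have "relab \<nu>s \<sigma> = ts"
  proof (rule nth_equalityI)
    fix i assume "i < length (relab \<nu>s \<sigma>)"
    then have i: "i < length ts" using len by simp
    have "rename (\<lambda>k. inv \<sigma> (?s i + k)) (rename (\<lambda>a. \<sigma> a - ?s i) (ts ! i)) = ts ! i"
      unfolding rename_rename
    proof (rule rename_id)
      fix a assume "a \<in> set (leaves (ts ! i))"
      then obtain k where "k < arity (ts ! i)" "a = leaves (ts ! i) ! k" by (auto simp: in_set_conv_nth)
      then have "?s i + (\<sigma> a - ?s i) = \<sigma> a" using leaf[OF i, of k] by simp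
      then show "inv \<sigma> (?s i + (\<sigma> a - ?s i)) = a" using permutes_inverses(2)[OF \<sigma>] by simp
    qed
    then show "relab \<nu>s \<sigma> ! i = ts ! i" using i len by (simp add: nth_relab ns nth)
  qed (simp add: len)
  then have "to_list ((l, id), \<nu>s, \<sigma>) = (l, ts)" by (simp add: to_list_def)
  moreover have "sum_list (map arity \<nu>s) = n" using sum ns by simp
  ultimately show thesis by (rule that)
qed

text \<open>An arbitrary choice is enough: by \<open>to_list_inj\<close> any two candidates agree
  modulo the relators.\<close>

definition lift :: "lelem \<Rightarrow> gelem" where
  "lift y = (SOME g. g \<in> ggens \<and> to_list g = y)"

lemma lift:
  assumes "y \<in> valid n"
  shows "lift y \<in> ggens" "to_list (lift y) = y"
proof -
  have "\<exists>g. g \<in> ggens \<and> to_list g = y"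
    using to_list_surj[of "fst y" "snd y" n] assms by (metis prod.collapse)
  then have "lift y \<in> ggens \<and> to_list (lift y) = y" unfolding lift_def by (rule someI_ex)
  then show "lift y \<in> ggens" "to_list (lift y) = y" by auto
qed

text \<open>All monomials of the relator have the same letters, so one \<open>\<sigma>\<close>,
  taken from a lift of the list with \<open>t0\<close>, serves for all of them and only the slot
  varies. This gives an honest slot relator, and the chosen lifts differ from it by
  relators.\<close>

lemma lift_slot_rels:
  assumes "y \<in> slot_rels n"
  shows "(lin (\<lambda>g. sgl (lift g)) y :: _ \<Rightarrow>\<^sub>0 'k::comm_ring_1) \<in> free_mod.span crels"
proof -
  obtain l us vs x M where y: "y = lin (\<lambda>t. sgl (l, us @ t # vs)) x" and x: "x \<in> lie_rel M"
    and v: "\<And>t. mset (leaves t) = M \<Longrightarrow> (l, us @ t # vs) \<in> valid n"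
    using assms unfolding slot_rels_def by blast
  show ?thesis
  proof (cases "Poly_Mapping.keys x = {}")
    case True
    then show ?thesis by (simp add: y lin_def free_mod.span_zero)
  next
    case False
    then obtain t0 where t0: "t0 \<in> Poly_Mapping.keys x" by blast
    have M: "mset (leaves t) = M" if "t \<in> Poly_Mapping.keys x" for t
      using that x by (auto simp: lie_rel_def over_def)
    obtain \<nu>s \<sigma> where g: "((l, id), \<nu>s, \<sigma>) \<in> ggens" "to_list ((l, id), \<nu>s, \<sigma>) = (l, us @ t0 # vs)"
      using to_list_surj[OF v[OF M[OF t0]]] by metis
    let ?i = "length us"
    let ?s = "sum_list (take ?i (map arity \<nu>s))"
    define f where "f a = \<sigma> a - ?s" for a
    have rel: "relab \<nu>s \<sigma> = us @ t0 # vs" using g(2) by (simp add: to_list_def)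
    have i: "?i < length \<nu>s"
      using arg_cong[OF rel, of length] by (simp only: length_relab length_append list.size)
    have \<sigma>: "\<sigma> permutes {1..sum_list (map arity \<nu>s)}" and lg: "\<nu>s ! ?i \<in> lie_gens" using g(1) i by (auto simp: ggens_def)
    have t0_eq: "t0 = rename (\<lambda>k. inv \<sigma> (?s + k)) (\<nu>s ! ?i)"
      using arg_cong[OF rel, of "\<lambda>ts. ts ! ?i"] i by (simp add: nth_relab)
    have f_t0: "rename f t0 = \<nu>s ! ?i"
      unfolding t0_eq rename_rename by (rule rename_id) (simp add: f_def permutes_inverses(1)[OF \<sigma>])
    have ft: "mset (leaves (rename f t)) = mset (leaves (\<nu>s ! ?i))" if "t \<in> Poly_Mapping.keys x" for t
      using M[OF that] M[OF t0] by (simp flip: f_t0)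
    have lgt: "rename f t \<in> lie_gens" and art: "arity (rename f t) = arity (\<nu>s ! ?i)" if "t \<in> Poly_Mapping.keys x" for t
    proof -
      show "arity (rename f t) = arity (\<nu>s ! ?i)" using mset_eq_length[OF ft[OF that]] .
      then show "rename f t \<in> lie_gens"
        using lg mset_eq_setD[OF ft[OF that]] mset_eq_imp_distinct_iff[OF ft[OF that]]
        unfolding lie_gens_def mem_Collect_eq by metis
    qed
    have gt: "((l, id), \<nu>s[?i := rename f t], \<sigma>) \<in> ggens" if "t \<in> Poly_Mapping.keys x" for t
    proof -
      have "map arity (\<nu>s[?i := rename f t]) = map arity \<nu>s"
        using art[OF that] i by (simp only: map_update) (metis list_update_id nth_map)
      moreover have "set (\<nu>s[?i := rename f t]) \<subseteq> lie_gens"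
        using g(1) lgt[OF that] set_update_subset_insert[of \<nu>s ?i "rename f t"] by (auto simp: ggens_def)
      ultimately show ?thesis using g(1) by (simp add: ggens_def)
    qed
    have tl: "to_list ((l, id), \<nu>s[?i := rename f t], \<sigma>) = (l, us @ t # vs)" if t: "t \<in> Poly_Mapping.keys x" for t
    proof -
      have "rename (\<lambda>k. inv \<sigma> (?s + k)) (rename f t) = t"
        unfolding rename_rename
      proof (rule rename_id)
        fix a assume "a \<in> set (leaves t)"
        then have "a \<in> set (leaves t0)" using mset_eq_setD[of "leaves t" "leaves t0"] M[OF t] M[OF t0] by simp
        then obtain k where "a = inv \<sigma> (?s + k)" unfolding t0_eq by auto
        then show "inv \<sigma> (?s + f a) = a" by (simp add: f_def permutes_inverses(1)[OF \<sigma>])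
      qed
      then show ?thesis
        using relab_update[OF i art[OF t], of \<sigma>] by (simp add: to_list_def rel)
    qed
    have sub: "lin (\<lambda>t. sgl (lift (l, us @ t # vs)) - sgl ((l, id), \<nu>s[?i := rename f t], \<sigma>)) x \<in> free_mod.span crels"
    proof (rule lin_in_span)
      fix t assume t: "t \<in> Poly_Mapping.keys x"
      show "sgl (lift (l, us @ t # vs)) - sgl ((l, id), \<nu>s[?i := rename f t], \<sigma>) \<in> free_mod.span (crels :: (_ \<Rightarrow>\<^sub>0 'k) set)"
        using lift[OF v[OF M[OF t]]] gt[OF t] tl[OF t] by (intro to_list_inj) auto
    qed
    let ?x = "lin (\<lambda>t. sgl (rename f t)) x"
    have "?x \<in> over (rename f ` Poly_Mapping.keys x)"
      by (rule over_lin[of _ "Poly_Mapping.keys x"]) (auto simp: over_def)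
    then have kx: "Poly_Mapping.keys ?x \<subseteq> rename f ` Poly_Mapping.keys x" by (simp add: over_def)
    have "lin (\<lambda>\<nu>. sgl ((l, id), \<nu>s[?i := \<nu>], \<sigma>)) ?x \<in> crels"
    proof (rule crel_slot[OF _ _ i])
      show "?x \<in> lie_ideal" using x by (intro rename_lie_ideal) (simp add: lie_rel_def)
      show "Poly_Mapping.keys ?x \<subseteq> lie_gens" using kx lgt by auto
      show "((l, id), \<nu>s[?i := \<nu>], \<sigma>) \<in> ggens" if "\<nu> \<in> Poly_Mapping.keys ?x" for \<nu>
        using kx gt that by auto
    qed
    from free_mod.span_add[OF sub free_mod.span_base[OF this]]
    show ?thesis by (simp add: y lin_fun_diff)
  qed
qed

text \<open>The comparison is injective on the quotient: an element killed by \<open>NF\<close> is a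
  combination of slot relators on lists, these lift to relators, and lifting after
  \<open>to_list\<close> is the identity modulo relators.\<close>

lemma NF_to_list_eq_0:
  assumes x: "(x :: _ \<Rightarrow>\<^sub>0 'k::comm_ring_1) \<in> over {((l, \<tau>), \<nu>s, \<sigma>). ((l, \<tau>), \<nu>s, \<sigma>) \<in> ggens \<and> sum_list (map arity \<nu>s) = n}"
    and "lin NF (tl_lin x) = 0"
  shows "x \<in> free_mod.span crels"
proof -
  have v: "to_list g \<in> valid n" and g: "g \<in> ggens" if g: "g \<in> Poly_Mapping.keys x" for g
  proof -
    obtain l \<tau> \<nu>s \<sigma> where gl: "g = ((l, \<tau>), \<nu>s, \<sigma>)" by (metis prod.exhaust)
    have *: "((l, \<tau>), \<nu>s, \<sigma>) \<in> ggens" "sum_list (map arity \<nu>s) = n"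
      using subsetD[OF x[unfolded over_def mem_Collect_eq] g] by (simp_all add: gl)
    show "to_list g \<in> valid n" using to_list_valid[OF *(1)] by (simp only: gl *(2))
    show "g \<in> ggens" using *(1) by (simp only: gl)
  qed
  have "tl_lin x \<in> over (valid n)"
    by (rule over_lin[of _ "Poly_Mapping.keys x"]) (use v in \<open>auto simp: over_def\<close>)
  then have "tl_lin x \<in> free_mod.span (slot_rels n)" using assms(2) NF_eq_0_iff by blast
  then have "lin (\<lambda>g. sgl (lift g)) (tl_lin x) \<in> free_mod.span crels"
    by (rule lin_span) (rule lift_slot_rels)
  moreover have "lin (\<lambda>g. sgl g - sgl (lift (to_list g))) x \<in> free_mod.span crels"
  proof (rule lin_in_span)
    fix h assume h: "h \<in> Poly_Mapping.keys x"
    show "sgl h - sgl (lift (to_list h)) \<in> free_mod.span (crels :: (_ \<Rightarrow>\<^sub>0 'k) set)"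
      by (rule to_list_inj[OF g[OF h] lift(1)[OF v[OF h]] lift(2)[OF v[OF h], symmetric]])
  qed
  ultimately have "lin (\<lambda>g. sgl g - sgl (lift (to_list g))) x + lin (\<lambda>g. sgl (lift g)) (tl_lin x) \<in> free_mod.span crels"
    by (intro free_mod.span_add)
  then show ?thesis by (simp add: lin_fun_diff)
qed

text \<open>In every term of a decomposition the factors carry identity permutations and only the
  outer permutation varies, so among nonvanishing values \<open>kappa_tilde\<close> is only
  evaluated at \<open>(L2, id)\<close>.\<close>

definition decs :: "lab \<Rightarrow> (lie3_gen, lie3_gen) elem set" where
  "decs l = {((m, id), map (\<lambda>l. (l, id)) ls, \<tau>) | m ls \<tau>. length ls = lab_ar m
     \<and> sum_list (map lab_ar ls) = lab_ar l \<and> \<tau> permutes {1..lab_ar l}}"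

lemma dterm_over:
  "length ls = lab_ar m \<Longrightarrow> sum_list (map lab_ar ls) = lab_ar l \<Longrightarrow> set c \<subseteq> {1..lab_ar l}
    \<Longrightarrow> (dterm m ls c :: _ \<Rightarrow>\<^sub>0 'k::comm_ring_1) \<in> over (decs l)"
  unfolding dterm_def decs_def using cycle_of_list_permutes by (intro over_single) blast

lemma ell_dec_over:
  assumes n: "1 \<le> n" "n \<le> 5"
  shows "(ell_dec n :: _ \<Rightarrow>\<^sub>0 'k::comm_ring_1) \<in> over (decs (ell n))"
  unfolding ell_dec_def
proof (intro over_sum over_single)
  fix j ns \<sigma>
  assume j: "j \<in> {1..n}" and ns: "ns \<in> {ns. length ns = j \<and> sum_list ns = n \<and> (\<forall>i\<in>set ns. 1 \<le> i)}"
    and \<sigma>: "\<sigma> \<in> inv_red_shuffles ns"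
  have "1 \<le> i \<and> i \<le> 5" if "i \<in> set ns" for i
    using ns that member_le_sum_list[of i ns] n by auto
  then have "map lab_ar (map ell ns) = ns"
    by (intro map_idI[of ns "\<lambda>i. lab_ar (ell i)", simplified comp_def map_map[symmetric]] nth_equalityI) (auto simp: ell_ar)
  moreover have "\<sigma> permutes {1..n}"
    using \<sigma> ns by (auto simp: inv_red_shuffles_def intro: permutes_inv)
  ultimately show "((ell j, id), map (\<lambda>i. (ell i, id)) ns, \<sigma>) \<in> decs (ell n)"
    unfolding decs_def using j ns n
    by (intro CollectI exI[of _ "ell j"] exI[of _ "map ell ns"] exI[of _ \<sigma>]) (simp add: ell_ar comp_def)
qed

lemma lab_dec_over: "(lab_dec l :: _ \<Rightarrow>\<^sub>0 'k::comm_ring_1) \<in> over (decs l)"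
proof (cases "l \<in> {L1, L2, L3, L4, L5}")
  case True
  then have "l = ell (lab_ar l)" "1 \<le> lab_ar l" "lab_ar l \<le> 5" by (auto simp: ell_def)
  then show ?thesis using ell_dec_over[of "lab_ar l"] True by (simp add: lab_dec_def)
next
  case False
  have "(red_dec l :: _ \<Rightarrow>\<^sub>0 'k) \<in> over (decs l)"
    using False by (cases l) (auto intro!: over_add over_diff over_uminus dterm_over)
  moreover have "(dterm L1 [l] [] :: _ \<Rightarrow>\<^sub>0 'k) \<in> over (decs l)" by (rule dterm_over) auto
  moreover have "(dterm l (replicate (lab_ar l) L1) [] :: _ \<Rightarrow>\<^sub>0 'k) \<in> over (decs l)"
    by (rule dterm_over) (auto simp: sum_list_replicate)
  ultimately show ?thesis using False by (auto simp: lab_dec_def intro!: over_add)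
qed

section \<open>The twist expressed by bracketing neighbouring entries\<close>

definition graft2 :: "nat \<Rightarrow> lie_mono list \<Rightarrow> lie_mono list" where
  "graft2 i \<xi> = take i \<xi> @ lie_graft (Br (Leaf 1) (Leaf 2)) (take 2 (drop i \<xi>)) # drop (i + 2) \<xi>"

text \<open>The only sign is that of \<open>kappa_tilde\<close> passing the label, which
  \<open>tw_term\<close> already contains; Lie in degree 0 adds none. The permutation of the label
  enters through equivariance of the decomposition, as
  \<open>\<tau>' \<circ> \<tau>\<close>.\<close>

lemma twist_eq:
  "twist C3 kappa_tilde Lie ((l, \<tau>), \<nu>s, \<sigma>)
    = (lin (\<lambda>(m, i, \<tau>'). sgl ((m, id), graft2 i (perm_list (\<tau>' \<circ> \<tau>) \<nu>s), block_perm (\<tau>' \<circ> \<tau>) (map arity \<nu>s) \<circ> \<sigma>)) (tw l)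
      :: _ \<Rightarrow>\<^sub>0 'k::comm_ring_1)"
proof -
  let ?G = "\<lambda>x. inf_gam Lie (x, \<nu>s, \<sigma>) :: _ \<Rightarrow>\<^sub>0 'k"
  let ?F = "\<lambda>(m, i, \<tau>'). sgl ((m, id), graft2 i (perm_list (\<tau>' \<circ> \<tau>) \<nu>s), block_perm (\<tau>' \<circ> \<tau>) (map arity \<nu>s) \<circ> \<sigma>) :: _ \<Rightarrow>\<^sub>0 'k"
  let ?P = "\<lambda>(\<mu>, \<nu>s, \<sigma>). \<Sum>i<length \<nu>s. Poly_Mapping.single (\<mu>, i, \<nu>s ! i, \<sigma>)
      (\<Prod>j\<in>{..<length \<nu>s} - {i}. counit C3 (\<nu>s ! j)) :: _ \<Rightarrow>\<^sub>0 'k"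
  have id: "lie_act (Br (Leaf a) (Leaf b)) id = Br (Leaf a) (Leaf b)" for a b
    by (simp add: lie_act_def)
  have "twist C3 kappa_tilde Lie ((l, \<tau>), \<nu>s, \<sigma>)
      = lin (\<lambda>(\<mu>, ls, \<tau>'). lin ?G (lin (inf_map C3 kappa_tilde) (?P (\<mu>, ls, \<tau>' \<circ> \<tau>)))) (lab_dec l)"
    by (simp add: twist_def part_dec_def case_prod_unfold)
  also have "\<dots> = lin (\<lambda>x. lin ?F (tw_term x)) (lab_dec l)"
  proof (rule over_lin_cong[OF lab_dec_over])
    fix x assume "x \<in> decs l"
    then obtain m ls \<tau>' where x: "x = ((m, id), map (\<lambda>l. (l, id)) ls, \<tau>')"
      unfolding decs_def by blast
    have "pscale c (lin ?G (inf_map C3 kappa_tilde ((m, id), i, (ls ! i, id), \<tau>' \<circ> \<tau>)))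
        = pscale (ksign (lab_dgr m) * (if ls ! i = L2 then 1 else 0) * c) (?F (m, i, \<tau>'))" for i and c :: 'k
      by (simp add: inf_map_def kappa_tilde_def id inf_gam_def Let_def graft2_def ksign_def mult.commute numeral_2_eq_2)
    then have "lin ?G (lin (inf_map C3 kappa_tilde) (?P ((m, id), map (\<lambda>l. (l, id)) ls, \<tau>' \<circ> \<tau>)))
        = lin ?F (tw_term ((m, id), map (\<lambda>l. (l, id)) ls, \<tau>'))"
      by (simp add: tw_term_def case_prod_unfold)
    then show "(case x of (\<mu>, ls, \<tau>') \<Rightarrow> lin ?G (lin (inf_map C3 kappa_tilde) (?P (\<mu>, ls, \<tau>' \<circ> \<tau>)))) = lin ?F (tw_term x)"
      by (simp only: x prod.case)
  qed
  finally show ?thesis by (simp add: tw_def)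
qed

lemma lie_graft_Br: "lie_graft (Br (Leaf 1) (Leaf 2)) [p, q] = Br p (rename (\<lambda>k. arity p + k) q)"
  by (simp add: lie_graft_def off_def rename_id)

lemma graft2_eq:
  "Suc i < length \<xi> \<Longrightarrow> graft2 i \<xi> = take i \<xi> @ Br (\<xi> ! i) (rename (\<lambda>k. arity (\<xi> ! i) + k) (\<xi> ! Suc i)) # drop (Suc (Suc i)) \<xi>"
proof -
  assume i: "Suc i < length \<xi>"
  then have "drop i \<xi> = \<xi> ! i # \<xi> ! Suc i # drop (Suc (Suc i)) \<xi>"
    by (simp add: Cons_nth_drop_Suc)
  then have "take 2 (drop i \<xi>) = [\<xi> ! i, \<xi> ! Suc i]" by simp
  then show ?thesis using lie_graft_Br by (simp add: graft2_def)
qed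

lemma map_arity_graft2:
  assumes "Suc i < length \<xi>"
  shows "map arity (graft2 i \<xi>) = take i (map arity \<xi>) @ (arity (\<xi> ! i) + arity (\<xi> ! Suc i)) # drop (Suc (Suc i)) (map arity \<xi>)"
  using assms by (simp add: graft2_eq take_map drop_map)

lemma sum_list_two:
  assumes "Suc i < length xs"
  shows "sum_list (take i xs) + (xs ! i + xs ! Suc i) + sum_list (drop (Suc (Suc i)) xs) = sum_list (xs :: nat list)"
proof -
  have "xs = take i xs @ drop i xs" by simp
  also have "drop i xs = xs ! i # xs ! Suc i # drop (Suc (Suc i)) xs"
    using assms by (simp add: Cons_nth_drop_Suc)
  finally have "sum_list xs = sum_list (take i xs @ xs ! i # xs ! Suc i # drop (Suc (Suc i)) xs)" by (rule arg_cong)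
  then show ?thesis by simp
qed

lemma lie_gens_graft:
  assumes "p \<in> lie_gens" "q \<in> lie_gens"
  shows "Br p (rename (\<lambda>k. arity p + k) q) \<in> lie_gens"
proof -
  have p: "distinct (leaves p)" "set (leaves p) = {1..arity p}" and q: "distinct (leaves q)" "set (leaves q) = {1..arity q}"
    using assms unfolding lie_gens_def by blast+
  have "(+) (arity p) ` {1..arity q} = {Suc (arity p)..arity p + arity q}"
    by (simp add: image_add_atLeastAtMost)
  then have "set (leaves p) \<inter> (+) (arity p) ` set (leaves q) = {}"
    "set (leaves p) \<union> (+) (arity p) ` set (leaves q) = {1..arity p + arity q}"
    unfolding p(2) q(2) by auto
  then show ?thesis
    using p(1) q(1) by (simp add: lie_gens_def distinct_map)
qed

text \<open>Grafting shifts the leaves of the second entry by the arity of the first, which is the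
  difference of their block offsets; the offsets further right do not change when two blocks are
  merged.\<close>

lemma relab_graft2:
  assumes i: "Suc i < length \<xi>"
  shows "relab (graft2 i \<xi>) \<sigma> = contract i (relab \<xi> \<sigma>)"
proof (rule nth_equalityI)
  have len: "length (graft2 i \<xi>) = length \<xi> - 1" using i by (simp add: graft2_eq)
  then show "length (relab (graft2 i \<xi>) \<sigma>) = length (contract i (relab \<xi> \<sigma>))"
    using length_contract[of i "relab \<xi> \<sigma>"] i by simp
  fix j assume "j < length (relab (graft2 i \<xi>) \<sigma>)"
  then have j: "j < length (graft2 i \<xi>)" "Suc j < length \<xi>" using len by auto
  let ?a = "map arity \<xi>"
  consider "j < i" | "j = i" | k where "j = Suc (i + k)" by (metis add_Suc_right less_iff_Suc_add linorder_neqE_nat)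
  then show "relab (graft2 i \<xi>) \<sigma> ! j = contract i (relab \<xi> \<sigma>) ! j"
  proof cases
    case 1
    then have "graft2 i \<xi> ! j = \<xi> ! j" "take j (map arity (graft2 i \<xi>)) = take j ?a"
      unfolding map_arity_graft2[OF i] using i by (simp_all add: graft2_eq nth_append min_def)
    then show ?thesis
      using 1 i j by (simp add: nth_relab contract_def nth_append)
  next
    case 2
    have t: "take i (map arity (graft2 i \<xi>)) = take i ?a"
      unfolding map_arity_graft2[OF i] using i by simp
    have "sum_list (take (Suc i) ?a) = sum_list (take i ?a) + arity (\<xi> ! i)"
      using i by (simp add: take_Suc_conv_app_nth)
    then have s: "inv \<sigma> (sum_list (take i ?a) + (arity (\<xi> ! i) + k)) = inv \<sigma> (sum_list (take (Suc i) ?a) + k)" for k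
      by (simp only: add.assoc)
    have "graft2 i \<xi> ! i = Br (\<xi> ! i) (rename (\<lambda>k. arity (\<xi> ! i) + k) (\<xi> ! Suc i))"
      using i by (simp add: graft2_eq nth_append)
    then show ?thesis
      using 2 i j t s by (simp add: nth_relab contract_def nth_append rename_rename del: take_Suc)
  next
    case 3
    have g: "graft2 i \<xi> ! j = \<xi> ! Suc j"
      using 3 i j by (simp add: graft2_eq nth_append)
    have "take (Suc j) ?a = take (Suc (Suc i)) ?a @ take k (drop (Suc (Suc i)) ?a)"
      using take_add[of "Suc (Suc i)" k ?a] 3 by simp
    moreover have "take (Suc (Suc i)) ?a = take i ?a @ [?a ! i, ?a ! Suc i]"
      using i by (simp add: take_Suc_conv_app_nth)
    ultimately have "sum_list (take j (map arity (graft2 i \<xi>))) = sum_list (take (Suc j) ?a)"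
      unfolding map_arity_graft2[OF i] using 3 i by simp
    then show ?thesis
      using 3 i j g by (simp add: nth_relab contract_def nth_append)
  qed
qed


section \<open>The differential of the presented complex and its homology\<close>

abbreviation K :: "(gelem, 'k::comm_ring_1) dg_smod" where
  "K \<equiv> twisted_composite C3 kappa_tilde Lie"

definition agens :: "nat \<Rightarrow> gelem set" where
  "agens n = {((l, \<tau>), \<nu>s, \<sigma>). ((l, \<tau>), \<nu>s, \<sigma>) \<in> ggens \<and> sum_list (map arity \<nu>s) = n}"

lemma diff_K:
  "diff K ((l, \<tau>), \<nu>s, \<sigma>) = (lin (\<lambda>(m, \<tau>'). sgl ((m, \<tau>' \<circ> \<tau>), \<nu>s, \<sigma>)) (lab_diff l)
    + lin (\<lambda>(m, i, \<tau>'). sgl ((m, id), graft2 i (perm_list (\<tau>' \<circ> \<tau>) \<nu>s), block_perm (\<tau>' \<circ> \<tau>) (map arity \<nu>s) \<circ> \<sigma>)) (tw l)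
    :: _ \<Rightarrow>\<^sub>0 'k::comm_ring_1)"
  by (simp add: twisted_composite_def composite_def composite_diff_def twist_eq) (simp add: case_prod_unfold)

lemma tw_agens:
  assumes g: "((l, \<tau>), \<nu>s, \<sigma>) \<in> agens n" and m: "lab_ar l = Suc (lab_ar m)" "Suc i < lab_ar l"
    and \<tau>': "\<tau>' permutes {1..lab_ar l}"
  shows "((m, id), graft2 i (perm_list (\<tau>' \<circ> \<tau>) \<nu>s), block_perm (\<tau>' \<circ> \<tau>) (map arity \<nu>s) \<circ> \<sigma>) \<in> agens n"
    and "to_list ((m, id), graft2 i (perm_list (\<tau>' \<circ> \<tau>) \<nu>s), block_perm (\<tau>' \<circ> \<tau>) (map arity \<nu>s) \<circ> \<sigma>)
      = (m, contract i (perm_list \<tau>' (perm_list \<tau> (relab \<nu>s \<sigma>))))"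
proof -
  have g': "\<tau> permutes {1..length \<nu>s}" "set \<nu>s \<subseteq> lie_gens" "length \<nu>s = lab_ar l"
      "\<sigma> permutes {1..sum_list (map arity \<nu>s)}" "sum_list (map arity \<nu>s) = n"
    using g by (auto simp: agens_def ggens_def)
  have p: "(\<tau>' \<circ> \<tau>) permutes {1..length \<nu>s}" using permutes_compose[OF g'(1)] \<tau>' g'(3) by simp
  let ?\<xi> = "perm_list (\<tau>' \<circ> \<tau>) \<nu>s"
  have i: "Suc i < length ?\<xi>" using m g' by simp
  have ms: "mset ?\<xi> = mset \<nu>s" by (rule mset_perm_list[OF p])
  have lg: "set ?\<xi> \<subseteq> lie_gens" using g'(2) mset_eq_setD[OF ms] by simp
  have s: "sum_list (map arity ?\<xi>) = n"
    using g'(5) ms by (metis mset_map sum_mset_sum_list)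
  have "sum_list (map arity (graft2 i ?\<xi>)) = n"
    using sum_list_two[of i "map arity ?\<xi>"] i s by (simp add: map_arity_graft2)
  moreover have "set (graft2 i ?\<xi>) \<subseteq> lie_gens"
  proof -
    have "?\<xi> ! i \<in> lie_gens" "?\<xi> ! Suc i \<in> lie_gens" using lg i by (auto simp: subset_iff)
    then show ?thesis
      using lie_gens_graft lg i by (auto simp: graft2_eq dest!: in_set_takeD in_set_dropD)
  qed
  moreover have "block_perm (\<tau>' \<circ> \<tau>) (map arity \<nu>s) permutes {1..n}"
    using block_perm_permutes(1)[of "\<tau>' \<circ> \<tau>" "map arity \<nu>s"] p g'(5) by simp
  then have "(block_perm (\<tau>' \<circ> \<tau>) (map arity \<nu>s) \<circ> \<sigma>) permutes {1..n}"
    using g'(4,5) permutes_compose by blast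
  moreover have "length (graft2 i ?\<xi>) = lab_ar m" using i g'(3) m by (simp add: graft2_eq)
  ultimately show "((m, id), graft2 i ?\<xi>, block_perm (\<tau>' \<circ> \<tau>) (map arity \<nu>s) \<circ> \<sigma>) \<in> agens n"
    by (simp add: agens_def ggens_def permutes_id)
  have "relab ?\<xi> (block_perm (\<tau>' \<circ> \<tau>) (map arity \<nu>s) \<circ> \<sigma>) = perm_list (\<tau>' \<circ> \<tau>) (relab \<nu>s \<sigma>)"
    by (rule relab_block_perm[OF g'(2) p g'(4)])
  also have "\<dots> = perm_list \<tau>' (perm_list \<tau> (relab \<nu>s \<sigma>))"
    using g' \<tau>' by (intro perm_list_perm_list[symmetric]) auto
  finally show "to_list ((m, id), graft2 i ?\<xi>, block_perm (\<tau>' \<circ> \<tau>) (map arity \<nu>s) \<circ> \<sigma>)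
      = (m, contract i (perm_list \<tau>' (perm_list \<tau> (relab \<nu>s \<sigma>))))"
    using relab_graft2[OF i] by (simp add: to_list_def)
qed

text \<open>\<open>to_list\<close> commutes with the differentials on the generators themselves,
  before any relators are divided out; so cycles and boundaries can be moved between the two
  complexes.\<close>

lemma diff_K_to_list:
  assumes g: "g \<in> agens n"
  shows "(diff K g :: _ \<Rightarrow>\<^sub>0 'k::comm_ring_1) \<in> over (agens n)" "tl_lin (diff K g) = (bd (to_list g) :: _ \<Rightarrow>\<^sub>0 'k)"
proof -
  obtain l \<tau> \<nu>s \<sigma> where gl: "g = ((l, \<tau>), \<nu>s, \<sigma>)" by (metis prod.exhaust)
  note g' = g[unfolded gl]
  let ?A = "lin (\<lambda>(m, \<tau>'). sgl ((m, \<tau>' \<circ> \<tau>), \<nu>s, \<sigma>)) (lab_diff l) :: _ \<Rightarrow>\<^sub>0 'k"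
  let ?B = "lin (\<lambda>(m, i, \<tau>'). sgl ((m, id), graft2 i (perm_list (\<tau>' \<circ> \<tau>) \<nu>s), block_perm (\<tau>' \<circ> \<tau>) (map arity \<nu>s) \<circ> \<sigma>)) (tw l) :: _ \<Rightarrow>\<^sub>0 'k"
  have \<tau>: "\<tau> permutes {1..lab_ar l}" and len: "length \<nu>s = lab_ar l" using g' by (auto simp: agens_def ggens_def)
  have "?A \<in> over (agens n)"
    by (rule over_lin[OF lab_diff_over]) (use g' \<tau> in \<open>auto simp: agens_def ggens_def intro!: over_single permutes_compose\<close>)
  moreover have "?B \<in> over (agens n)"
    by (rule over_lin[OF tw_over]) (auto intro!: over_single tw_agens(1)[OF g'])
  ultimately show "(diff K g :: _ \<Rightarrow>\<^sub>0 'k) \<in> over (agens n)"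
    unfolding gl diff_K by (rule over_add)
  have "tl_lin ?A = lin (\<lambda>p. sgl (fst p, perm_list (snd p) (perm_list \<tau> (relab \<nu>s \<sigma>)))) (lab_diff l)"
    unfolding lin_lin
    by (rule over_lin_cong[OF lab_diff_over]) (use \<tau> len in \<open>auto simp: to_list_def perm_list_perm_list\<close>)
  moreover have "tl_lin ?B = lin (\<lambda>p. sgl (fst p, contract (fst (snd p)) (perm_list (snd (snd p)) (perm_list \<tau> (relab \<nu>s \<sigma>))))) (tw l)"
    unfolding lin_lin
    by (rule over_lin_cong[OF tw_over]) (auto simp: tw_agens(2)[OF g'])
  ultimately show "tl_lin (diff K g) = (bd (to_list g) :: _ \<Rightarrow>\<^sub>0 'k)"
    unfolding gl diff_K lin_add by (simp add: bd_def to_list_def case_prod_unfold)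
qed

lemma rels_K: "rels K = crels"
  by (simp add: twisted_composite_def composite_def)

lemma dg_chains_K: "dg_chains (K :: (gelem, 'k::comm_ring_1) dg_smod) n r = over {((l, \<tau>), \<nu>s, \<sigma>). ((l, \<tau>), \<nu>s, \<sigma>) \<in> agens n \<and> lab_dgr l = r}"
proof -
  let ?K = "K :: (gelem, 'k) dg_smod"
  have *: "gens ?K = ggens"
    using composite_gens_eq by (simp add: twisted_composite_def composite_def)
  have "{g \<in> gens ?K. ar ?K g = n \<and> dgr ?K g = r} = {((l, \<tau>), \<nu>s, \<sigma>). ((l, \<tau>), \<nu>s, \<sigma>) \<in> agens n \<and> lab_dgr l = r}"
    unfolding * by (auto simp: twisted_composite_def composite_def agens_def)
  then show ?thesis by (simp only: dg_chains_def over_def)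
qed

text \<open>In arity 1 the complex is spanned by the composite of the units, in degree 0 with zero
  differential, so its homology there is the ground ring; this is the excluded pair.\<close>

theorem proposition2p3:
  fixes n :: nat and r :: int
  assumes "r \<le> 3" and "(n, r) \<noteq> (1, 0)"
  shows "homology_vanishes
    (twisted_composite (lie_diamond3 :: (lie3_gen, 'k::comm_ring_1) dg_cooperad) kappa_tilde lie) n r"
proof -
  let ?K = "K :: (gelem, 'k) dg_smod"
  let ?Z = "dg_cycles ?K n r" and ?B = "dg_boundaries ?K n r"
  have to_list: "to_list g \<in> valid n" if "g \<in> agens n" for g
    using that to_list_valid by (auto simp: agens_def)
  have "x \<in> ?B" if x: "x \<in> ?Z" for x
  proof -
    have xc: "x \<in> over {((l, \<tau>), \<nu>s, \<sigma>). ((l, \<tau>), \<nu>s, \<sigma>) \<in> agens n \<and> lab_dgr l = r}"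
      and cyc: "lin (diff ?K) x \<in> free_mod.span crels"
      using x by (simp_all only: dg_cycles_def dg_chains_K rels_K mem_Collect_eq)
    have xa: "x \<in> over (agens n)" by (rule over_mono[OF xc]) auto
    have tl_diff: "tl_lin (lin (diff ?K) y) = lin bd (tl_lin y)" if "y \<in> over (agens n)" for y
      using over_lin_cong[OF that diff_K_to_list(2)] by simp
    have "tl_lin x \<in> over (lchains n r)"
      by (rule over_lin[OF xc]) (use to_list in \<open>auto simp: lchains_def to_list_def\<close>)
    moreover have "lin (\<lambda>g. lin NF (sgl (to_list g))) (lin (diff ?K) x) = 0"
      by (rule lin_span_eq_0[OF cyc]) (use NF_crels in simp)
    then have "lin NF (tl_lin (lin (diff ?K) x)) = 0"
      by (simp only: lin_lin)
    then have "lin NF (lin bd (tl_lin x)) = 0"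
      by (simp only: tl_diff[OF xa])
    ultimately obtain y where y: "y \<in> over (lchains n (r + 1))" and eq: "lin NF (tl_lin x - lin bd y) = 0"
      using chains_exact[OF assms] by metis
    let ?y = "lin (\<lambda>h. sgl (lift h)) y"
    have lift_n: "lift h \<in> agens n \<and> lab_dgr (fst (fst (lift h))) = r + 1 \<and> to_list (lift h) = h" if "h \<in> lchains n (r + 1)" for h
    proof -
      have h: "h \<in> valid n" "lab_dgr (fst h) = r + 1" using that by (auto simp: lchains_def)
      obtain l \<tau> \<nu>s \<sigma> where s: "lift h = ((l, \<tau>), \<nu>s, \<sigma>)" by (metis prod.exhaust)
      have "((l, \<tau>), \<nu>s, \<sigma>) \<in> ggens" "to_list ((l, \<tau>), \<nu>s, \<sigma>) = h" using lift[OF h(1)] by (simp_all only: s)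
      moreover from this have "h \<in> valid (sum_list (map arity \<nu>s))" using to_list_valid by metis
      then have "{1..sum_list (map arity \<nu>s)} = {1..n}" using h(1) by (auto simp: valid_def)
      then have "sum_list (map arity \<nu>s) = n" by (metis card_atLeastAtMost diff_Suc_1)
      ultimately show ?thesis using h(2) by (auto simp: s agens_def to_list_def)
    qed
    have yc: "?y \<in> dg_chains ?K n (r + 1)"
      unfolding dg_chains_K
    proof (rule over_lin[OF y], rule over_single)
      fix h assume "h \<in> lchains n (r + 1)"
      from lift_n[OF this] show "lift h \<in> {((l, \<tau>), \<nu>s, \<sigma>). ((l, \<tau>), \<nu>s, \<sigma>) \<in> agens n \<and> lab_dgr l = r + 1}"
        by (cases "lift h") auto
    qed
    have ya: "?y \<in> over (agens n)"
      by (rule over_lin[OF y]) (use lift_n in \<open>auto intro: over_single\<close>)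
    have "tl_lin ?y = lin sgl y"
      unfolding lin_lin by (rule over_lin_cong[OF y]) (use lift_n in auto)
    then have "lin NF (tl_lin (x - lin (diff ?K) ?y)) = 0"
      using eq tl_diff[OF ya] by (simp del: lin_lin)
    moreover have "x - lin (diff ?K) ?y \<in> over (agens n)"
      by (rule over_diff[OF xa over_lin[OF ya diff_K_to_list(1)]])
    ultimately have "x - lin (diff ?K) ?y \<in> free_mod.span crels"
      unfolding agens_def by (intro NF_to_list_eq_0)
    then show ?thesis
      using xc yc unfolding dg_boundaries_def rels_K mem_Collect_eq dg_chains_K by blast
  qed
  moreover have "0 \<in> ?Z"
    by (simp add: dg_cycles_def dg_chains_K free_mod.span_zero)
  \<comment> \<open>Every cycle is a boundary by now; that the boundaries form a subgroup makes the
    quotient a single coset.\<close>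
  moreover have "x - y \<in> ?B" if "x \<in> ?B" "y \<in> ?B" for x y
  proof -
    obtain x' where x': "x' \<in> dg_chains ?K n (r + 1)" "x - lin (diff ?K) x' \<in> free_mod.span crels"
      using \<open>x \<in> ?B\<close> by (auto simp: dg_boundaries_def rels_K)
    obtain y' where y': "y' \<in> dg_chains ?K n (r + 1)" "y - lin (diff ?K) y' \<in> free_mod.span crels"
      using \<open>y \<in> ?B\<close> by (auto simp: dg_boundaries_def rels_K)
    have "x - y - lin (diff ?K) (x' - y') = (x - lin (diff ?K) x') - (y - lin (diff ?K) y')"
      by simp
    also have "\<dots> \<in> free_mod.span crels"
      by (rule free_mod.span_diff[OF x'(2) y'(2)])
    finally have "x - y - lin (diff ?K) (x' - y') \<in> free_mod.span crels" .
    moreover have "x' - y' \<in> dg_chains ?K n (r + 1)" "x - y \<in> dg_chains ?K n r"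
      using x'(1) y'(1) that by (auto simp: dg_boundaries_def dg_chains_K intro: over_diff)
    ultimately show ?thesis
      unfolding dg_boundaries_def rels_K by blast
  qed
  ultimately have "homology ?K n r = {?B}"
  proof -
    assume ZB: "\<And>x. x \<in> ?Z \<Longrightarrow> x \<in> ?B" and 0: "0 \<in> ?Z" and sub: "\<And>x y. x \<in> ?B \<Longrightarrow> y \<in> ?B \<Longrightarrow> x - y \<in> ?B"
    have "{(x, y). x - y \<in> ?B} `` {x} = ?B" if "x \<in> ?Z" for x
    proof (intro equalityI subsetI)
      fix y assume "y \<in> {(x, y). x - y \<in> ?B} `` {x}"
      then show "y \<in> ?B" using sub[OF ZB[OF that], of "x - y"] by simp
    next
      fix y assume "y \<in> ?B"
      then show "y \<in> {(x, y). x - y \<in> ?B} `` {x}" using sub[OF ZB[OF that]] by simp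
    qed
    then show ?thesis using 0 by (auto simp: homology_def quotient_def)
  qed
  then show ?thesis by (simp only: homology_vanishes_def)
qed

end
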